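(* Let $T=(T_1,\dots,T_d)$ be a nilpotent commuting row contraction on some Hilbert space $\mathfrak{H}$. Set \[ \mathcal{A}=\mathbb{C}[x_1,\dots,x_d]/(\mathbb{C}[x_1,\dots,x_d]\cap \mathrm{Ann}_{\mathrm{c}}(T)). \] Then, for any positive integer $s\geq \dim\mathcal{A}$, the ampliation $T^{(s)}$ has a dense set of separating vectors in $\mathfrak{H}^{(s)}$.
   Context: Fix a positive integer $d$. The Drury--Arveson space $H^2_d$ is the Hilbert space of analytic functions $f=\sum_{\alpha\in\mathbb{N}^d}c_\alpha x^\alpha$ on the open unit ball $\mathbb{B}_d\subset\mathbb{C}^d$ with $\|f\|^2=\sum_{\alpha}\frac{\alpha!}{|\alpha|!}|c_\alpha|^2<\infty$; $x_1,\dots,x_d$ are the coordinate functions. $\mathcal{M}_d$ is its multiplier algebra, viewed as a weak-$*$ closed unital subalgebra of $B(H^2_d)$ via $\phi\mapsto M_\phi$, $M_\phi f=\phi f$; it contains all polynomials. A $d$-tuple $T=(T_1,\dots,T_d)$ of bounded operators on $\mathfrak{H}$ is a row contraction if $\sum_{k=1}^d T_kT_k^*\le I$; it is commuting if the $T_k$ commute with each other; it is pure if $\lim_{n\to\infty}\sum_{|w|=n}\|T_w^*\xi\|^2=0$ for all $\xi\in\mathfrak{H}$, where $w=i_1\cdots i_n$ ranges over words of length $n$ in $\{1,\dots,d\}$ and $T_w=T_{i_1}\cdots T_{i_n}$. A commuting $d$-tuple is nilpotent if for each $k$ there is $m_k\in\mathbb{N}$ with $T_k^{m_k}=0$; a nilpotent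 commuting row contraction is pure. For a pure commuting row contraction $T$ there is a unique unital completely contractive weak-$*$ continuous homomorphism $\mathcal{M}_d\to B(\mathfrak{H})$ sending $M_{x_k}$ to $T_k$ for each $k$; the image of $\theta$ is written $\theta(T)$. $\mathrm{Ann}_{\mathrm{c}}(T)=\{\theta\in\mathcal{M}_d:\theta(T)=0\}$. A vector $\xi$ is separating for $T$ if for every $\theta\in\mathcal{M}_d$, $\theta(T)\xi=0$ implies $\theta(T)=0$. For a positive integer $n$, $\mathfrak{H}^{(n)}=\mathfrak{H}\oplus\cdots\oplus\mathfrak{H}$ ($n$ copies) and $T^{(n)}=T\oplus\cdots\oplus T$ is the $d$-tuple on $\mathfrak{H}^{(n)}$ with entries $T_k\oplus\cdots\oplus T_k$. *)

theory Defs
  imports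
    "HOL-Analysis.Analysis"
    "HOL-Library.Poly_Mapping"
    "HOL-Algebra.Embedded_Algebras"
begin

section \<open>Complex Hilbert spaces\<close>

class scaleC =
  fixes scaleC :: "complex \<Rightarrow> 'a \<Rightarrow> 'a" (infixr \<open>*\<^sub>C\<close> 75)

class complex_normed_vector = scaleC + real_normed_vector +
  assumes scaleC_add_right: "c *\<^sub>C (x + y) = c *\<^sub>C x + c *\<^sub>C y"
    and scaleC_add_left: "(b + c) *\<^sub>C x = b *\<^sub>C x + c *\<^sub>C x"
    and scaleC_scaleC: "b *\<^sub>C c *\<^sub>C x = (b * c) *\<^sub>C x"
    and scaleR_scaleC: "r *\<^sub>R x = complex_of_real r *\<^sub>C x"
    and norm_scaleC: "norm (c *\<^sub>C x) = cmod c * norm x"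

text \<open>The inner product is linear in its first argument.\<close>

class complex_inner = complex_normed_vector +
  fixes cinner :: "'a \<Rightarrow> 'a \<Rightarrow> complex"
  assumes cinner_commute: "cinner x y = cnj (cinner y x)"
    and cinner_add_left: "cinner (x + y) z = cinner x z + cinner y z"
    and cinner_scaleC_left: "cinner (c *\<^sub>C x) y = c * cinner x y"
    and norm_eq_sqrt_cinner: "norm x = sqrt (Re (cinner x x))"

class chilbert_space = complex_inner + complete_space

instantiation vec :: (complex_inner, finite) complex_inner
begin

definition scaleC_vec :: "complex \<Rightarrow> 'a ^ 'b \<Rightarrow> 'a ^ 'b" where
  "c *\<^sub>C x = (\<chi> i. c *\<^sub>C (x $ i))"

definition cinner_vec :: "'a ^ 'b \<Rightarrow> 'a ^ 'b \<Rightarrow> complex" where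
  "cinner x y = (\<Sum>i\<in>UNIV. cinner (x $ i) (y $ i))"

instance
proof
  fix x y z :: "'a ^ 'b" and b c :: complex and r :: real
  show "c *\<^sub>C (x + y) = c *\<^sub>C x + c *\<^sub>C y"
    by (simp add: vec_eq_iff scaleC_vec_def scaleC_add_right)
  show "(b + c) *\<^sub>C x = b *\<^sub>C x + c *\<^sub>C x"
    by (simp add: vec_eq_iff scaleC_vec_def scaleC_add_left)
  show "b *\<^sub>C c *\<^sub>C x = (b * c) *\<^sub>C x"
    by (simp add: vec_eq_iff scaleC_vec_def scaleC_scaleC)
  show "r *\<^sub>R x = complex_of_real r *\<^sub>C x"
    by (simp add: vec_eq_iff scaleC_vec_def scaleR_scaleC)
  show "norm (c *\<^sub>C x) = cmod c * norm x"
    by (simp add: norm_vec_def scaleC_vec_def norm_scaleC L2_set_right_distrib)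
  show "cinner x y = cnj (cinner y x)"
    unfolding cinner_vec_def cnj_sum by (rule sum.cong[OF refl]) (rule cinner_commute)
  show "cinner (x + y) z = cinner x z + cinner y z"
    by (simp add: cinner_vec_def cinner_add_left sum.distrib)
  show "cinner (c *\<^sub>C x) y = c * cinner x y"
    by (simp add: cinner_vec_def scaleC_vec_def cinner_scaleC_left sum_distrib_left)
  have "(norm v)\<^sup>2 = Re (cinner v v)" for v :: 'a
    using norm_ge_zero[of v] unfolding norm_eq_sqrt_cinner by simp
  then show "norm x = sqrt (Re (cinner x x))"
    by (simp add: norm_vec_def L2_set_def cinner_vec_def)
qed

end

instance vec :: (chilbert_space, finite) chilbert_space ..


section \<open>Bounded operators\<close>

text \<open>The library type of bounded operators only demands real linearity; \<open>bops\<close> is \<open>B(H)\<close>.\<close>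

definition bops :: "('a::complex_normed_vector \<Rightarrow>\<^sub>L 'a) set" where
  "bops = {A :: 'a \<Rightarrow>\<^sub>L 'a. \<forall>c x. A (c *\<^sub>C x) = c *\<^sub>C A x}"

instantiation blinfun :: (real_normed_vector, complex_normed_vector) scaleC
begin

lift_definition scaleC_blinfun :: "complex \<Rightarrow> ('a \<Rightarrow>\<^sub>L 'b) \<Rightarrow> ('a \<Rightarrow>\<^sub>L 'b)" is "\<lambda>c f x. c *\<^sub>C f x"
proof -
  fix c :: complex and f :: "'a \<Rightarrow> 'b"
  assume "bounded_linear f"
  then interpret f: bounded_linear f .
  obtain K where K: "\<And>x. norm (f x) \<le> norm x * K"
    using f.bounded by blast
  show "bounded_linear (\<lambda>x. c *\<^sub>C f x)"
  proof (rule bounded_linear_intro[where K = "cmod c * K"])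
    show "c *\<^sub>C f (x + y) = c *\<^sub>C f x + c *\<^sub>C f y" for x y
      by (simp add: f.add scaleC_add_right)
    show "c *\<^sub>C f (r *\<^sub>R x) = r *\<^sub>R (c *\<^sub>C f x)" for r x
      by (simp add: f.scale scaleR_scaleC scaleC_scaleC mult.commute)
    show "norm (c *\<^sub>C f x) \<le> norm x * (cmod c * K)" for x
      using mult_left_mono[OF K[of x], of "cmod c"] by (simp add: norm_scaleC mult_ac)
  qed
qed

instance ..

end

definition adj :: "('a::chilbert_space \<Rightarrow>\<^sub>L 'a) \<Rightarrow> ('a \<Rightarrow>\<^sub>L 'a)" where
  "adj A = (THE B :: 'a \<Rightarrow>\<^sub>L 'a. \<forall>x y. cinner (A x) y = cinner x (B y))"

definition op_le :: "('a::complex_inner \<Rightarrow>\<^sub>L 'a) \<Rightarrow> ('a \<Rightarrow>\<^sub>L 'a) \<Rightarrow> bool" where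
  "op_le A B \<longleftrightarrow> (\<forall>x. cinner ((B - A) x) x \<in> \<real> \<and> 0 \<le> Re (cinner ((B - A) x) x))"

text \<open>
  The weak-* topology on \<open>B(H)\<close> as the dual of the trace class operators: the normal functionals
  are \<open>A \<mapsto> \<Sum>n. \<langle>A (x n), y n\<rangle>\<close> with square summable \<open>x\<close> and \<open>y\<close>.
\<close>

definition normal_functional ::
  "(nat \<Rightarrow> 'a::complex_inner) \<Rightarrow> (nat \<Rightarrow> 'a) \<Rightarrow> ('a \<Rightarrow>\<^sub>L 'a) \<Rightarrow> complex" where
  "normal_functional x y A = suminf (\<lambda>n. cinner (A (x n)) (y n))"

definition weak_star :: "('a::complex_inner \<Rightarrow>\<^sub>L 'a) topology" where
  "weak_star = topology_generated_by
     {{A \<in> bops. normal_functional x y A \<in> U} | x y U.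
        summable (\<lambda>n. (norm (x n))\<^sup>2) \<and> summable (\<lambda>n. (norm (y n))\<^sup>2) \<and> open U}"

text \<open>The norm of an \<open>n \<times> n\<close> matrix of operators, acting on the direct sum of \<open>n\<close> copies of \<open>H\<close>.\<close>

definition matrix_norm :: "nat \<Rightarrow> (nat \<Rightarrow> nat \<Rightarrow> ('a::complex_inner \<Rightarrow>\<^sub>L 'a)) \<Rightarrow> real" where
  "matrix_norm n A =
     (SUP \<xi>\<in>{\<xi>. L2_set (\<lambda>j. norm (\<xi> j)) {..<n} \<le> 1}.
        L2_set (\<lambda>i. norm (\<Sum>j<n. A i j (\<xi> j))) {..<n})"


section \<open>The Drury--Arveson space\<close>

definition multi_power :: "complex ^ 'd::finite \<Rightarrow> ('d \<Rightarrow>\<^sub>0 nat) \<Rightarrow> complex" where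
  "multi_power z \<alpha> = (\<Prod>k\<in>UNIV. (z $ k) ^ Poly_Mapping.lookup \<alpha> k)"

definition da_weight :: "('d::finite \<Rightarrow>\<^sub>0 nat) \<Rightarrow> real" where
  "da_weight \<alpha> = (\<Prod>k\<in>UNIV. fact (Poly_Mapping.lookup \<alpha> k)) / fact (\<Sum>k\<in>UNIV. Poly_Mapping.lookup \<alpha> k)"

lemma da_weight_pos: "da_weight \<alpha> > 0"
  unfolding da_weight_def by (intro divide_pos_pos prod_pos) auto

text \<open>
  An element \<open>f = \<Sum>\<alpha>. c \<alpha> x\<^sup>\<alpha>\<close> is stored as its family of Taylor coefficients \<open>c\<close>; the function
  on the open unit ball that it denotes is \<open>da_eval f\<close>.
\<close>

typedef (overloaded) 'd drury_arveson =
  "{c :: ('d::finite \<Rightarrow>\<^sub>0 nat) \<Rightarrow> complex. (\<lambda>\<alpha>. da_weight \<alpha> * (cmod (c \<alpha>))\<^sup>2) summable_on UNIV}"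
  morphisms da_coeff Abs_da
  by (rule exI[of _ "\<lambda>_. 0"]) simp

setup_lifting type_definition_drury_arveson

lemma da_summable_mult:
  fixes c :: "('d::finite \<Rightarrow>\<^sub>0 nat) \<Rightarrow> complex"
  assumes "(\<lambda>\<alpha>. da_weight \<alpha> * (cmod (c \<alpha>))\<^sup>2) summable_on UNIV"
  shows "(\<lambda>\<alpha>. da_weight \<alpha> * (cmod (a * c \<alpha>))\<^sup>2) summable_on UNIV"
  using summable_on_cmult_right[OF assms, of "(cmod a)\<^sup>2"]
  by (simp add: norm_mult power_mult_distrib mult_ac)

lemma da_summable_add:
  fixes c d :: "('d::finite \<Rightarrow>\<^sub>0 nat) \<Rightarrow> complex"
  assumes "(\<lambda>\<alpha>. da_weight \<alpha> * (cmod (c \<alpha>))\<^sup>2) summable_on UNIV"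
    and "(\<lambda>\<alpha>. da_weight \<alpha> * (cmod (d \<alpha>))\<^sup>2) summable_on UNIV"
  shows "(\<lambda>\<alpha>. da_weight \<alpha> * (cmod (c \<alpha> + d \<alpha>))\<^sup>2) summable_on UNIV"
proof (rule summable_on_comparison_test)
  show "(\<lambda>\<alpha>. 2 * (da_weight \<alpha> * (cmod (c \<alpha>))\<^sup>2 + da_weight \<alpha> * (cmod (d \<alpha>))\<^sup>2)) summable_on UNIV"
    by (intro summable_on_cmult_right summable_on_add assms)
  show "da_weight \<alpha> * (cmod (c \<alpha> + d \<alpha>))\<^sup>2
      \<le> 2 * (da_weight \<alpha> * (cmod (c \<alpha>))\<^sup>2 + da_weight \<alpha> * (cmod (d \<alpha>))\<^sup>2)" for \<alpha>
  proof -
    have "(cmod (c \<alpha> + d \<alpha>))\<^sup>2 \<le> (cmod (c \<alpha>) + cmod (d \<alpha>))\<^sup>2"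
      by (intro power_mono norm_triangle_ineq) simp
    also have "\<dots> \<le> 2 * ((cmod (c \<alpha>))\<^sup>2 + (cmod (d \<alpha>))\<^sup>2)"
      using sum_squares_bound[of "cmod (c \<alpha>)" "cmod (d \<alpha>)"] by (simp add: power2_sum)
    finally show ?thesis
      using mult_left_mono[of _ _ "da_weight \<alpha>"] da_weight_pos[of \<alpha>]
      by (fastforce simp: distrib_left mult.left_commute)
  qed
  show "0 \<le> da_weight \<alpha> * (cmod (c \<alpha> + d \<alpha>))\<^sup>2" for \<alpha>
    using da_weight_pos[of \<alpha>] by simp
qed

instantiation drury_arveson :: (finite) "{zero, plus, minus, uminus, scaleR, scaleC}"
begin

lift_definition zero_drury_arveson :: "'a drury_arveson" is "\<lambda>_. 0"
  by simp

lift_definition plus_drury_arveson ::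
  "'a drury_arveson \<Rightarrow> 'a drury_arveson \<Rightarrow> 'a drury_arveson" is "\<lambda>c d \<alpha>. c \<alpha> + d \<alpha>"
  by (rule da_summable_add)

lift_definition minus_drury_arveson ::
  "'a drury_arveson \<Rightarrow> 'a drury_arveson \<Rightarrow> 'a drury_arveson" is "\<lambda>c d \<alpha>. c \<alpha> - d \<alpha>"
  using da_summable_add[OF _ da_summable_mult[where a = "- 1"]] by fastforce

lift_definition uminus_drury_arveson :: "'a drury_arveson \<Rightarrow> 'a drury_arveson" is "\<lambda>c \<alpha>. - c \<alpha>"
  by simp

lift_definition scaleC_drury_arveson :: "complex \<Rightarrow> 'a drury_arveson \<Rightarrow> 'a drury_arveson"
  is "\<lambda>a c \<alpha>. a * c \<alpha>"
  by (rule da_summable_mult)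

lift_definition scaleR_drury_arveson :: "real \<Rightarrow> 'a drury_arveson \<Rightarrow> 'a drury_arveson"
  is "\<lambda>r c \<alpha>. complex_of_real r * c \<alpha>"
  by (rule da_summable_mult)

instance ..

end

definition da_inner :: "'d::finite drury_arveson \<Rightarrow> 'd drury_arveson \<Rightarrow> complex" where
  "da_inner f g = (\<Sum>\<^sub>\<infinity>\<alpha>. complex_of_real (da_weight \<alpha>) * (da_coeff f \<alpha> * cnj (da_coeff g \<alpha>)))"

definition da_norm :: "'d::finite drury_arveson \<Rightarrow> real" where
  "da_norm f = sqrt (\<Sum>\<^sub>\<infinity>\<alpha>. da_weight \<alpha> * (cmod (da_coeff f \<alpha>))\<^sup>2)"

lemmas da_coeff_simps = zero_drury_arveson.rep_eq plus_drury_arveson.rep_eq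
  minus_drury_arveson.rep_eq uminus_drury_arveson.rep_eq scaleC_drury_arveson.rep_eq
  scaleR_drury_arveson.rep_eq

lemma da_eq_iff: "f = g \<longleftrightarrow> (\<forall>\<alpha>. da_coeff f \<alpha> = da_coeff g \<alpha>)"
  by (metis da_coeff_inject ext)

lemma da_summable: "(\<lambda>\<alpha>. da_weight \<alpha> * (cmod (da_coeff f \<alpha>))\<^sup>2) summable_on UNIV"
  using da_coeff by blast

lemma da_inner_summable:
  "(\<lambda>\<alpha>. complex_of_real (da_weight \<alpha>) * (da_coeff f \<alpha> * cnj (da_coeff g \<alpha>))) summable_on UNIV"
proof (rule abs_summable_summable, rule summable_on_comparison_test)
  show "(\<lambda>\<alpha>. da_weight \<alpha> * (cmod (da_coeff f \<alpha>))\<^sup>2 + da_weight \<alpha> * (cmod (da_coeff g \<alpha>))\<^sup>2)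
      summable_on UNIV"
    by (intro summable_on_add da_summable)
  show "norm (complex_of_real (da_weight \<alpha>) * (da_coeff f \<alpha> * cnj (da_coeff g \<alpha>)))
      \<le> da_weight \<alpha> * (cmod (da_coeff f \<alpha>))\<^sup>2 + da_weight \<alpha> * (cmod (da_coeff g \<alpha>))\<^sup>2" for \<alpha>
  proof -
    have sq: "x * y \<le> x\<^sup>2 + y\<^sup>2" if "x \<ge> 0" "y \<ge> 0" for x y :: real
    proof -
      have "0 \<le> x * y"
        using that by simp
      then show ?thesis
        using sum_squares_bound[of x y] by linarith
    qed
    from mult_left_mono[OF sq[of "cmod (da_coeff f \<alpha>)" "cmod (da_coeff g \<alpha>)"], of "da_weight \<alpha>"]
    show ?thesis
      using da_weight_pos[of \<alpha>] by (simp add: norm_mult distrib_left)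
  qed
qed simp_all

lemma da_weight_nonneg: "da_weight \<alpha> \<ge> 0"
  using da_weight_pos[of \<alpha>] by simp

lemma da_inner_commute: "da_inner f g = cnj (da_inner g f)"
  unfolding da_inner_def by (subst infsum_cnj[symmetric]) (simp add: mult.commute)

lemma da_inner_add: "da_inner (f + g) h = da_inner f h + da_inner g h"
  unfolding da_inner_def
  by (subst infsum_add[symmetric, OF da_inner_summable da_inner_summable])
     (simp add: da_coeff_simps algebra_simps)

lemma da_inner_scaleC: "da_inner (a *\<^sub>C f) h = a * da_inner f h"
  unfolding da_inner_def
  by (subst infsum_cmult_right'[symmetric]) (simp add: da_coeff_simps algebra_simps)

lemma da_inner_self: "da_inner f f = complex_of_real ((da_norm f)\<^sup>2)"
proof -
  have "da_inner f f = (\<Sum>\<^sub>\<infinity>\<alpha>. complex_of_real (da_weight \<alpha> * (cmod (da_coeff f \<alpha>))\<^sup>2))"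
    unfolding da_inner_def by (simp add: complex_norm_square[symmetric] of_real_power[symmetric] del: of_real_power)
  also have "\<dots> = complex_of_real (\<Sum>\<^sub>\<infinity>\<alpha>. da_weight \<alpha> * (cmod (da_coeff f \<alpha>))\<^sup>2)"
    by (intro infsumI) (simp only: has_sum_of_real_iff has_sum_infsum[OF da_summable])
  also have "\<dots> = complex_of_real ((da_norm f)\<^sup>2)"
    unfolding da_norm_def 
    by (subst real_sqrt_pow2) (auto intro!: infsum_nonneg mult_nonneg_nonneg simp: da_weight_nonneg)
  finally show ?thesis .
qed

lemma da_norm_nonneg: "da_norm f \<ge> 0"
  unfolding da_norm_def
  by (auto intro!: infsum_nonneg mult_nonneg_nonneg simp: da_weight_nonneg)

lemma da_norm_finite: "(\<Sum>\<alpha>\<in>F. da_weight \<alpha> * (cmod (da_coeff f \<alpha>))\<^sup>2) \<le> (da_norm f)\<^sup>2"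
  if "finite F" for F
proof -
  have "(\<Sum>\<alpha>\<in>F. da_weight \<alpha> * (cmod (da_coeff f \<alpha>))\<^sup>2)
      \<le> (\<Sum>\<^sub>\<infinity>\<alpha>. da_weight \<alpha> * (cmod (da_coeff f \<alpha>))\<^sup>2)"
    using that
    by (intro finite_sum_le_infsum da_summable)
       (auto intro!: mult_nonneg_nonneg simp: da_weight_nonneg)
  also have "\<dots> = (da_norm f)\<^sup>2"
    unfolding da_norm_def
    by (subst real_sqrt_pow2) (auto intro!: infsum_nonneg mult_nonneg_nonneg simp: da_weight_nonneg)
  finally show ?thesis .
qed

lemma da_norm_scaleC: "da_norm (a *\<^sub>C f) = cmod a * da_norm f"
proof -
  have "(\<Sum>\<^sub>\<infinity>\<alpha>. da_weight \<alpha> * (cmod (da_coeff (a *\<^sub>C f) \<alpha>))\<^sup>2)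
      = (cmod a)\<^sup>2 * (\<Sum>\<^sub>\<infinity>\<alpha>. da_weight \<alpha> * (cmod (da_coeff f \<alpha>))\<^sup>2)"
    by (subst infsum_cmult_right'[symmetric])
       (simp add: da_coeff_simps norm_mult power_mult_distrib mult_ac)
  then show ?thesis
    unfolding da_norm_def by (simp add: real_sqrt_mult)
qed

lemma da_norm_eq_0: "da_norm f = 0 \<longleftrightarrow> f = 0"
proof
  assume 0: "da_norm f = 0"
  have "da_coeff f \<alpha> = 0" for \<alpha>
    using da_norm_finite[of "{\<alpha>}" f] 0 da_weight_pos[of \<alpha>]
    by (simp add: mult_le_0_iff)
  then show "f = 0"
    by (simp add: da_eq_iff da_coeff_simps)
next
  assume "f = 0"
  then show "da_norm f = 0"
    by (simp add: da_norm_def da_coeff_simps)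
qed

lemma da_norm_triangle: "da_norm (f + g) \<le> da_norm f + da_norm g"
proof -
  have fin: "L2_set (\<lambda>\<alpha>. sqrt (da_weight \<alpha>) * cmod (da_coeff h \<alpha>)) F \<le> da_norm h"
    if "finite F" for F and h :: "'a drury_arveson"
    unfolding L2_set_def power_mult_distrib
    using da_norm_finite[OF that, of h] da_weight_pos da_norm_nonneg[of h]
    by (auto intro!: real_le_lsqrt sum_nonneg mult_nonneg_nonneg simp: da_weight_nonneg)
  have "(\<Sum>\<^sub>\<infinity>\<alpha>. da_weight \<alpha> * (cmod (da_coeff (f + g) \<alpha>))\<^sup>2) \<le> (da_norm f + da_norm g)\<^sup>2"
  proof (rule infsum_le_finite_sums[OF da_summable])
    fix F :: "('a \<Rightarrow>\<^sub>0 nat) set"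
    assume F: "finite F"
    have "L2_set (\<lambda>\<alpha>. sqrt (da_weight \<alpha>) * cmod (da_coeff (f + g) \<alpha>)) F
        \<le> L2_set (\<lambda>\<alpha>. sqrt (da_weight \<alpha>) * cmod (da_coeff f \<alpha>)
            + sqrt (da_weight \<alpha>) * cmod (da_coeff g \<alpha>)) F"
      by (intro L2_set_mono)
         (auto simp: da_coeff_simps norm_triangle_ineq da_weight_nonneg simp flip: distrib_left
               intro!: mult_left_mono mult_nonneg_nonneg)
    also have "\<dots> \<le> da_norm f + da_norm g"
      by (rule order_trans[OF L2_set_triangle_ineq add_mono[OF fin[OF F] fin[OF F]]])
    finally have "(L2_set (\<lambda>\<alpha>. sqrt (da_weight \<alpha>) * cmod (da_coeff (f + g) \<alpha>)) F)\<^sup>2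
        \<le> (da_norm f + da_norm g)\<^sup>2"
      by (intro power_mono) auto
    then show "(\<Sum>\<alpha>\<in>F. da_weight \<alpha> * (cmod (da_coeff (f + g) \<alpha>))\<^sup>2) \<le> (da_norm f + da_norm g)\<^sup>2"
      by (simp add: L2_set_def sum_nonneg power_mult_distrib da_weight_nonneg)
  qed
  then show ?thesis
    unfolding da_norm_def[of "f + g"]
    by (intro real_le_lsqrt) (auto intro: add_nonneg_nonneg da_norm_nonneg)
qed

instantiation drury_arveson :: (finite) real_normed_vector
begin

definition norm_drury_arveson :: "'a drury_arveson \<Rightarrow> real" where
  "norm_drury_arveson f = da_norm f"

definition dist_drury_arveson :: "'a drury_arveson \<Rightarrow> 'a drury_arveson \<Rightarrow> real" where
  "dist_drury_arveson f g = norm (f - g)"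

definition uniformity_drury_arveson :: "('a drury_arveson \<times> 'a drury_arveson) filter" where
  "uniformity_drury_arveson = (INF e\<in>{0<..}. principal {(f, g). dist f g < e})"

definition sgn_drury_arveson :: "'a drury_arveson \<Rightarrow> 'a drury_arveson" where
  "sgn_drury_arveson f = inverse (norm f) *\<^sub>R f"

definition open_drury_arveson :: "'a drury_arveson set \<Rightarrow> bool" where
  "open_drury_arveson U \<longleftrightarrow> (\<forall>f\<in>U. \<forall>\<^sub>F (f', g) in uniformity. f' = f \<longrightarrow> g \<in> U)"

instance
proof
  fix f g h :: "'a drury_arveson" and r s :: real
  have scaleR: "r *\<^sub>R f = complex_of_real r *\<^sub>C f"
    by (simp add: da_eq_iff da_coeff_simps)
  show "f + g + h = f + (g + h)" "f + g = g + f" "0 + f = f" "- f + f = 0" "f - g = f + - g"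
    by (simp_all add: da_eq_iff da_coeff_simps)
  show "r *\<^sub>R (f + g) = r *\<^sub>R f + r *\<^sub>R g" "(r + s) *\<^sub>R f = r *\<^sub>R f + s *\<^sub>R f"
      "r *\<^sub>R s *\<^sub>R f = (r * s) *\<^sub>R f" "1 *\<^sub>R f = f"
    by (simp_all add: da_eq_iff da_coeff_simps algebra_simps)
  show "dist f g = norm (f - g)" "sgn f = inverse (norm f) *\<^sub>R f"
      "uniformity = (INF e\<in>{0<..}. principal {(x, y::'a drury_arveson). dist x y < e})"
    by (simp_all add: dist_drury_arveson_def sgn_drury_arveson_def uniformity_drury_arveson_def)
  show "open U \<longleftrightarrow> (\<forall>x\<in>U. \<forall>\<^sub>F (x', y) in uniformity. x' = x \<longrightarrow> y \<in> U)" for U :: "'a drury_arveson set"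
    by (simp add: open_drury_arveson_def)
  show "norm f = 0 \<longleftrightarrow> f = 0"
    by (simp add: norm_drury_arveson_def da_norm_eq_0)
  show "norm (f + g) \<le> norm f + norm g"
    by (simp add: norm_drury_arveson_def da_norm_triangle)
  show "norm (r *\<^sub>R f) = \<bar>r\<bar> * norm f"
    by (simp add: norm_drury_arveson_def scaleR da_norm_scaleC)
qed

end

instantiation drury_arveson :: (finite) complex_inner
begin

definition cinner_drury_arveson :: "'a drury_arveson \<Rightarrow> 'a drury_arveson \<Rightarrow> complex" where
  "cinner f g = da_inner f g"

instance
proof
  fix f g h :: "'a drury_arveson" and a b :: complex and r :: real
  show "a *\<^sub>C (f + g) = a *\<^sub>C f + a *\<^sub>C g" "(a + b) *\<^sub>C f = a *\<^sub>C f + b *\<^sub>C f"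
      "a *\<^sub>C b *\<^sub>C f = (a * b) *\<^sub>C f"
    by (simp_all add: da_eq_iff da_coeff_simps algebra_simps)
  show "r *\<^sub>R f = complex_of_real r *\<^sub>C f"
    by (simp add: da_eq_iff da_coeff_simps)
  show "norm (a *\<^sub>C f) = cmod a * norm f"
    by (simp add: norm_drury_arveson_def da_norm_scaleC)
  show "cinner f g = cnj (cinner g f)" "cinner (f + g) h = cinner f h + cinner g h"
      "cinner (a *\<^sub>C f) h = a * cinner f h"
    unfolding cinner_drury_arveson_def
    by (rule da_inner_commute da_inner_add da_inner_scaleC)+
  show "norm f = sqrt (Re (cinner f f))"
    by (simp add: cinner_drury_arveson_def norm_drury_arveson_def da_inner_self da_norm_nonneg)
qed

end

instance drury_arveson :: (finite) chilbert_space
proof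
  fix X :: "nat \<Rightarrow> 'a drury_arveson"
  assume X: "Cauchy X"
  have bd: "(\<Sum>\<alpha>\<in>F. da_weight \<alpha> * (cmod (da_coeff (X m) \<alpha> - da_coeff (X n) \<alpha>))\<^sup>2) \<le> (norm (X m - X n))\<^sup>2"
    if "finite F" for F m n
    using da_norm_finite[OF that, of "X m - X n"]
    by (simp add: da_coeff_simps norm_drury_arveson_def)
  have "Cauchy (\<lambda>n. da_coeff (X n) \<alpha>)" for \<alpha>
  proof (rule metric_CauchyI)
    fix e :: real
    assume e: "e > 0"
    define e' where "e' = sqrt (da_weight \<alpha>) * e"
    have "e' > 0"
      using e da_weight_pos[of \<alpha>] by (simp add: e'_def)
    from metric_CauchyD[OF X this] obtain N where N: "\<And>m n. m \<ge> N \<Longrightarrow> n \<ge> N \<Longrightarrow> norm (X m - X n) < e'"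
      by (auto simp: dist_norm)
    have "dist (da_coeff (X m) \<alpha>) (da_coeff (X n) \<alpha>) < e" if "m \<ge> N" "n \<ge> N" for m n
    proof -
      have "(sqrt (da_weight \<alpha>) * cmod (da_coeff (X m) \<alpha> - da_coeff (X n) \<alpha>))\<^sup>2 \<le> (norm (X m - X n))\<^sup>2"
        using bd[of "{\<alpha>}" m n] da_weight_pos[of \<alpha>] by (simp add: power_mult_distrib)
      then have "sqrt (da_weight \<alpha>) * cmod (da_coeff (X m) \<alpha> - da_coeff (X n) \<alpha>) \<le> norm (X m - X n)"
        by (rule power2_le_imp_le) simp
      also have "\<dots> < sqrt (da_weight \<alpha>) * e"
        using N[OF that] by (simp add: e'_def)
      finally show ?thesis
        using da_weight_pos[of \<alpha>] by (simp add: dist_norm)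
    qed
    then show "\<exists>M. \<forall>m\<ge>M. \<forall>n\<ge>M. dist (da_coeff (X m) \<alpha>) (da_coeff (X n) \<alpha>) < e"
      by blast
  qed
  then have "\<exists>c. \<forall>\<alpha>. (\<lambda>n. da_coeff (X n) \<alpha>) \<longlonglongrightarrow> c \<alpha>"
    by (intro choice allI) (meson Cauchy_convergent_iff convergent_def)
  then obtain c where c: "\<And>\<alpha>. (\<lambda>n. da_coeff (X n) \<alpha>) \<longlonglongrightarrow> c \<alpha>"
    by blast
  have lim: "(\<Sum>\<alpha>\<in>F. da_weight \<alpha> * (cmod (da_coeff (X m) \<alpha> - c \<alpha>))\<^sup>2) \<le> e\<^sup>2"
    if F: "finite F" and e: "e > 0" and N: "\<And>m n. m \<ge> N \<Longrightarrow> n \<ge> N \<Longrightarrow> norm (X m - X n) < e"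
      and m: "m \<ge> N" for F e N m
  proof (rule LIMSEQ_le_const2)
    show "(\<lambda>n. \<Sum>\<alpha>\<in>F. da_weight \<alpha> * (cmod (da_coeff (X m) \<alpha> - da_coeff (X n) \<alpha>))\<^sup>2)
        \<longlonglongrightarrow> (\<Sum>\<alpha>\<in>F. da_weight \<alpha> * (cmod (da_coeff (X m) \<alpha> - c \<alpha>))\<^sup>2)"
      by (intro tendsto_intros c)
    have "(\<Sum>\<alpha>\<in>F. da_weight \<alpha> * (cmod (da_coeff (X m) \<alpha> - da_coeff (X n) \<alpha>))\<^sup>2) \<le> e\<^sup>2" if "n \<ge> N" for n
      using bd[OF F, of m n] power_mono[OF less_imp_le[OF N[OF m that]], of 2] by simp
    then show "\<exists>N. \<forall>n\<ge>N. (\<Sum>\<alpha>\<in>F. da_weight \<alpha> * (cmod (da_coeff (X m) \<alpha> - da_coeff (X n) \<alpha>))\<^sup>2) \<le> e\<^sup>2"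
      by blast
  qed
  have ex: "\<exists>N. \<forall>m\<ge>N. \<forall>n\<ge>N. norm (X m - X n) < e" if "e > 0" for e
    using metric_CauchyD[OF X that] by (auto simp: dist_norm)
  have diff: "(\<lambda>\<alpha>. da_weight \<alpha> * (cmod (da_coeff (X m) \<alpha> - c \<alpha>))\<^sup>2) summable_on UNIV"
    if "e > 0" and "\<And>m n. m \<ge> N \<Longrightarrow> n \<ge> N \<Longrightarrow> norm (X m - X n) < e" and "m \<ge> N" for e N m
    using lim[OF _ that] da_weight_pos
    by (intro nonneg_bdd_above_summable_on bdd_aboveI2[where M = "e\<^sup>2"])
       (auto simp: da_weight_nonneg)
  obtain N1 where N1: "\<And>m n. m \<ge> N1 \<Longrightarrow> n \<ge> N1 \<Longrightarrow> norm (X m - X n) < 1"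
    using ex[of 1] by auto
  have "(\<lambda>\<alpha>. da_weight \<alpha> * (cmod (da_coeff (X N1) \<alpha> + (- 1) * (da_coeff (X N1) \<alpha> - c \<alpha>)))\<^sup>2) summable_on UNIV"
    using diff[OF _ N1] by (intro da_summable_add da_summable_mult da_summable) auto
  then have c_sum: "(\<lambda>\<alpha>. da_weight \<alpha> * (cmod (c \<alpha>))\<^sup>2) summable_on UNIV"
    by simp
  define L where "L = Abs_da c"
  have L: "da_coeff L = c"
    using c_sum by (simp add: L_def Abs_da_inverse)
  have "X \<longlonglongrightarrow> L"
  proof (rule LIMSEQ_I)
    fix e :: real
    assume "e > 0"
    then have e2: "e / 2 > 0"
      by simp
    from ex[OF e2] obtain N where N: "\<And>m n. m \<ge> N \<Longrightarrow> n \<ge> N \<Longrightarrow> norm (X m - X n) < e / 2"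
      by blast
    have "norm (X m - L) < e" if m: "m \<ge> N" for m
    proof -
      have "(\<Sum>\<^sub>\<infinity>\<alpha>. da_weight \<alpha> * (cmod (da_coeff (X m) \<alpha> - c \<alpha>))\<^sup>2) \<le> (e / 2)\<^sup>2"
        by (rule infsum_le_finite_sums[OF diff[OF e2 N m]]) (use lim[OF _ e2 N m] in auto)
      then have "norm (X m - L) \<le> e / 2"
        unfolding norm_drury_arveson_def da_norm_def
        using e2 by (intro real_le_lsqrt) (auto simp: da_coeff_simps L)
      then show ?thesis
        using e2 by simp
    qed
    then show "\<exists>N. \<forall>n\<ge>N. norm (X n - L) < e"
      by blast
  qed
  then show "convergent X"
    by (auto simp: convergent_def)
qed

definition da_eval :: "'d::finite drury_arveson \<Rightarrow> complex ^ 'd \<Rightarrow> complex" where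
  "da_eval f z = (\<Sum>\<^sub>\<infinity>\<alpha>. da_coeff f \<alpha> * multi_power z \<alpha>)"

text \<open>
  \<open>M\<close> is the operator \<open>f \<mapsto> \<phi> f\<close> on \<open>H\<^sup>2\<^sub>d\<close>. Boundedness of \<open>M\<close>, automatic by the closed graph
  theorem, is part of the type.
\<close>

definition multiplies_by ::
  "(complex ^ 'd::finite \<Rightarrow> complex) \<Rightarrow> ('d drury_arveson \<Rightarrow>\<^sub>L 'd drury_arveson) \<Rightarrow> bool" where
  "multiplies_by \<phi> M \<longleftrightarrow> (\<forall>f. \<forall>z\<in>ball 0 1. da_eval (M f) z = \<phi> z * da_eval f z)"

definition multiplier_algebra :: "('d::finite drury_arveson \<Rightarrow>\<^sub>L 'd drury_arveson) set" where
  "multiplier_algebra = {M \<in> bops. \<exists>\<phi>. multiplies_by \<phi> M}"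

definition mult_op ::
  "(complex ^ 'd::finite \<Rightarrow> complex) \<Rightarrow> ('d drury_arveson \<Rightarrow>\<^sub>L 'd drury_arveson)" where
  "mult_op \<phi> = (THE M. M \<in> bops \<and> multiplies_by \<phi> M)"


section \<open>Tuples of operators\<close>

type_synonym ('d, 'h) op_tuple = "'d \<Rightarrow> ('h \<Rightarrow>\<^sub>L 'h)"

definition commuting_tuple :: "('d, 'h::complex_inner) op_tuple \<Rightarrow> bool" where
  "commuting_tuple T \<longleftrightarrow> (\<forall>j k. T j o\<^sub>L T k = T k o\<^sub>L T j)"

definition row_contraction :: "('d::finite, 'h::chilbert_space) op_tuple \<Rightarrow> bool" where
  "row_contraction T \<longleftrightarrow> op_le (\<Sum>k\<in>UNIV. T k o\<^sub>L adj (T k)) id_blinfun"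

definition nilpotent_tuple :: "('d, 'h::complex_inner) op_tuple \<Rightarrow> bool" where
  "nilpotent_tuple T \<longleftrightarrow> (\<forall>k. \<exists>m. \<forall>x. (blinfun_apply (T k) ^^ m) x = 0)"

lift_definition blinfun_ampl :: "('h::real_normed_vector \<Rightarrow>\<^sub>L 'h) \<Rightarrow> (('h ^ 's::finite) \<Rightarrow>\<^sub>L ('h ^ 's))"
  is "\<lambda>A v. \<chi> i. A (v $ i)"
proof -
  fix A :: "'h \<Rightarrow> 'h"
  assume "bounded_linear A"
  then interpret A: bounded_linear A .
  obtain K where K: "\<And>x. norm (A x) \<le> norm x * K" and "K > 0"
    using A.pos_bounded by blast
  show "bounded_linear (\<lambda>v :: 'h ^ 's. \<chi> i. A (v $ i))"
  proof (rule bounded_linear_intro[where K = K])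
    show "norm (\<chi> i. A (v $ i)) \<le> norm v * K" for v :: "'h ^ 's"
      unfolding norm_vec_def using K \<open>K > 0\<close>
      by (subst L2_set_left_distrib) (auto intro!: L2_set_mono)
  qed (simp_all add: vec_eq_iff A.add A.scale)
qed

definition ampliation :: "('d, 'h::complex_inner) op_tuple \<Rightarrow> ('d, 'h ^ 's::finite) op_tuple" where
  "ampliation T k = blinfun_ampl (T k)"


section \<open>The functional calculus\<close>

definition is_functional_calculus ::
  "('d::finite, 'h::chilbert_space) op_tuple \<Rightarrow>
    (('d drury_arveson \<Rightarrow>\<^sub>L 'd drury_arveson) \<Rightarrow> ('h \<Rightarrow>\<^sub>L 'h)) \<Rightarrow> bool" where
  "is_functional_calculus T \<Phi> \<longleftrightarrow>
     (\<forall>A\<in>multiplier_algebra. \<Phi> A \<in> bops) \<and>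
     \<Phi> id_blinfun = id_blinfun \<and>
     (\<forall>A\<in>multiplier_algebra. \<forall>B\<in>multiplier_algebra. \<Phi> (A + B) = \<Phi> A + \<Phi> B) \<and>
     (\<forall>A\<in>multiplier_algebra. \<forall>c. \<Phi> (c *\<^sub>C A) = c *\<^sub>C \<Phi> A) \<and>
     (\<forall>A\<in>multiplier_algebra. \<forall>B\<in>multiplier_algebra. \<Phi> (A o\<^sub>L B) = \<Phi> A o\<^sub>L \<Phi> B) \<and>
     (\<forall>n A. (\<forall>i<n. \<forall>j<n. A i j \<in> multiplier_algebra) \<longrightarrow>
        matrix_norm n (\<lambda>i j. \<Phi> (A i j)) \<le> matrix_norm n A) \<and>
     continuous_map (subtopology weak_star multiplier_algebra) weak_star \<Phi> \<and>
     (\<forall>k. \<Phi> (mult_op (\<lambda>z. z $ k)) = T k)"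

text \<open>
  \<open>func_calc \<theta> T\<close> is \<open>\<theta>(T)\<close>. It is meaningful for pure commuting_tuple row contractions, in particular for
  nilpotent ones, where the calculus exists and is unique on the multiplier algebra.
\<close>

definition func_calc ::
  "('d::finite drury_arveson \<Rightarrow>\<^sub>L 'd drury_arveson) \<Rightarrow> ('d, 'h::chilbert_space) op_tuple \<Rightarrow>
    ('h \<Rightarrow>\<^sub>L 'h)" where
  "func_calc \<theta> T = (THE B. \<exists>\<Phi>. is_functional_calculus T \<Phi> \<and> B = \<Phi> \<theta>)"

definition Ann :: "('d::finite, 'h::chilbert_space) op_tuple \<Rightarrow>
    ('d drury_arveson \<Rightarrow>\<^sub>L 'd drury_arveson) set" where
  "Ann T = {\<theta> \<in> multiplier_algebra. func_calc \<theta> T = 0}"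

definition separating :: "('d::finite, 'h::chilbert_space) op_tuple \<Rightarrow> 'h \<Rightarrow> bool" where
  "separating T \<xi> \<longleftrightarrow>
     (\<forall>\<theta>\<in>multiplier_algebra. func_calc \<theta> T \<xi> = 0 \<longrightarrow> func_calc \<theta> T = 0)"


section \<open>The polynomial quotient algebra\<close>

type_synonym 'd cpoly = "('d \<Rightarrow>\<^sub>0 nat) \<Rightarrow>\<^sub>0 complex"

definition cpoly_eval :: "'d::finite cpoly \<Rightarrow> complex ^ 'd \<Rightarrow> complex" where
  "cpoly_eval p z = (\<Sum>\<alpha>\<in>Poly_Mapping.keys p. Poly_Mapping.lookup p \<alpha> * multi_power z \<alpha>)"

definition cpoly_ring :: "'d::finite cpoly ring" where
  "cpoly_ring = \<lparr>carrier = UNIV, monoid.mult = (*), one = 1, ring.zero = 0, add = (+)\<rparr>"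

definition poly_Ann :: "('d::finite, 'h::chilbert_space) op_tuple \<Rightarrow> 'd cpoly set" where
  "poly_Ann T = {p. mult_op (cpoly_eval p) \<in> Ann T}"

definition quotient_algebra :: "('d::finite, 'h::chilbert_space) op_tuple \<Rightarrow> 'd cpoly set ring" where
  "quotient_algebra T = cpoly_ring Quot (poly_Ann T)"

text \<open>The image of the scalars in the quotient, over which its dimension is taken.\<close>

definition quotient_scalars :: "('d::finite, 'h::chilbert_space) op_tuple \<Rightarrow> 'd cpoly set set" where
  "quotient_scalars T = range (\<lambda>c. poly_Ann T +>\<^bsub>cpoly_ring\<^esub> Poly_Mapping.single 0 c)"

definition dim_quotient :: "('d::finite, 'h::chilbert_space) op_tuple \<Rightarrow> nat" where
  "dim_quotient T =
     ring.dim (quotient_algebra T) (quotient_scalars T) (carrier (quotient_algebra T))"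

end

theory Submission
  imports
    Defs
    "HOL-Complex_Analysis.Cauchy_Integral_Formula"
begin

text \<open>
  The functional calculus is \<open>M \<mapsto> \<Sum>\<alpha>. c \<alpha> T\<^sup>\<alpha>\<close>, a finite sum over the Taylor coefficients of the
  symbol of \<open>M\<close> because \<open>T\<close> is nilpotent. It is completely contractive because the Poisson kernel
  \<open>K\<close> is an isometry with \<open>K\<^sup>* (M \<otimes> 1) K = M(T)\<close>; a factorisation of the defect form on a finite set
  of vectors replaces the square root of the defect operator. It is the only calculus because the
  polynomials \<open>\<sigma> n M\<close> given by Fejer means are bounded by \<open>norm M\<close> and converge weak-* to \<open>M\<close>.

  So only the finite-dimensional algebra \<open>\<A>\<close> of polynomials in \<open>T\<close> matters. Choosing vectors one at a
  time, each lowering the dimension of the common annihilator, yields \<open>dim \<A>\<close> vectors that together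
  separate \<open>\<A>\<close>, hence one separating vector \<open>\<eta>\<close> for the ampliation. For any \<open>\<zeta>\<close>, the vector
  \<open>\<zeta> + t \<eta>\<close> is separating for all but finitely many real \<open>t\<close>.
\<close>

section \<open>Positive semidefinite forms\<close>

text \<open>\<open>func_calc\<close> is a definite description, so nothing can be said about
  separating vectors until the calculus of T and the calculus of its ampliation are both known to
  exist and to be unique. Hence analysis fills the larger part of the proof. For existence the
  demanding clause is complete contractivity. For one operator matrix and one tuple of vectors it
  involves finitely many vectors only, so the defect form has to be factorised just on their images
  under adjoint monomials. The coordinates of that factorisation index finitely many copies of the
  Drury-Arveson space, which stand in for its tensor product with the defect space. For uniqueness a
  calculus is prescribed on polynomials and is weak-* continuous. Passing to the limit inside a
  normal functional, which is an infinite series, calls for polynomials with a common norm bound.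
  Taylor truncations of a multiplier have no such bound in general; this is why the weights are
  Fejer's.\<close>

lemma scaleC_zero_right [simp]: "c *\<^sub>C (0 :: 'a::complex_normed_vector) = 0"
  using scaleC_add_right[of c "0 :: 'a" 0] by simp

lemma scaleC_zero_left [simp]: "0 *\<^sub>C (x :: 'a::complex_normed_vector) = 0"
  using scaleC_add_left[of 0 0 x] by simp

lemma scaleC_one [simp]: "1 *\<^sub>C (x :: 'a::complex_normed_vector) = x"
  using scaleR_scaleC[of 1 x] by simp

lemma scaleC_minus1: "(- 1) *\<^sub>C (x :: 'a::complex_normed_vector) = - x"
  using scaleR_scaleC[of "- 1" x] by simp

lemma scaleC_sum_right: "c *\<^sub>C (\<Sum>i\<in>A. f i :: 'a::complex_normed_vector) = (\<Sum>i\<in>A. c *\<^sub>C f i)"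
  by (induction A rule: infinite_finite_induct) (auto simp: scaleC_add_right)

text \<open>Covers both the inner product and the defect form of a row contraction. The latter may
  have null vectors, so positivity is asked in its weak form.\<close>

locale psd_form =
  fixes B :: "'a::complex_normed_vector \<Rightarrow> 'a \<Rightarrow> complex"
  assumes add_left: "B (x + y) z = B x z + B y z"
    and scaleC_left: "B (c *\<^sub>C x) y = c * B x y"
    and hermitian: "B x y = cnj (B y x)"
    and nonneg: "0 \<le> Re (B x x)"
begin

lemma zero_left [simp]: "B 0 y = 0"
  using scaleC_left[of 0 0 y] by simp

lemma zero_right [simp]: "B x 0 = 0"
  by (subst hermitian) simp

lemma add_right: "B x (y + z) = B x y + B x z"
  by (subst hermitian, subst (2 3) hermitian) (simp add: add_left)

lemma scaleC_right: "B x (c *\<^sub>C y) = cnj c * B x y"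
  by (subst hermitian, subst (2) hermitian) (simp add: scaleC_left)

lemma minus_left: "B (- x) y = - B x y"
  using scaleC_left[of "- 1" x y] by (simp add: scaleC_minus1)

lemma minus_right: "B x (- y) = - B x y"
  using scaleC_right[of x "- 1" y] by (simp add: scaleC_minus1)

lemma diff_left: "B (x - y) z = B x z - B y z"
  using add_left[of x "- y" z] by (simp add: minus_left)

lemma diff_right: "B x (y - z) = B x y - B x z"
  using add_right[of x y "- z"] by (simp add: minus_right)

lemma sum_left: "B (\<Sum>i\<in>A. f i) y = (\<Sum>i\<in>A. B (f i) y)"
  by (induction A rule: infinite_finite_induct) (auto simp: add_left)

lemma sum_right: "B x (\<Sum>i\<in>A. f i) = (\<Sum>i\<in>A. B x (f i))"
  by (induction A rule: infinite_finite_induct) (auto simp: add_right)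

lemma self_real: "B x x = complex_of_real (Re (B x x))"
proof -
  have "Im (B x x) = Im (cnj (B x x))"
    by (rule arg_cong[OF hermitian])
  then show ?thesis
    by (simp add: complex_eq_iff)
qed

lemma Cauchy_Schwarz: "(cmod (B x y))\<^sup>2 \<le> Re (B x x) * Re (B y y)"
proof -
  \<comment> \<open>Expanded positivity of \<open>B\<close> at \<open>x - c *\<^sub>C y\<close>;
    below, \<open>c\<close> is taken to be a real multiple of \<open>B x y\<close>.\<close>
  have *: "0 \<le> Re (B x x) - 2 * Re (cnj c * B x y) + (cmod c)\<^sup>2 * Re (B y y)" for c
  proof -
    have "B y x = cnj (B x y)"
      by (rule hermitian)
    moreover have "c * cnj c = (complex_of_real (cmod c))\<^sup>2"
      by (simp add: complex_norm_square[symmetric])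
    ultimately have "B (x - c *\<^sub>C y) (x - c *\<^sub>C y)
        = B x x - cnj c * B x y - cnj (cnj c * B x y) + complex_of_real ((cmod c)\<^sup>2) * B y y"
      by (simp add: diff_left diff_right scaleC_left scaleC_right algebra_simps)
    then have "Re (B (x - c *\<^sub>C y) (x - c *\<^sub>C y))
        = Re (B x x) - 2 * Re (cnj c * B x y) + (cmod c)\<^sup>2 * Re (B y y)"
      by simp
    then show ?thesis
      using nonneg[of "x - c *\<^sub>C y"] by linarith
  qed
  have sq: "Re (cnj (complex_of_real t * B x y) * B x y) = t * (cmod (B x y))\<^sup>2" for t
    by (simp add: cmod_def power2_eq_square algebra_simps)
  show ?thesis
  proof (cases "Re (B y y) = 0")
    case True
    have "2 * t * (cmod (B x y))\<^sup>2 \<le> Re (B x x)" for t :: real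
      using *[of "complex_of_real t * B x y"] unfolding sq True by simp
    \<comment> \<open>With \<open>Re (B y y) = 0\<close> the bound is linear in t. For this t it
      would read \<open>Re (B x x) + 1 \<le> Re (B x x)\<close>, unless \<open>B x y\<close>
      vanishes.\<close>
    from this[of "(Re (B x x) + 1) / (2 * (cmod (B x y))\<^sup>2)"]
    have "(cmod (B x y))\<^sup>2 = 0"
      by (cases "(cmod (B x y))\<^sup>2 = 0") (auto simp: field_simps)
    then show ?thesis
      using True by simp
  next
    case False
    then have pos: "0 < Re (B y y)"
      using nonneg[of y] by simp
    define r where "r = Re (B y y)"
    \<comment> \<open>The scalar \<open>B x y / r\<close> minimises the quadratic expression in
      \<open>c\<close>.\<close>
    have "0 \<le> Re (B x x) - 2 * ((cmod (B x y))\<^sup>2 / r) + (cmod (B x y))\<^sup>2 / r\<^sup>2 * r"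
      using *[of "complex_of_real (1 / r) * B x y"] pos unfolding sq r_def[symmetric]
      by (simp add: norm_mult norm_divide power_divide power_mult_distrib)
    also have "(cmod (B x y))\<^sup>2 / r\<^sup>2 * r = (cmod (B x y))\<^sup>2 / r"
      using pos by (simp add: r_def power2_eq_square)
    finally show ?thesis
      using pos by (simp add: r_def[symmetric] field_simps)
  qed
qed

lemma null_left: "Re (B x x) = 0 \<Longrightarrow> B x y = 0"
  using Cauchy_Schwarz[of x y] by simp

lemma null_right: "Re (B y y) = 0 \<Longrightarrow> B x y = 0"
  using Cauchy_Schwarz[of x y] by simp

text \<open>Division by zero makes this the form \<open>B\<close> itself when \<open>B v v = 0\<close>.\<close>

lemma schur_complement: "psd_form (\<lambda>x y. B x y - B x v * B v y / B v v)"
proof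
  fix x y z :: 'a and c
  show "B (x + y) z - B (x + y) v * B v z / B v v
      = B x z - B x v * B v z / B v v + (B y z - B y v * B v z / B v v)"
    by (simp add: add_left algebra_simps add_divide_distrib)
  show "B (c *\<^sub>C x) y - B (c *\<^sub>C x) v * B v y / B v v = c * (B x y - B x v * B v y / B v v)"
    by (simp add: scaleC_left algebra_simps)
  show "B x y - B x v * B v y / B v v = cnj (B y x - B y v * B v x / B v v)"
  proof -
    have "cnj (B v v) = B v v"
      by (rule hermitian[symmetric])
    then show ?thesis
      using hermitian[of x y] hermitian[of x v] hermitian[of v y] by (simp add: mult.commute)
  qed
  have "B x v * B v x / B v v = complex_of_real ((cmod (B x v))\<^sup>2 / Re (B v v))"
    using hermitian[of v x] self_real[of v]
    by (metis complex_norm_square of_real_divide)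
  moreover have "(cmod (B x v))\<^sup>2 / Re (B v v) \<le> Re (B x x)"
    using Cauchy_Schwarz[of x v] nonneg[of v] nonneg[of x]
    by (cases "Re (B v v) = 0") (auto simp: field_simps)
  ultimately show "0 \<le> Re (B x x - B x v * B v x / B v v)"
    by simp
qed

end

text \<open>Cholesky factorisation by induction on the set: the coordinate of \<open>v\<close>
  carries the rank-one part of the form in direction \<open>v\<close>, and the Schur complement,
  which vanishes against \<open>v\<close>, is left to the induction hypothesis. Each vector of
  \<open>V\<close> thus contributes one coordinate.\<close>

lemma psd_form_gram:
  assumes "finite V" "psd_form B"
  shows "\<exists>l. \<forall>x\<in>V. \<forall>y\<in>V. B x y = (\<Sum>p\<in>V. l p x * cnj (l p y))"
  using assms
proof (induction V arbitrary: B rule: finite_induct)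
  case (insert v V)
  interpret psd_form B by fact
  define C where "C = (\<lambda>x y. B x y - B x v * B v y / B v v)"
  have C: "psd_form C"
    unfolding C_def by (rule schur_complement)
  from insert.IH[OF C] obtain l where l: "\<And>x y. x \<in> V \<Longrightarrow> y \<in> V \<Longrightarrow> C x y = (\<Sum>p\<in>V. l p x * cnj (l p y))"
    by blast
  have C0: "C v y = 0" "C x v = 0" for x y
    using null_left[of v y] null_right[of v x] self_real[of v]
    by (cases "B v v = 0"; auto simp: C_def)+
  \<comment> \<open>The coordinates from the induction hypothesis are uncontrolled at
    \<open>v\<close>, so they are reset to 0 there. If \<open>B v v = 0\<close>, division by zero
    makes the new coordinate 0, as it should be for a null vector.\<close>
  define l' where "l' = (\<lambda>p x. if p = v then B x v / complex_of_real (sqrt (Re (B v v)))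
    else if x = v then 0 else l p x)"
  have sq: "complex_of_real (sqrt (Re (B v v))) * complex_of_real (sqrt (Re (B v v))) = B v v"
    using self_real[of v] nonneg[of v] by (metis of_real_mult real_sqrt_mult_self abs_of_nonneg)
  have "B x y = (\<Sum>p\<in>insert v V. l' p x * cnj (l' p y))" if "x \<in> insert v V" "y \<in> insert v V" for x y
  proof -
    have "l' v x * cnj (l' v y) = B x v * B v y / B v v"
      using hermitian[of v y] sq by (simp add: l'_def)
    moreover have "(\<Sum>p\<in>V. l' p x * cnj (l' p y)) = C x y"
    proof (cases "x = v \<or> y = v")
      case True
      have "(\<Sum>p\<in>V. l' p x * cnj (l' p y)) = 0"
        using True insert.hyps by (intro sum.neutral) (auto simp: l'_def)
      then show ?thesis
        using True C0 by auto
    next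
      case False
      have "(\<Sum>p\<in>V. l' p x * cnj (l' p y)) = (\<Sum>p\<in>V. l p x * cnj (l p y))"
        using False insert.hyps by (intro sum.cong) (auto simp: l'_def)
      then show ?thesis
        using False that l by simp
    qed
    ultimately show ?thesis
      using insert.hyps by (simp add: C_def)
  qed
  then show ?case
    by blast
qed simp

section \<open>Inner products and adjoints\<close>

lemma norm_sq_cinner: "(norm (x :: 'a::complex_inner))\<^sup>2 = Re (cinner x x)"
  using norm_ge_zero[of x] unfolding norm_eq_sqrt_cinner by simp

interpretation cinner: psd_form "cinner :: 'a::complex_inner \<Rightarrow> 'a \<Rightarrow> complex"
proof
  show "0 \<le> Re (cinner x x)" for x :: 'a
    by (simp flip: norm_sq_cinner)
qed (rule cinner_add_left cinner_scaleC_left cinner_commute)+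

lemma cinner_self: "cinner x x = complex_of_real ((norm x)\<^sup>2)"
  by (metis cinner.self_real norm_sq_cinner)

lemma cinner_self_eq_0 [simp]: "cinner x x = 0 \<longleftrightarrow> x = 0"
  by (simp add: cinner_self)

lemma cinner_bound: "cmod (cinner x y) \<le> norm x * norm y"
proof (rule power2_le_imp_le)
  show "(cmod (cinner x y))\<^sup>2 \<le> (norm x * norm y)\<^sup>2"
    using cinner.Cauchy_Schwarz[of x y] by (simp add: norm_sq_cinner power_mult_distrib)
qed simp

interpretation cinner_bilinear: bounded_bilinear "cinner :: 'a::complex_inner \<Rightarrow> 'a \<Rightarrow> complex"
proof
  show "\<exists>K. \<forall>(a::'a) b. cmod (cinner a b) \<le> norm a * norm b * K"
    by (rule exI[of _ 1]) (simp add: cinner_bound)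
qed (simp_all add: cinner.add_left cinner.add_right scaleR_scaleC cinner.scaleC_left
    cinner.scaleC_right scaleR_conv_of_real)

lemma cinner_extL: "(\<And>y. cinner x y = cinner x' y) \<Longrightarrow> x = x'"
  using cinner.diff_left[of x x' "x - x'"] by simp

lemma cinner_extR: "(\<And>x. cinner x y = cinner x y') \<Longrightarrow> y = y'"
  using cinner.diff_right[of "y - y'" y y'] by simp

section \<open>Riesz representation and existence of adjoints\<close>

lemma parallelogram:
  "(norm (x + y))\<^sup>2 + (norm (x - y))\<^sup>2 = 2 * (norm x)\<^sup>2 + 2 * (norm (y :: 'a::complex_inner))\<^sup>2"
  by (simp add: norm_sq_cinner cinner.add_left cinner.add_right cinner.diff_left cinner.diff_right)

text \<open>The representing vector is a multiple of the vector of least norm in the affine hyperplane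
  \<open>f x = 1\<close>.\<close>

lemma riesz_representation:
  fixes f :: "'a::chilbert_space \<Rightarrow> complex"
  assumes f: "bounded_linear f" and fC: "\<And>c x. f (c *\<^sub>C x) = c * f x"
  shows "\<exists>z. \<forall>x. f x = cinner x z"
proof (cases "\<forall>x. f x = 0")
  case True
  then show ?thesis
    by (intro exI[of _ 0]) simp
next
  case False
  interpret f: bounded_linear f by fact
  define S where "S = {x. f x = 1}"
  obtain x0 where "f x0 \<noteq> 0"
    using False by blast
  then have "(1 / f x0) *\<^sub>C x0 \<in> S"
    by (simp add: S_def fC)
  then have ne: "S \<noteq> {}"
    by blast
  define d where "d = (INF x\<in>S. norm x)"
  have bdd: "bdd_below (norm ` S)"
    by (rule bdd_belowI[where m = 0]) auto
  have d_le: "d \<le> norm x" if "x \<in> S" for x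
    unfolding d_def by (rule cINF_lower[OF bdd that])
  have d0: "0 \<le> d"
    unfolding d_def by (rule cINF_greatest[OF ne]) simp
  have "\<exists>x\<in>S. norm x < d + 1 / Suc n" for n
    using cINF_less_iff[OF ne bdd, of "d + 1 / Suc n"] by (simp add: d_def)
  then obtain X where XS: "\<And>n. X n \<in> S" and X: "\<And>n. norm (X n) < d + 1 / Suc n"
    by metis
  \<comment> \<open>The midpoint of two members of \<open>S\<close> is again in \<open>S\<close>, so
    \<open>norm (X m + X n)\<close> is at least \<open>2 * d\<close>; the parallelogram law turns
    this into a bound on the difference.\<close>
  have near: "(norm (X m - X n))\<^sup>2 \<le> 4 * ((d + 1 / Suc N)\<^sup>2 - d\<^sup>2)" if "m \<ge> N" "n \<ge> N" for m n N
  proof -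
    have le: "(norm (X k))\<^sup>2 \<le> (d + 1 / Suc N)\<^sup>2" if "k \<ge> N" for k
    proof (rule power_mono)
      have "1 / Suc k \<le> 1 / real (Suc N)"
        using that by (simp add: field_simps)
      then show "norm (X k) \<le> d + 1 / Suc N"
        using X[of k] by linarith
    qed simp
    have "(1 / 2) *\<^sub>C (X m + X n) \<in> S"
      using XS[of m] XS[of n] by (simp add: S_def fC f.add)
    from d_le[OF this] have "2 * d \<le> norm (X m + X n)"
      by (simp add: norm_scaleC norm_divide)
    from power_mono[OF this, of 2] have "4 * d\<^sup>2 \<le> (norm (X m + X n))\<^sup>2"
      using d0 by (simp add: power_mult_distrib)
    then show ?thesis
      using parallelogram[of "X m" "X n"] le[OF that(1)] le[OF that(2)] by simp
  qed
  have "Cauchy X"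
  proof (rule metric_CauchyI)
    fix e :: real
    assume e: "e > 0"
    have "(\<lambda>N. 4 * ((d + 1 / real (Suc N))\<^sup>2 - d\<^sup>2)) \<longlonglongrightarrow> 4 * ((d + 0)\<^sup>2 - d\<^sup>2)"
      by (intro tendsto_intros LIMSEQ_Suc lim_1_over_n)
    then have "\<forall>\<^sub>F N in sequentially. 4 * ((d + 1 / real (Suc N))\<^sup>2 - d\<^sup>2) < e\<^sup>2"
      using e by (intro order_tendstoD(2)) auto
    then obtain N where N: "4 * ((d + 1 / real (Suc N))\<^sup>2 - d\<^sup>2) < e\<^sup>2"
      by (auto simp: eventually_sequentially)
    have "dist (X m) (X n) < e" if "m \<ge> N" "n \<ge> N" for m n
    proof -
      have "(norm (X m - X n))\<^sup>2 < e\<^sup>2"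
        using near[OF that] N by simp
      then show ?thesis
        using e by (simp add: dist_norm power_less_imp_less_base)
    qed
    then show "\<exists>M. \<forall>m\<ge>M. \<forall>n\<ge>M. dist (X m) (X n) < e"
      by blast
  qed
  then obtain z where z: "X \<longlonglongrightarrow> z"
    by (auto simp: Cauchy_convergent_iff convergent_def)
  have "(\<lambda>n. f (X n)) \<longlonglongrightarrow> f z"
    by (rule f.tendsto[OF z])
  moreover have "(\<lambda>n. f (X n)) = (\<lambda>_. 1)"
    using XS by (auto simp: S_def)
  ultimately have fz: "f z = 1"
    by (simp add: LIMSEQ_const_iff)
  have "norm z \<le> d"
  proof (rule LIMSEQ_le[OF tendsto_norm[OF z]])
    show "(\<lambda>n. d + 1 / real (Suc n)) \<longlonglongrightarrow> d"
      using tendsto_add[OF tendsto_const LIMSEQ_Suc[OF lim_1_over_n], of d] by simp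
  qed (use X in \<open>auto intro!: exI[of _ 0] less_imp_le\<close>)
  then have min: "norm z \<le> norm (z + y)" if "f y = 0" for y
    using d_le[of "z + y"] fz that by (simp add: S_def f.add)
  have z0: "z \<noteq> 0"
    using fz f.zero by auto
  have orth: "cinner y z = 0" if y: "f y = 0" for y
  proof (rule ccontr)
    assume ne: "cinner y z \<noteq> 0"
    then have y0: "y \<noteq> 0"
      by auto
    \<comment> \<open>This \<open>c\<close> makes \<open>z + c *\<^sub>C y\<close> the component of
      \<open>z\<close> orthogonal to \<open>y\<close>, which would be strictly shorter than
      \<open>z\<close>.\<close>
    define c where "c = - cnj (cinner y z) / complex_of_real ((norm y)\<^sup>2)"
    have fcy: "f (c *\<^sub>C y) = 0"
      by (simp add: fC y)
    have zy: "cinner z y = cnj (cinner y z)"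
      by (rule cinner_commute)
    have "cinner (z + c *\<^sub>C y) (z + c *\<^sub>C y)
        = cinner z z - complex_of_real ((cmod (cinner y z))\<^sup>2 / (norm y)\<^sup>2)"
      using y0
      by (simp add: cinner.add_left cinner.add_right cinner.scaleC_left cinner.scaleC_right zy c_def
          cinner_self[of y] complex_norm_square[of "cinner y z"] mult.commute del: of_real_power)
    then have "(norm (z + c *\<^sub>C y))\<^sup>2 = (norm z)\<^sup>2 - (cmod (cinner y z))\<^sup>2 / (norm y)\<^sup>2"
      unfolding norm_sq_cinner[of z] norm_sq_cinner[of "z + c *\<^sub>C y"] by simp
    also have "\<dots> < (norm z)\<^sup>2"
      using ne y0 by simp
    finally show False
      using power_mono[OF min[OF fcy] norm_ge_zero, of 2] by linarith
  qed
  \<comment> \<open>Since \<open>f z = 1\<close>, the vector \<open>x - f x *\<^sub>C z\<close> lies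
    in the kernel of \<open>f\<close> and is orthogonal to \<open>z\<close>; the factor normalises
    \<open>cinner z z\<close> to 1.\<close>
  have "f x = cinner x ((1 / complex_of_real ((norm z)\<^sup>2)) *\<^sub>C z)" for x
  proof -
    have "cinner (x - f x *\<^sub>C z) z = 0"
      by (rule orth) (simp add: f.diff fC fz)
    then show ?thesis
      using z0 by (simp add: cinner.diff_left cinner.scaleC_left cinner.scaleC_right cinner_self)
  qed
  then show ?thesis
    by blast
qed

lemma bopsD: "A \<in> bops \<Longrightarrow> blinfun_apply A (c *\<^sub>C x) = c *\<^sub>C blinfun_apply A x"
  by (simp add: bops_def)

lemma adjoint_exists:
  fixes A :: "'a::chilbert_space \<Rightarrow>\<^sub>L 'a"
  assumes A: "A \<in> bops"
  shows "\<exists>B. \<forall>x y. cinner (A x) y = cinner x (blinfun_apply B y)"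
proof -
  have "\<exists>z. \<forall>x. cinner (A x) y = cinner x z" for y
  proof (rule riesz_representation)
    show "bounded_linear (\<lambda>x. cinner (blinfun_apply A x) y)"
      by (rule bounded_linear_compose[OF cinner_bilinear.bounded_linear_left blinfun.bounded_linear_right])
  qed (simp add: bopsD[OF A] cinner.scaleC_left)
  then obtain g where g: "\<And>x y. cinner (A x) y = cinner x (g y)"
    by metis
  have "bounded_linear g"
  proof (rule bounded_linear_intro[where K = "norm A"])
    show "g (x + y) = g x + g y" for x y
      by (rule cinner_extR) (simp add: g[symmetric] cinner.add_right)
    show "g (r *\<^sub>R x) = r *\<^sub>R g x" for r x
      by (rule cinner_extR) (simp add: g[symmetric] cinner.scaleC_right scaleR_scaleC)
    show "norm (g x) \<le> norm x * norm A" for x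
    proof -
      \<comment> \<open>Moving one factor \<open>g x\<close> back through the adjoint identity gives
        \<open>cinner (A (g x)) x\<close>, and one power of \<open>norm (g x)\<close> then
        cancels.\<close>
      have "(norm (g x))\<^sup>2 = cmod (cinner (A (g x)) x)"
        by (simp add: g cinner_self norm_power)
      also have "\<dots> \<le> norm (A (g x)) * norm x"
        by (rule cinner_bound)
      also have "\<dots> \<le> norm A * norm (g x) * norm x"
        by (intro mult_right_mono norm_blinfun) simp
      finally show ?thesis
        by (cases "g x = 0") (auto simp: power2_eq_square mult_ac)
    qed
  qed
  then show ?thesis
    using g by (intro exI[of _ "Blinfun g"]) (simp add: bounded_linear_Blinfun_apply)
qed

text \<open>\<open>adj\<close> is a definite description and vectors are determined by their inner
  products. The adjoint of an ampliation is identified in this way.\<close>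

lemma adj_unique:
  assumes "\<And>x y. cinner (blinfun_apply A x) y = cinner x (blinfun_apply B y)"
  shows "adj A = B"
  unfolding adj_def
proof (rule the_equality)
  show "C = B" if "\<forall>x y. cinner (A x) y = cinner x (blinfun_apply C y)" for C
    by (rule blinfun_eqI, rule cinner_extR) (use that assms in simp)
qed (use assms in simp)

lemma adj_cinner:
  assumes "A \<in> bops"
  shows "cinner (blinfun_apply A x) y = cinner x (adj A y)"
proof -
  from adjoint_exists[OF assms] obtain B
    where B: "\<forall>x y. cinner (A x) y = cinner x (blinfun_apply B y)" ..
  with adj_unique[of A B] show ?thesis
    by simp
qed

lemma adj_bops: "A \<in> bops \<Longrightarrow> adj A \<in> bops"
proof -
  assume A: "A \<in> bops"
  have "adj A (c *\<^sub>C x) = c *\<^sub>C adj A x" for c x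
    by (rule cinner_extR) (simp add: adj_cinner[OF A, symmetric] cinner.scaleC_right)
  then show ?thesis
    by (simp add: bops_def)
qed

section \<open>Multi-indices\<close>

abbreviation unit_index :: "'d \<Rightarrow> ('d \<Rightarrow>\<^sub>0 nat)" where
  "unit_index k \<equiv> Poly_Mapping.single k (Suc 0)"

lemma lookup_add_unit_index:
  "Poly_Mapping.lookup (\<alpha> + unit_index k) j = Poly_Mapping.lookup \<alpha> j + (if j = k then 1 else 0)"
  by (auto simp: lookup_add lookup_single)

lemma index_diff_add:
  fixes \<alpha> \<beta> :: "'d \<Rightarrow>\<^sub>0 nat"
  assumes "\<And>k. Poly_Mapping.lookup \<alpha> k \<le> Poly_Mapping.lookup \<beta> k"
  shows "\<beta> - \<alpha> + \<alpha> = \<beta>"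
  using assms by (intro poly_mapping_eqI) (simp add: lookup_add lookup_minus)

lemma diff_unit_index:
  "Poly_Mapping.lookup \<alpha> k \<noteq> (0 :: nat) \<Longrightarrow> \<alpha> - unit_index k + unit_index k = \<alpha>"
  by (rule index_diff_add) (auto simp: lookup_single when_def)

definition index_degree :: "('d::finite \<Rightarrow>\<^sub>0 nat) \<Rightarrow> nat" where
  "index_degree \<alpha> = (\<Sum>k\<in>UNIV. Poly_Mapping.lookup \<alpha> k)"

lemma index_degree_0 [simp]: "index_degree 0 = 0"
  by (simp add: index_degree_def)

lemma index_degree_add: "index_degree (\<alpha> + \<beta>) = index_degree \<alpha> + index_degree \<beta>"
  by (simp add: index_degree_def lookup_add sum.distrib)

lemma index_degree_unit_index [simp]: "index_degree (unit_index k) = 1"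
  by (simp add: index_degree_def lookup_single when_def)

lemma lookup_le_degree: "Poly_Mapping.lookup \<alpha> k \<le> index_degree (\<alpha> :: 'd::finite \<Rightarrow>\<^sub>0 nat)"
  unfolding index_degree_def by (rule member_le_sum) auto

lemma index_degree_eq_0_iff: "index_degree \<alpha> = 0 \<longleftrightarrow> \<alpha> = 0"
  by (auto simp: index_degree_def poly_mapping_eq_iff fun_eq_iff)

lemma multi_index_induct [case_names zero add]:
  fixes \<alpha> :: "'d::finite \<Rightarrow>\<^sub>0 nat"
  assumes "P 0" "\<And>\<alpha> k. P \<alpha> \<Longrightarrow> P (\<alpha> + unit_index k)"
  shows "P \<alpha>"
proof (induction "index_degree \<alpha>" arbitrary: \<alpha>)
  case 0
  then show ?case
    using assms(1) by (simp add: index_degree_eq_0_iff)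
next
  case (Suc n)
  then obtain k where k: "Poly_Mapping.lookup \<alpha> k \<noteq> 0"
    unfolding index_degree_def by (metis nat.distinct(1) sum.neutral)
  have "index_degree (\<alpha> - unit_index k) + 1 = index_degree \<alpha>"
    using arg_cong[OF diff_unit_index[OF k], of index_degree] by (simp add: index_degree_add)
  then have "P (\<alpha> - unit_index k)"
    using Suc by simp
  from assms(2)[OF this, of k] show ?case
    by (simp add: diff_unit_index[OF k])
qed

text \<open>Boxes rather than degree balls, because nilpotency bounds each exponent separately. They
  are finite, exhaust all multi-indices and contain every index below one of their members.\<close>

definition index_box :: "nat \<Rightarrow> ('d::finite \<Rightarrow>\<^sub>0 nat) set" where
  "index_box n = {\<alpha>. \<forall>k. Poly_Mapping.lookup \<alpha> k < n}"

lemma finite_index_box [simp]: "finite (index_box n :: ('d::finite \<Rightarrow>\<^sub>0 nat) set)"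
proof (rule finite_imageD)
  have "Poly_Mapping.lookup ` index_box n \<subseteq> PiE UNIV (\<lambda>_ :: 'd. {..<n})"
    by (auto simp: index_box_def)
  then show "finite (Poly_Mapping.lookup ` index_box n :: ('d \<Rightarrow> nat) set)"
    by (rule finite_subset) (simp add: finite_PiE)
  show "inj_on Poly_Mapping.lookup (index_box n :: ('d \<Rightarrow>\<^sub>0 nat) set)"
    by (rule inj_onI) (simp only: poly_mapping_eq_iff)
qed

lemma index_box_mono: "m \<le> n \<Longrightarrow> index_box m \<subseteq> index_box n"
  by (auto simp: index_box_def intro: less_le_trans)

lemma eventually_in_index_box: "\<forall>\<^sub>F n in sequentially. \<alpha> \<in> index_box n"
proof (rule eventually_sequentiallyI)
  show "\<alpha> \<in> index_box n" if "n \<ge> index_degree \<alpha> + 1" for n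
    unfolding index_box_def mem_Collect_eq
  proof
    show "Poly_Mapping.lookup \<alpha> k < n" for k
      using that lookup_le_degree[of \<alpha> k] by linarith
  qed
qed

lemma finite_subset_index_box:
  assumes "finite F"
  obtains n where "F \<subseteq> index_box n"
proof -
  have "\<forall>\<^sub>F n in sequentially. \<forall>\<alpha>\<in>F. \<alpha> \<in> index_box n"
    by (intro eventually_ball_finite assms ballI eventually_in_index_box)
  then show ?thesis
    using that by (auto simp: eventually_sequentially)
qed

lemma da_weight_0 [simp]: "da_weight 0 = 1"
  by (simp add: da_weight_def)

lemma da_weight_add_unit_index:
  "da_weight (\<alpha> + unit_index k) * (index_degree \<alpha> + 1) = da_weight \<alpha> * (Poly_Mapping.lookup \<alpha> k + 1)"
proof -
  have "(\<Prod>j\<in>UNIV. fact (Poly_Mapping.lookup (\<alpha> + unit_index k) j))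
      = fact (Poly_Mapping.lookup \<alpha> k + 1) * (\<Prod>j\<in>UNIV - {k}. fact (Poly_Mapping.lookup \<alpha> j) :: real)"
    by (subst prod.remove[of _ k]) (auto simp: lookup_add_unit_index intro!: prod.cong)
  also have "\<dots> = (Poly_Mapping.lookup \<alpha> k + 1) * (\<Prod>j\<in>UNIV. fact (Poly_Mapping.lookup \<alpha> j))"
    using prod.remove[of UNIV k "\<lambda>j. fact (Poly_Mapping.lookup \<alpha> j) :: real"] by (simp add: algebra_simps)
  finally have *: "(\<Prod>j\<in>UNIV. fact (Poly_Mapping.lookup (\<alpha> + unit_index k) j) :: real)
      = (Poly_Mapping.lookup \<alpha> k + 1) * (\<Prod>j\<in>UNIV. fact (Poly_Mapping.lookup \<alpha> j))" .
  define D where "D = real (index_degree \<alpha>) + 1"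
  have "D > 0"
    by (simp add: D_def)
  moreover have "fact (index_degree (\<alpha> + unit_index k)) = D * fact (index_degree \<alpha>)"
    by (simp add: index_degree_add D_def)
  ultimately show ?thesis
    unfolding da_weight_def index_degree_def[symmetric] *
    by (simp add: D_def[symmetric] distrib_left divide_simps) (simp add: D_def algebra_simps)
qed

text \<open>The quotient of the two weights is \<open>(\<alpha> k + 1) / (|\<alpha>| + 1)\<close>.
  Its being at most 1 makes multiplication by a coordinate a contraction.\<close>

lemma da_weight_add_unit_index_le: "da_weight (\<alpha> + unit_index k) \<le> da_weight \<alpha>"
proof -
  have "da_weight (\<alpha> + unit_index k) * (index_degree \<alpha> + 1) \<le> da_weight \<alpha> * (index_degree \<alpha> + 1)"
    unfolding da_weight_add_unit_index using lookup_le_degree[of \<alpha> k] da_weight_pos[of \<alpha>]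
    by (intro mult_left_mono) auto
  then show ?thesis
    by simp
qed

text \<open>This is Pascal's rule for the multinomial coefficients \<open>1 / da_weight \<gamma>\<close>, summed by parts.\<close>

lemma sum_index_box_Pascal:
  fixes g :: "('d::finite \<Rightarrow>\<^sub>0 nat) \<Rightarrow> 'a::real_vector"
  assumes "n > 0"
  shows "(\<Sum>\<gamma>\<in>index_box n. (1 / da_weight \<gamma>) *\<^sub>R g \<gamma>)
    = g 0 + (\<Sum>k\<in>UNIV. \<Sum>\<alpha> | \<alpha> \<in> index_box n \<and> \<alpha> + unit_index k \<in> index_box n.
        (1 / da_weight \<alpha>) *\<^sub>R g (\<alpha> + unit_index k))"
proof -
  \<comment> \<open>The share of \<open>1 / da_weight \<gamma>\<close> assigned to direction k; it
    equals \<open>1 / da_weight (\<gamma> - unit_index k)\<close> if k occurs in \<gamma>. At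
    \<open>\<gamma> = 0\<close> all shares are 0, so that term is split off.\<close>
  let ?c = "\<lambda>\<gamma> k. Poly_Mapping.lookup \<gamma> k / (index_degree \<gamma> * da_weight \<gamma>)"
  have "(\<Sum>k\<in>UNIV. ?c \<gamma> k) = 1 / da_weight \<gamma>" if "\<gamma> \<noteq> 0" for \<gamma> :: "'d \<Rightarrow>\<^sub>0 nat"
  proof -
    have "(\<Sum>k\<in>UNIV. ?c \<gamma> k) = index_degree \<gamma> / (index_degree \<gamma> * da_weight \<gamma>)"
      by (simp add: index_degree_def sum_divide_distrib)
    then show ?thesis
      using that index_degree_eq_0_iff[of \<gamma>] by simp
  qed
  then have "(\<Sum>\<gamma>\<in>index_box n - {0}. (1 / da_weight \<gamma>) *\<^sub>R g \<gamma>)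
      = (\<Sum>\<gamma>\<in>index_box n - {0}. \<Sum>k\<in>UNIV. ?c \<gamma> k *\<^sub>R g \<gamma>)"
    by (intro sum.cong) (auto simp flip: scaleR_sum_left)
  also have "\<dots> = (\<Sum>k\<in>UNIV. \<Sum>\<gamma>\<in>index_box n - {0}. ?c \<gamma> k *\<^sub>R g \<gamma>)"
    by (rule sum.swap)
  also have "\<dots> = (\<Sum>k\<in>UNIV. \<Sum>\<alpha> | \<alpha> \<in> index_box n \<and> \<alpha> + unit_index k \<in> index_box n.
      (1 / da_weight \<alpha>) *\<^sub>R g (\<alpha> + unit_index k))"
  proof (rule sum.cong[OF refl])
    fix k :: 'd
    have "(\<Sum>\<gamma>\<in>index_box n - {0}. ?c \<gamma> k *\<^sub>R g \<gamma>)
        = (\<Sum>\<gamma> | \<gamma> \<in> index_box n \<and> Poly_Mapping.lookup \<gamma> k \<noteq> 0. ?c \<gamma> k *\<^sub>R g \<gamma>)"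
      by (rule sum.mono_neutral_right) auto
    also have "\<dots> = (\<Sum>\<alpha> | \<alpha> \<in> index_box n \<and> \<alpha> + unit_index k \<in> index_box n.
        (1 / da_weight \<alpha>) *\<^sub>R g (\<alpha> + unit_index k))"
    proof (rule sum.reindex_bij_witness[of _ "\<lambda>\<alpha>. \<alpha> + unit_index k" "\<lambda>\<gamma>. \<gamma> - unit_index k"])
      fix \<gamma> :: "'d \<Rightarrow>\<^sub>0 nat"
      assume "\<gamma> \<in> {\<gamma>. \<gamma> \<in> index_box n \<and> Poly_Mapping.lookup \<gamma> k \<noteq> 0}"
      then have \<gamma>: "\<gamma> \<in> index_box n" "Poly_Mapping.lookup \<gamma> k \<noteq> 0"
        by auto
      show "\<gamma> - unit_index k + unit_index k = \<gamma>"
        by (rule diff_unit_index[OF \<gamma>(2)])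
      then show "\<gamma> - unit_index k \<in> {\<alpha>. \<alpha> \<in> index_box n \<and> \<alpha> + unit_index k \<in> index_box n}"
        using \<gamma>(1) by (auto simp: index_box_def lookup_minus intro: le_less_trans[OF diff_le_self])
      show "(1 / da_weight (\<gamma> - unit_index k)) *\<^sub>R g (\<gamma> - unit_index k + unit_index k) = ?c \<gamma> k *\<^sub>R g \<gamma>"
      proof -
        define \<alpha> where "\<alpha> = \<gamma> - unit_index k"
        have \<gamma>\<alpha>: "\<gamma> = \<alpha> + unit_index k"
          by (simp only: \<alpha>_def diff_unit_index[OF \<gamma>(2)])
        have "index_degree \<gamma> * da_weight \<gamma> = da_weight \<alpha> * (Poly_Mapping.lookup \<alpha> k + 1)"
          unfolding \<gamma>\<alpha> da_weight_add_unit_index[symmetric] by (simp add: index_degree_add)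
        moreover have "real (Poly_Mapping.lookup \<alpha> k + 1) > 0"
          by linarith
        ultimately have "1 / da_weight \<alpha> = ?c \<gamma> k"
          by (simp add: \<gamma>\<alpha> lookup_add_unit_index)
        then show ?thesis
          unfolding \<alpha>_def[symmetric] \<gamma>\<alpha> by simp
      qed
    qed (auto simp: lookup_add_unit_index)
    finally show "(\<Sum>\<gamma>\<in>index_box n - {0}. ?c \<gamma> k *\<^sub>R g \<gamma>)
        = (\<Sum>\<alpha> | \<alpha> \<in> index_box n \<and> \<alpha> + unit_index k \<in> index_box n.
            (1 / da_weight \<alpha>) *\<^sub>R g (\<alpha> + unit_index k))" .
  qed
  finally have "(\<Sum>\<gamma>\<in>index_box n - {0}. (1 / da_weight \<gamma>) *\<^sub>R g \<gamma>)
    = (\<Sum>k\<in>UNIV. \<Sum>\<alpha> | \<alpha> \<in> index_box n \<and> \<alpha> + unit_index k \<in> index_box n.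
        (1 / da_weight \<alpha>) *\<^sub>R g (\<alpha> + unit_index k))" .
  moreover have "0 \<in> (index_box n :: ('d \<Rightarrow>\<^sub>0 nat) set)"
    using assms by (simp add: index_box_def)
  ultimately show ?thesis
    by (subst sum.remove[of _ 0]) auto
qed

section \<open>Monomials in commuting operators\<close>

lemma blinfun_ext_iff: "f = g \<longleftrightarrow> (\<forall>x. blinfun_apply f x = blinfun_apply g x)"
  by (auto intro: blinfun_eqI)

lemma id_bops [simp]: "id_blinfun \<in> bops"
  by (simp add: bops_def)

lemma zero_bops [simp]: "0 \<in> bops"
  by (simp add: bops_def)

lemma compose_bops: "A \<in> bops \<Longrightarrow> B \<in> bops \<Longrightarrow> A o\<^sub>L B \<in> bops"
  by (simp add: bops_def)

lemma add_bops: "A \<in> bops \<Longrightarrow> B \<in> bops \<Longrightarrow> A + B \<in> bops"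
  by (simp add: bops_def blinfun.add_left scaleC_add_right)

lemma scaleC_bops: "A \<in> bops \<Longrightarrow> c *\<^sub>C A \<in> bops"
  by (simp add: bops_def scaleC_blinfun.rep_eq scaleC_scaleC mult.commute)

lemma sum_bops: "(\<And>i. i \<in> I \<Longrightarrow> A i \<in> bops) \<Longrightarrow> (\<Sum>i\<in>I. A i) \<in> bops"
  by (induction I rule: infinite_finite_induct) (auto simp: add_bops)

lemma blinfun_scaleC_sum_apply:
  "blinfun_apply (\<Sum>i\<in>I. f i *\<^sub>C A i) x = (\<Sum>i\<in>I. f i *\<^sub>C blinfun_apply (A i) x)"
  by (simp add: blinfun.sum_left scaleC_blinfun.rep_eq)

lemma bops_scaleC_sum:
  "B \<in> bops \<Longrightarrow> blinfun_apply B (\<Sum>i\<in>I. f i *\<^sub>C x i) = (\<Sum>i\<in>I. f i *\<^sub>C blinfun_apply B (x i))"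
  by (simp add: blinfun.sum_right bopsD)

lemma blinfun_compose_id [simp]: "id_blinfun o\<^sub>L A = A" "A o\<^sub>L id_blinfun = A"
  by (simp_all add: blinfun_ext_iff)

lemma blinfun_compose_assoc: "(A o\<^sub>L B) o\<^sub>L C = A o\<^sub>L (B o\<^sub>L C)"
  by (simp add: blinfun_ext_iff)

text \<open>The index type carries no order, hence a fold over \<open>UNIV\<close>. For commuting
  tuples the result is the usual power, accessible through
  \<open>op_monomial_add_unit_index\<close>.\<close>

definition op_monomial ::
  "('d::finite, 'h::complex_inner) op_tuple \<Rightarrow> ('d \<Rightarrow>\<^sub>0 nat) \<Rightarrow> ('h \<Rightarrow>\<^sub>L 'h)" where
  "op_monomial T \<alpha> = Finite_Set.fold (\<lambda>k. ((o\<^sub>L) (T k)) ^^ Poly_Mapping.lookup \<alpha> k) id_blinfun UNIV"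

lemma op_monomial_0 [simp]:
  fixes T :: "('d::finite, 'h::complex_inner) op_tuple"
  shows "op_monomial T 0 = id_blinfun"
proof -
  \<comment> \<open>At exponent 0 every step of the fold is the identity, so the steps commute for
    any tuple.\<close>
  have comm: "comp_fun_commute_on UNIV (\<lambda>(_ :: 'd) a :: 'h \<Rightarrow>\<^sub>L 'b. a)"
    by unfold_locales auto
  have "Finite_Set.fold (\<lambda>_ a. a) (z :: 'h \<Rightarrow>\<^sub>L 'b) A = z" if "finite A" for A :: "'d set" and z
    using that
  proof (induction A rule: finite_induct)
    case (insert x F)
    then show ?case
      by (subst comp_fun_commute_on.fold_insert[OF comm]) auto
  qed simp
  from this[of UNIV] show ?thesis
    by (simp add: op_monomial_def id_def)
qed

lemma op_monomial_add_unit_index: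
  fixes T :: "('d::finite, 'h::complex_inner) op_tuple"
  assumes "commuting_tuple T"
  shows "op_monomial T (\<alpha> + unit_index k) = T k o\<^sub>L op_monomial T \<alpha>"
proof -
  let ?f = "\<lambda>\<alpha> k. ((o\<^sub>L) (T k) :: ('h \<Rightarrow>\<^sub>L 'h) \<Rightarrow> _) ^^ Poly_Mapping.lookup \<alpha> k"
  have comm: "comp_fun_commute_on UNIV (?f \<alpha>)" for \<alpha>
  proof
    fix j k
    have 1: "T j o\<^sub>L (T k o\<^sub>L A) = T k o\<^sub>L (T j o\<^sub>L A)" for A
      using assms by (metis blinfun_compose_assoc commuting_tuple_def)
    have 2: "(((o\<^sub>L) (T j)) ^^ m) (T k o\<^sub>L A) = T k o\<^sub>L ((((o\<^sub>L) (T j)) ^^ m) A)" for m A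
      by (induction m) (simp_all add: 1)
    have "(((o\<^sub>L) (T j)) ^^ m) ((((o\<^sub>L) (T k)) ^^ n) A) = (((o\<^sub>L) (T k)) ^^ n) ((((o\<^sub>L) (T j)) ^^ m) A)"
      for m n and A :: "'h \<Rightarrow>\<^sub>L 'h"
      by (induction n) (simp_all add: 2)
    then show "?f \<alpha> j \<circ> ?f \<alpha> k = ?f \<alpha> k \<circ> ?f \<alpha> j"
      by (simp add: fun_eq_iff)
  qed
  \<comment> \<open>Coordinate k is pulled to the front: it is the only factor in which \<alpha> and
    \<open>\<alpha> + unit_index k\<close> differ.\<close>
  have split: "op_monomial T \<alpha> = ?f \<alpha> k (Finite_Set.fold (?f \<alpha>) id_blinfun (UNIV - {k}))" for \<alpha>
  proof -
    have "op_monomial T \<alpha> = Finite_Set.fold (?f \<alpha>) id_blinfun (insert k (UNIV - {k}))"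
      by (simp add: op_monomial_def insert_absorb)
    also have "\<dots> = ?f \<alpha> k (Finite_Set.fold (?f \<alpha>) id_blinfun (UNIV - {k}))"
      by (rule comp_fun_commute_on.fold_insert[OF comm]) auto
    finally show ?thesis .
  qed
  have "Finite_Set.fold (?f (\<alpha> + unit_index k)) id_blinfun (UNIV - {k})
      = Finite_Set.fold (?f \<alpha>) id_blinfun (UNIV - {k})"
    by (rule Finite_Set.fold_cong[of UNIV, OF comm comm]) (auto simp: lookup_add_unit_index)
  then show ?thesis
    unfolding split[of "\<alpha> + unit_index k"] split[of \<alpha>] by (simp add: lookup_add_unit_index)
qed

lemma op_monomial_add:
  assumes "commuting_tuple T"
  shows "op_monomial T (\<alpha> + \<beta>) = op_monomial T \<alpha> o\<^sub>L op_monomial T \<beta>"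
proof (induction \<alpha> rule: multi_index_induct)
  case (add \<alpha> k)
  have "\<alpha> + unit_index k + \<beta> = \<alpha> + \<beta> + unit_index k"
    by (simp add: ac_simps)
  then show ?case
    by (simp only: op_monomial_add_unit_index[OF assms] add.IH) (simp add: blinfun_ext_iff)
qed simp

lemma op_monomial_unit_index:
  "commuting_tuple T \<Longrightarrow> op_monomial T (unit_index k) = T k"
  using op_monomial_add_unit_index[of T 0 k] by simp

lemma op_monomial_bops:
  assumes "commuting_tuple T" "\<And>k. T k \<in> bops"
  shows "op_monomial T \<alpha> \<in> bops"
  by (induction \<alpha> rule: multi_index_induct)
     (simp_all add: op_monomial_add_unit_index assms compose_bops)

lemma op_monomial_single:
  assumes "commuting_tuple T"
  shows "op_monomial T (Poly_Mapping.single k n) x = (blinfun_apply (T k) ^^ n) x"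
proof (induction n)
  case (Suc n)
  have "Poly_Mapping.single k (Suc n) = Poly_Mapping.single k n + unit_index k"
    by (simp flip: single_add)
  then show ?case
    using Suc by (simp only: op_monomial_add_unit_index[OF assms]) simp
qed simp

text \<open>If one exponent reaches the largest of the nilpotency orders, a vanishing power of that
  \<open>T k\<close> splits off the monomial. Hence only finitely many monomials survive.\<close>

lemma nilpotent_op_monomial_eq_0:
  assumes T: "commuting_tuple T" and "nilpotent_tuple T"
  obtains m where "\<And>\<alpha>. \<alpha> \<notin> index_box m \<Longrightarrow> op_monomial T \<alpha> = 0"
proof -
  obtain e where e: "\<And>k x. (blinfun_apply (T k) ^^ e k) x = 0"
    using assms(2) unfolding nilpotent_tuple_def by metis
  have "op_monomial T \<alpha> = 0" if \<alpha>: "\<alpha> \<notin> index_box (Max (range e))" for \<alpha>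
  proof -
    obtain k where "Max (range e) \<le> Poly_Mapping.lookup \<alpha> k"
      using \<alpha> by (auto simp: index_box_def not_less)
    then have le: "e k \<le> Poly_Mapping.lookup \<alpha> k"
      using order_trans[OF Max_ge[of "range e" "e k"]] by simp
    have \<alpha>: "\<alpha> = (\<alpha> - Poly_Mapping.single k (e k)) + Poly_Mapping.single k (e k)"
      by (rule index_diff_add[symmetric]) (use le in \<open>auto simp: lookup_single when_def\<close>)
    show ?thesis
      by (subst \<alpha>) (simp add: op_monomial_add[OF T] blinfun_ext_iff op_monomial_single[OF T] e blinfun.zero_right)
  qed
  then show ?thesis
    using that by blast
qed

lemma commuting_adj:
  assumes "commuting_tuple T" "\<And>k. T k \<in> bops"
  shows "commuting_tuple (\<lambda>k. adj (T k))"
  unfolding commuting_tuple_def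
proof (intro allI blinfun_eqI cinner_extR)
  fix j k x y
  have "T k (T j y) = T j (T k y)"
    using assms(1) by (metis blinfun_apply_blinfun_compose commuting_tuple_def)
  then show "cinner y ((adj (T j) o\<^sub>L adj (T k)) x) = cinner y ((adj (T k) o\<^sub>L adj (T j)) x)"
    by (simp add: adj_cinner[symmetric] assms(2))
qed

text \<open>Adjunction reverses the order of the factors; this does no harm because the adjoints
  commute as well.\<close>

lemma op_monomial_adj:
  assumes "commuting_tuple T" "\<And>k. T k \<in> bops"
  shows "cinner (op_monomial T \<alpha> x) y = cinner x (op_monomial (\<lambda>k. adj (T k)) \<alpha> y)"
proof (induction \<alpha> arbitrary: x y rule: multi_index_induct)
  case (add \<alpha> k)
  have "op_monomial T (\<alpha> + unit_index k) x = op_monomial T \<alpha> (T k x)"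
    using op_monomial_add[OF assms(1), of \<alpha> "unit_index k"]
    by (simp add: op_monomial_unit_index[OF assms(1)])
  then show ?case
    by (simp add: add.IH adj_cinner assms op_monomial_add_unit_index[OF commuting_adj[OF assms]])
qed simp

lemma ampliation_apply [simp]: "ampliation T k x $ i = T k (x $ i)"
  by (simp add: ampliation_def blinfun_ampl.rep_eq)

lemma op_monomial_ampliation:
  assumes "commuting_tuple T" "commuting_tuple (ampliation T :: ('d::finite, 'h::complex_inner ^ 's::finite) op_tuple)"
  shows "op_monomial (ampliation T :: ('d::finite, 'h::complex_inner ^ 's::finite) op_tuple) \<alpha> = blinfun_ampl (op_monomial T \<alpha>)"
  by (induction \<alpha> rule: multi_index_induct)
     (simp_all add: op_monomial_add_unit_index assms blinfun_ext_iff blinfun_ampl.rep_eq vec_eq_iff)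

section \<open>Operators on the Drury--Arveson space\<close>

lemma da_norm_sq: "(norm f)\<^sup>2 = (\<Sum>\<^sub>\<infinity>\<alpha>. da_weight \<alpha> * (cmod (da_coeff f \<alpha>))\<^sup>2)"
proof -
  have "0 \<le> (\<Sum>\<^sub>\<infinity>\<alpha>. da_weight \<alpha> * (cmod (da_coeff f \<alpha>))\<^sup>2)"
    by (intro infsum_nonneg mult_nonneg_nonneg da_weight_nonneg) simp
  then show ?thesis
    by (simp add: norm_drury_arveson_def da_norm_def)
qed

lemma da_finite_sum_le:
  "finite F \<Longrightarrow> (\<Sum>\<alpha>\<in>F. da_weight \<alpha> * (cmod (da_coeff f \<alpha>))\<^sup>2) \<le> (norm f)\<^sup>2"
  using da_norm_finite[of F f] by (simp add: norm_drury_arveson_def)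

lemma da_norm_leI:
  assumes "\<And>F. finite F \<Longrightarrow> (\<Sum>\<alpha>\<in>F. da_weight \<alpha> * (cmod (da_coeff f \<alpha>))\<^sup>2) \<le> b\<^sup>2" "0 \<le> b"
  shows "norm f \<le> b"
proof (rule power2_le_imp_le)
  show "(norm f)\<^sup>2 \<le> b\<^sup>2"
    unfolding da_norm_sq by (rule infsum_le_finite_sums[OF da_summable]) (use assms in auto)
qed fact

lemma da_summableI:
  fixes c :: "('d::finite \<Rightarrow>\<^sub>0 nat) \<Rightarrow> complex"
  assumes "\<And>F. finite F \<Longrightarrow> (\<Sum>\<alpha>\<in>F. da_weight \<alpha> * (cmod (c \<alpha>))\<^sup>2) \<le> b"
  shows "(\<lambda>\<alpha>. da_weight \<alpha> * (cmod (c \<alpha>))\<^sup>2) summable_on UNIV"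
  by (rule nonneg_bdd_above_summable_on)
     (use assms in \<open>auto simp: da_weight_nonneg intro!: bdd_aboveI2[where M = b]\<close>)

lemma Abs_da_coeff:
  fixes c :: "('d::finite \<Rightarrow>\<^sub>0 nat) \<Rightarrow> complex"
  assumes "\<And>F. finite F \<Longrightarrow> (\<Sum>\<alpha>\<in>F. da_weight \<alpha> * (cmod (c \<alpha>))\<^sup>2) \<le> b"
  shows "da_coeff (Abs_da c) = c"
  using da_summableI[OF assms] by (simp add: Abs_da_inverse)

definition da_monomial :: "('d::finite \<Rightarrow>\<^sub>0 nat) \<Rightarrow> 'd drury_arveson" where
  "da_monomial \<alpha> = Abs_da (\<lambda>\<beta>. if \<beta> = \<alpha> then 1 else 0)"

lemma da_coeff_monomial: "da_coeff (da_monomial \<alpha>) = (\<lambda>\<beta>. if \<beta> = \<alpha> then 1 else 0)"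
  unfolding da_monomial_def
proof (rule Abs_da_coeff)
  fix F :: "('a \<Rightarrow>\<^sub>0 nat) set"
  assume "finite F"
  then have "(\<Sum>\<beta>\<in>F. da_weight \<beta> * (cmod (if \<beta> = \<alpha> then 1 else 0))\<^sup>2)
      = (\<Sum>\<beta>\<in>F. if \<beta> = \<alpha> then da_weight \<alpha> else 0)"
    by (intro sum.cong) auto
  also have "\<dots> \<le> da_weight \<alpha>"
    using \<open>finite F\<close> by (simp add: da_weight_nonneg)
  finally show "(\<Sum>\<beta>\<in>F. da_weight \<beta> * (cmod (if \<beta> = \<alpha> then 1 else 0))\<^sup>2) \<le> da_weight \<alpha>" .
qed

text \<open>The orthogonal projection onto the closed span of the monomials in \<open>A\<close>. It
  occurs with boxes, with slices fixing or bounding one exponent, and with finite sets cut by degree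
  windows.\<close>

definition da_restrict :: "('d::finite \<Rightarrow>\<^sub>0 nat) set \<Rightarrow> 'd drury_arveson \<Rightarrow> 'd drury_arveson" where
  "da_restrict A f = Abs_da (\<lambda>\<alpha>. if \<alpha> \<in> A then da_coeff f \<alpha> else 0)"

lemma da_coeff_restrict: "da_coeff (da_restrict A f) = (\<lambda>\<alpha>. if \<alpha> \<in> A then da_coeff f \<alpha> else 0)"
  unfolding da_restrict_def
proof (rule Abs_da_coeff)
  fix F :: "('a \<Rightarrow>\<^sub>0 nat) set"
  assume F: "finite F"
  have "(\<Sum>\<alpha>\<in>F. da_weight \<alpha> * (cmod (if \<alpha> \<in> A then da_coeff f \<alpha> else 0))\<^sup>2)
      \<le> (\<Sum>\<alpha>\<in>F. da_weight \<alpha> * (cmod (da_coeff f \<alpha>))\<^sup>2)"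
    by (intro sum_mono) (auto simp: da_weight_nonneg)
  also have "\<dots> \<le> (norm f)\<^sup>2"
    by (rule da_finite_sum_le[OF F])
  finally show "(\<Sum>\<alpha>\<in>F. da_weight \<alpha> * (cmod (if \<alpha> \<in> A then da_coeff f \<alpha> else 0))\<^sup>2) \<le> (norm f)\<^sup>2" .
qed

text \<open>Subtracting \<open>unit_index k\<close> is injective on indices in which k occurs, and
  the weights only grow under it. The bound yields both well-definedness and contractivity of
  \<open>da_shift\<close>.\<close>

lemma sum_shift_le:
  fixes f :: "'d::finite drury_arveson"
  assumes F: "finite F"
  shows "(\<Sum>\<alpha>\<in>F. da_weight \<alpha> * (cmod (if Poly_Mapping.lookup \<alpha> k = 0 then 0 else da_coeff f (\<alpha> - unit_index k)))\<^sup>2)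
    \<le> (norm f)\<^sup>2"
proof -
  let ?c = "da_coeff f"
  let ?G = "{\<alpha> \<in> F. Poly_Mapping.lookup \<alpha> k \<noteq> 0}"
  have "(\<Sum>\<alpha>\<in>F. da_weight \<alpha> * (cmod (if Poly_Mapping.lookup \<alpha> k = 0 then 0 else ?c (\<alpha> - unit_index k)))\<^sup>2)
      = (\<Sum>\<alpha>\<in>?G. da_weight \<alpha> * (cmod (?c (\<alpha> - unit_index k)))\<^sup>2)"
    using F by (intro sum.mono_neutral_cong_right) auto
  also have "\<dots> \<le> (\<Sum>\<alpha>\<in>?G. da_weight (\<alpha> - unit_index k) * (cmod (?c (\<alpha> - unit_index k)))\<^sup>2)"
  proof (intro sum_mono mult_right_mono)
    fix \<alpha> assume "\<alpha> \<in> ?G"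
    then show "da_weight \<alpha> \<le> da_weight (\<alpha> - unit_index k)"
      using da_weight_add_unit_index_le[of "\<alpha> - unit_index k" k] diff_unit_index[of \<alpha> k] by simp
  qed simp
  also have "\<dots> = (\<Sum>\<alpha>\<in>(\<lambda>\<alpha>. \<alpha> - unit_index k) ` ?G. da_weight \<alpha> * (cmod (?c \<alpha>))\<^sup>2)"
  proof (subst sum.reindex)
    show "inj_on (\<lambda>\<alpha>. \<alpha> - unit_index k) ?G"
      by (rule inj_onI) (metis (mono_tags, lifting) diff_unit_index mem_Collect_eq)
  qed simp
  also have "\<dots> \<le> (norm f)\<^sup>2"
    by (rule da_finite_sum_le) (use F in auto)
  finally show ?thesis .
qed

definition da_shift_fun :: "'d::finite \<Rightarrow> 'd drury_arveson \<Rightarrow> 'd drury_arveson" where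
  "da_shift_fun k f = Abs_da (\<lambda>\<alpha>. if Poly_Mapping.lookup \<alpha> k = 0 then 0 else da_coeff f (\<alpha> - unit_index k))"

lemma da_coeff_shift_fun: "da_coeff (da_shift_fun k f)
    = (\<lambda>\<alpha>. if Poly_Mapping.lookup \<alpha> k = 0 then 0 else da_coeff f (\<alpha> - unit_index k))"
  unfolding da_shift_fun_def by (rule Abs_da_coeff, rule sum_shift_le)

lift_definition da_shift :: "'d::finite \<Rightarrow> ('d drury_arveson \<Rightarrow>\<^sub>L 'd drury_arveson)" is da_shift_fun
proof (rule bounded_linear_intro[where K = 1])
  fix k :: 'd and f g :: "'d drury_arveson" and r :: real
  show "da_shift_fun k (f + g) = da_shift_fun k f + da_shift_fun k g"
    by (simp add: da_eq_iff da_coeff_shift_fun da_coeff_simps)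
  show "da_shift_fun k (r *\<^sub>R f) = r *\<^sub>R da_shift_fun k f"
    by (simp add: da_eq_iff da_coeff_shift_fun da_coeff_simps)
  have "norm (da_shift_fun k f) \<le> norm f"
    by (rule da_norm_leI) (simp_all add: sum_shift_le da_coeff_shift_fun)
  then show "norm (da_shift_fun k f) \<le> norm f * 1"
    by simp
qed

lemma da_shift_bops [simp]: "da_shift k \<in> bops"
  by (simp add: bops_def da_shift.rep_eq da_eq_iff da_coeff_shift_fun da_coeff_simps)

lemma da_shift_monomial: "da_shift k (da_monomial \<alpha>) = da_monomial (\<alpha> + unit_index k)"
proof -
  have "\<beta> - unit_index k = \<alpha> \<longleftrightarrow> \<beta> = \<alpha> + unit_index k" if "Poly_Mapping.lookup \<beta> k \<noteq> 0" for \<beta>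
    using diff_unit_index[OF that] by auto
  then show ?thesis
    by (auto simp: da_eq_iff da_shift.rep_eq da_coeff_shift_fun da_coeff_monomial lookup_add_unit_index)
qed

lemma bounded_linear_da_restrict: "bounded_linear (da_restrict A)"
proof (rule bounded_linear_intro[where K = 1])
  fix f g :: "'a drury_arveson" and r :: real
  show "da_restrict A (f + g) = da_restrict A f + da_restrict A g"
    by (simp add: da_eq_iff da_coeff_restrict da_coeff_simps)
  show "da_restrict A (r *\<^sub>R f) = r *\<^sub>R da_restrict A f"
    by (simp add: da_eq_iff da_coeff_restrict da_coeff_simps)
  have "norm (da_restrict A f) \<le> norm f"
  proof (rule da_norm_leI)
    fix F :: "('a \<Rightarrow>\<^sub>0 nat) set" assume F: "finite F"
    have "(\<Sum>\<alpha>\<in>F. da_weight \<alpha> * (cmod (da_coeff (da_restrict A f) \<alpha>))\<^sup>2)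
        \<le> (\<Sum>\<alpha>\<in>F. da_weight \<alpha> * (cmod (da_coeff f \<alpha>))\<^sup>2)"
      by (intro sum_mono) (auto simp: da_weight_nonneg da_coeff_restrict)
    also have "\<dots> \<le> (norm f)\<^sup>2"
      by (rule da_finite_sum_le[OF F])
    finally show "(\<Sum>\<alpha>\<in>F. da_weight \<alpha> * (cmod (da_coeff (da_restrict A f) \<alpha>))\<^sup>2) \<le> (norm f)\<^sup>2" .
  qed simp
  then show "norm (da_restrict A f) \<le> norm f * 1"
    by simp
qed

lemma da_restrict_scaleC: "da_restrict A (c *\<^sub>C f) = c *\<^sub>C da_restrict A f"
  by (simp add: da_eq_iff da_coeff_restrict da_coeff_simps)

lemma da_restrict_monomial: "da_restrict A (da_monomial \<alpha>) = (if \<alpha> \<in> A then da_monomial \<alpha> else 0)"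
  by (auto simp: da_eq_iff da_coeff_restrict da_coeff_monomial da_coeff_simps)

lemma da_coeff_sum: "da_coeff (\<Sum>i\<in>I. f i) \<alpha> = (\<Sum>i\<in>I. da_coeff (f i) \<alpha>)"
  by (induction I rule: infinite_finite_induct) (auto simp: da_coeff_simps)

lemma da_restrict_finite:
  assumes "finite F"
  shows "da_restrict F f = (\<Sum>\<alpha>\<in>F. da_coeff f \<alpha> *\<^sub>C da_monomial \<alpha>)"
  using assms
  by (simp add: da_eq_iff da_coeff_restrict da_coeff_sum da_coeff_simps da_coeff_monomial
      if_distrib[of "\<lambda>x. _ * x"] cong: if_cong)

text \<open>A finite set of indices carries the squared norm of f up to
  \<open>e\<^sup>2 / 2\<close>. Once \<open>A n\<close> contains it, the discarded part has norm at
  most \<open>e / sqrt 2\<close>, which is strictly below e.\<close>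

lemma da_restrict_tendsto:
  assumes "\<And>\<alpha>. \<forall>\<^sub>F n in sequentially. \<alpha> \<in> A n"
  shows "(\<lambda>n. da_restrict (A n) f) \<longlonglongrightarrow> f"
proof (rule tendstoI)
  fix e :: real
  assume e: "e > 0"
  let ?s = "\<lambda>\<alpha>. da_weight \<alpha> * (cmod (da_coeff f \<alpha>))\<^sup>2"
  have "0 < e\<^sup>2 / 2"
    using e by simp
  from infsum_finite_approximation[OF da_summable[of f] this]
  obtain F where F: "finite F" "dist (sum ?s F) (infsum ?s UNIV) \<le> e\<^sup>2 / 2"
    by auto
  have "\<forall>\<^sub>F n in sequentially. \<forall>\<alpha>\<in>F. \<alpha> \<in> A n"
    by (intro eventually_ball_finite F ballI assms)
  then show "\<forall>\<^sub>F n in sequentially. dist (da_restrict (A n) f) f < e"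
  proof eventually_elim
    case (elim n)
    have "norm (da_restrict (A n) f - f) \<le> sqrt (e\<^sup>2 / 2)"
    proof (rule da_norm_leI)
      fix G :: "('a \<Rightarrow>\<^sub>0 nat) set"
      assume G: "finite G"
      have "(\<Sum>\<alpha>\<in>G. da_weight \<alpha> * (cmod (da_coeff (da_restrict (A n) f - f) \<alpha>))\<^sup>2)
          = (\<Sum>\<alpha>\<in>G - F. da_weight \<alpha> * (cmod (da_coeff (da_restrict (A n) f - f) \<alpha>))\<^sup>2)"
        using elim G by (intro sum.mono_neutral_right) (auto simp: da_coeff_simps da_coeff_restrict)
      also have "\<dots> \<le> (\<Sum>\<alpha>\<in>G - F. ?s \<alpha>)"
        by (intro sum_mono) (auto simp: da_coeff_simps da_coeff_restrict da_weight_nonneg)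
      also have "\<dots> = sum ?s (F \<union> G) - sum ?s F"
        using F G by (simp add: sum_diff[symmetric] Un_Diff)
      also have "\<dots> \<le> infsum ?s UNIV - sum ?s F"
        using da_finite_sum_le[of "F \<union> G" f] F G by (simp add: da_norm_sq)
      also have "\<dots> \<le> e\<^sup>2 / 2"
        using F(2) unfolding dist_real_def by linarith
      finally show "(\<Sum>\<alpha>\<in>G. da_weight \<alpha> * (cmod (da_coeff (da_restrict (A n) f - f) \<alpha>))\<^sup>2)
          \<le> (sqrt (e\<^sup>2 / 2))\<^sup>2"
        using e by simp
    qed (use e in simp)
    also have "\<dots> < e"
      using e by (intro real_less_lsqrt) (auto simp: power2_eq_square)
    finally show ?case
      by (simp add: dist_norm)
  qed
qed

lemma da_monomials_dense: "(\<lambda>n. \<Sum>\<alpha>\<in>index_box n. da_coeff f \<alpha> *\<^sub>C da_monomial \<alpha>) \<longlonglongrightarrow> f"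
  using da_restrict_tendsto[OF eventually_in_index_box, of f] by (simp add: da_restrict_finite)

text \<open>Linear combinations of monomials are dense. The scalar \<open>c\<close> belongs to the
  test vectors because \<open>bounded_linear\<close> gives real linearity only.\<close>

lemma da_linear_ext:
  fixes F G :: "'d::finite drury_arveson \<Rightarrow> 'b::real_normed_vector"
  assumes F: "bounded_linear F" and G: "bounded_linear G"
    and eq: "\<And>c \<alpha>. F (c *\<^sub>C da_monomial \<alpha>) = G (c *\<^sub>C da_monomial \<alpha>)"
  shows "F f = G f"
proof -
  interpret F: bounded_linear F by fact
  interpret G: bounded_linear G by fact
  have "(\<lambda>n. F (\<Sum>\<alpha>\<in>index_box n. da_coeff f \<alpha> *\<^sub>C da_monomial \<alpha>)) \<longlonglongrightarrow> F f"
    by (rule F.tendsto[OF da_monomials_dense])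
  moreover have "(\<lambda>n. F (\<Sum>\<alpha>\<in>index_box n. da_coeff f \<alpha> *\<^sub>C da_monomial \<alpha>)) \<longlonglongrightarrow> G f"
    using G.tendsto[OF da_monomials_dense[of f]] by (simp add: F.sum G.sum eq)
  ultimately show ?thesis
    by (rule LIMSEQ_unique)
qed

lemma cinner_da_monomial: "cinner f (da_monomial \<alpha>) = complex_of_real (da_weight \<alpha>) * da_coeff f \<alpha>"
proof -
  have "cinner f (da_monomial \<alpha>)
      = (\<Sum>\<^sub>\<infinity>\<beta>\<in>{\<alpha>}. complex_of_real (da_weight \<beta>) * (da_coeff f \<beta> * cnj (da_coeff (da_monomial \<alpha>) \<beta>)))"
    unfolding cinner_drury_arveson_def da_inner_def
    by (rule infsum_cong_neutral) (auto simp: da_coeff_monomial)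
  then show ?thesis
    by (simp add: da_coeff_monomial)
qed

lemma da_coeff_cinner: "da_coeff f \<alpha> = cinner f (da_monomial \<alpha>) / complex_of_real (da_weight \<alpha>)"
  using da_weight_pos[of \<alpha>] by (simp add: cinner_da_monomial)

lemma bounded_linear_da_coeff: "bounded_linear (\<lambda>f. da_coeff f \<alpha>)"
  unfolding da_coeff_cinner by (intro bounded_linear_divide bounded_linear_compose[OF bounded_linear_divide]
    cinner_bilinear.bounded_linear_left)

section \<open>The reproducing kernel and point evaluations\<close>

lemma multi_power_0 [simp]: "multi_power z 0 = 1"
  by (simp add: multi_power_def)

lemma multi_power_add: "multi_power z (\<alpha> + \<beta>) = multi_power z \<alpha> * multi_power z \<beta>"
  by (simp add: multi_power_def lookup_add power_add prod.distrib)

lemma multi_power_unit_index [simp]: "multi_power z (unit_index k) = z $ k"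
proof -
  have "multi_power z (unit_index k) = (\<Prod>j\<in>UNIV. if j = k then z $ j else 1)"
    unfolding multi_power_def by (intro prod.cong) (auto simp: lookup_single when_def)
  then show ?thesis
    by simp
qed

lemma norm_sq_vec: "(norm (z :: complex ^ 'd::finite))\<^sup>2 = (\<Sum>k\<in>UNIV. (cmod (z $ k))\<^sup>2)"
  by (simp add: norm_vec_def L2_set_def sum_nonneg)

text \<open>The full sum is the value \<open>1 / (1 - (norm z)\<^sup>2)\<close> of the reproducing
  kernel on the diagonal. For its truncation \<open>S\<close> to a box, Pascal's rule gives
  \<open>S \<le> 1 + (norm z)\<^sup>2 * S\<close>, which is solved for \<open>S\<close>.\<close>

lemma sum_kernel_le:
  fixes z :: "complex ^ 'd::finite"
  assumes z: "z \<in> ball 0 1" and F: "finite F"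
  shows "(\<Sum>\<alpha>\<in>F. (cmod (multi_power z \<alpha>))\<^sup>2 / da_weight \<alpha>) \<le> 1 / (1 - (norm z)\<^sup>2)"
proof -
  let ?g = "\<lambda>\<alpha>. (cmod (multi_power z \<alpha>))\<^sup>2"
  have z1: "(norm z)\<^sup>2 < 1"
    using z by (simp add: abs_square_less_1)
  obtain m where m: "F \<subseteq> index_box m"
    using finite_subset_index_box[OF F] .
  define n where "n = Suc m"
  have n: "F \<subseteq> index_box n" "n > 0"
    using m index_box_mono[of m n] by (auto simp: n_def)
  define S where "S = (\<Sum>\<alpha>\<in>index_box n. ?g \<alpha> / da_weight \<alpha>)"
  have "S = ?g 0 + (\<Sum>k\<in>UNIV. \<Sum>\<alpha> | \<alpha> \<in> index_box n \<and> \<alpha> + unit_index k \<in> index_box n.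
      ?g (\<alpha> + unit_index k) / da_weight \<alpha>)"
    using sum_index_box_Pascal[OF n(2), of ?g] by (simp add: S_def)
  also have "\<dots> \<le> 1 + (\<Sum>k\<in>UNIV. \<Sum>\<alpha>\<in>index_box n. ?g (\<alpha> + unit_index k) / da_weight \<alpha>)"
    using da_weight_nonneg by (auto intro!: add_mono sum_mono sum_mono2 divide_nonneg_nonneg)
  also have "\<dots> = 1 + (\<Sum>k\<in>UNIV. (cmod (z $ k))\<^sup>2 * S)"
    by (simp add: S_def sum_distrib_left multi_power_add norm_mult power_mult_distrib mult.commute)
  also have "\<dots> = 1 + (norm z)\<^sup>2 * S"
    by (simp add: norm_sq_vec sum_distrib_right)
  finally have "S \<le> 1 / (1 - (norm z)\<^sup>2)"
    using z1 by (simp add: field_simps)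
  moreover have "(\<Sum>\<alpha>\<in>F. ?g \<alpha> / da_weight \<alpha>) \<le> S"
    unfolding S_def by (rule sum_mono2) (use n da_weight_nonneg in \<open>auto intro!: divide_nonneg_nonneg\<close>)
  ultimately show ?thesis
    by simp
qed

text \<open>The Taylor coefficients of the kernel function
  \<open>1 / (1 - \<langle>x, z\<rangle>)\<close>. Evaluation at \<open>z\<close> becomes an inner
  product with it and is therefore bounded.\<close>

definition da_kernel :: "complex ^ 'd::finite \<Rightarrow> 'd drury_arveson" where
  "da_kernel z = Abs_da (\<lambda>\<alpha>. cnj (multi_power z \<alpha>) / complex_of_real (da_weight \<alpha>))"

lemma da_coeff_kernel:
  assumes "z \<in> ball 0 1"
  shows "da_coeff (da_kernel z) \<alpha> = cnj (multi_power z \<alpha>) / complex_of_real (da_weight \<alpha>)"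
proof -
  have "(\<lambda>\<alpha>. da_weight \<alpha> * (cmod (cnj (multi_power z \<alpha>) / complex_of_real (da_weight \<alpha>)))\<^sup>2) summable_on UNIV"
  proof (rule da_summableI)
    fix F :: "('a \<Rightarrow>\<^sub>0 nat) set" assume F: "finite F"
    have "da_weight \<alpha> * (cmod (cnj (multi_power z \<alpha>) / complex_of_real (da_weight \<alpha>)))\<^sup>2
        = (cmod (multi_power z \<alpha>))\<^sup>2 / da_weight \<alpha>" for \<alpha>
      using da_weight_pos[of \<alpha>] by (simp add: norm_divide power_divide power2_eq_square)
    then show "(\<Sum>\<alpha>\<in>F. da_weight \<alpha> * (cmod (cnj (multi_power z \<alpha>) / complex_of_real (da_weight \<alpha>)))\<^sup>2)
        \<le> 1 / (1 - (norm z)\<^sup>2)"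
      using sum_kernel_le[OF assms F] by simp
  qed
  then show ?thesis
    by (simp add: da_kernel_def Abs_da_inverse)
qed

lemma da_eval_cinner: "z \<in> ball 0 1 \<Longrightarrow> da_eval f z = cinner f (da_kernel z)"
  unfolding da_eval_def cinner_drury_arveson_def da_inner_def
proof (intro infsum_cong)
  fix \<alpha> assume "z \<in> ball 0 1"
  then show "da_coeff f \<alpha> * multi_power z \<alpha>
      = complex_of_real (da_weight \<alpha>) * (da_coeff f \<alpha> * cnj (da_coeff (da_kernel z) \<alpha>))"
    using da_weight_pos[of \<alpha>] by (simp only: da_coeff_kernel) simp
qed

lemma bounded_linear_da_eval: "z \<in> ball 0 1 \<Longrightarrow> bounded_linear (\<lambda>f. da_eval f z)"
  by (simp add: da_eval_cinner cinner_bilinear.bounded_linear_left)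

lemma da_eval_scaleC: "z \<in> ball 0 1 \<Longrightarrow> da_eval (c *\<^sub>C f) z = c * da_eval f z"
  by (simp add: da_eval_cinner cinner.scaleC_left)

lemma da_eval_monomial: "da_eval (da_monomial \<alpha>) z = multi_power z \<alpha>"
proof -
  have "da_eval (da_monomial \<alpha>) z = (\<Sum>\<^sub>\<infinity>\<beta>\<in>{\<alpha>}. da_coeff (da_monomial \<alpha>) \<beta> * multi_power z \<beta>)"
    unfolding da_eval_def by (rule infsum_cong_neutral) (auto simp: da_coeff_monomial)
  then show ?thesis
    by (simp add: da_coeff_monomial)
qed

lemma da_eval_shift:
  assumes z: "z \<in> ball 0 1"
  shows "da_eval (da_shift k f) z = z $ k * da_eval f z"
proof (rule da_linear_ext[where F = "\<lambda>f. da_eval (da_shift k f) z"])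
  show "bounded_linear (\<lambda>f. da_eval (da_shift k f) z)"
    by (rule bounded_linear_compose[OF bounded_linear_da_eval[OF z] blinfun.bounded_linear_right])
  show "bounded_linear (\<lambda>f. z $ k * da_eval f z)"
    by (rule bounded_linear_const_mult[OF bounded_linear_da_eval[OF z]])
qed (simp add: bopsD da_eval_scaleC[OF z] da_shift_monomial da_eval_monomial multi_power_add)

section \<open>Elements of the space are determined by their values on the ball\<close>

lemma vec_scale_coord_in_ball:
  fixes z :: "complex ^ 'd::finite"
  assumes "z \<in> ball 0 1" "cmod t \<le> 1"
  shows "(\<chi> j. if j = k then t * z $ j else z $ j) \<in> ball 0 1"
proof -
  have "norm (\<chi> j. if j = k then t * z $ j else z $ j) \<le> norm z"
    unfolding norm_vec_def using assms(2)
    by (intro L2_set_mono) (auto simp: norm_mult intro: mult_left_le_one_le)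
  then show ?thesis
    using assms(1) by simp
qed

text \<open>Scaling the coordinate \<open>z $ k\<close> by \<open>t\<close> turns \<open>da_eval f\<close> into a power series in \<open>t\<close> whose
  coefficients are the values of the restrictions of \<open>f\<close>.\<close>

lemma da_eval_restrict_eq_0:
  assumes f: "\<And>z. z \<in> ball 0 1 \<Longrightarrow> da_eval f z = 0" and z: "z \<in> ball 0 1"
  shows "da_eval (da_restrict {\<alpha>. Poly_Mapping.lookup \<alpha> k = n} f) z = 0"
proof -
  define u where "u t = (\<chi> j. if j = k then t * z $ j else z $ j)" for t
  have u: "u t \<in> ball 0 1" if "cmod t \<le> 1" for t
    unfolding u_def by (rule vec_scale_coord_in_ball[OF z that])
  define a where "a m = da_eval (da_restrict {\<alpha>. Poly_Mapping.lookup \<alpha> k = m} f) z" for m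
  have pw: "multi_power (u t) \<alpha> = t ^ Poly_Mapping.lookup \<alpha> k * multi_power z \<alpha>" for t \<alpha>
  proof -
    have "multi_power (u t) \<alpha> = (\<Prod>j\<in>UNIV. (if j = k then t ^ Poly_Mapping.lookup \<alpha> k else 1)
        * (z $ j) ^ Poly_Mapping.lookup \<alpha> j)"
      unfolding multi_power_def u_def by (intro prod.cong) (auto simp: power_mult_distrib)
    then show ?thesis
      by (simp add: prod.distrib multi_power_def)
  qed
  have part: "da_eval (da_restrict {\<alpha>. Poly_Mapping.lookup \<alpha> k < N} f) (u t) = (\<Sum>m<N. a m * t ^ m)"
    if t: "cmod t \<le> 1" for t N
    unfolding a_def
  proof (rule da_linear_ext[where f = f])
    show "bounded_linear (\<lambda>f. da_eval (da_restrict {\<alpha>. Poly_Mapping.lookup \<alpha> k < N} f) (u t))"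
      by (rule bounded_linear_compose[OF bounded_linear_da_eval[OF u[OF t]] bounded_linear_da_restrict])
    show "bounded_linear (\<lambda>f. \<Sum>m<N. da_eval (da_restrict {\<alpha>. Poly_Mapping.lookup \<alpha> k = m} f) z * t ^ m)"
      by (intro bounded_linear_sum bounded_linear_mult_const
          bounded_linear_compose[OF bounded_linear_da_eval[OF z] bounded_linear_da_restrict])
    have 0: "da_eval 0 w = 0" for w :: "complex ^ 'a"
      by (simp add: da_eval_def da_coeff_simps)
    show "da_eval (da_restrict {\<alpha>. Poly_Mapping.lookup \<alpha> k < N} (c *\<^sub>C da_monomial \<alpha>)) (u t)
        = (\<Sum>m<N. da_eval (da_restrict {\<alpha>. Poly_Mapping.lookup \<alpha> k = m} (c *\<^sub>C da_monomial \<alpha>)) z * t ^ m)"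
      for c \<alpha>
      by (simp add: da_restrict_scaleC da_restrict_monomial da_eval_scaleC[OF z] da_eval_scaleC[OF u[OF t]]
          da_eval_monomial pw 0 if_distrib[of "\<lambda>x. da_eval x _"] if_distrib[of "\<lambda>x. _ * x"]
          if_distrib[of "\<lambda>x. x * _"] cong: if_cong)
  qed
  have sums: "(\<lambda>m. a m * t ^ m) sums 0" if t: "cmod t \<le> 1" for t
  proof -
    have "(\<lambda>N. da_restrict {\<alpha>. Poly_Mapping.lookup \<alpha> k < N} f) \<longlonglongrightarrow> f"
      by (rule da_restrict_tendsto) (auto intro: eventually_gt_at_top)
    from bounded_linear.tendsto[OF bounded_linear_da_eval[OF u[OF t]] this]
    show ?thesis
      unfolding sums_def part[OF t] f[OF u[OF t]] .
  qed
  have "a n = 0"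
  proof (rule ccontr)
    assume an: "a n \<noteq> 0"
    \<comment> \<open>The identity theorem below asks for a nonzero coefficient of positive index;
      index 0 is read off at \<open>t = 0\<close>.\<close>
    have "a 0 = 0"
      using sums[of 0] by simp
    then have "n > 0"
      using an by (cases n) auto
    \<comment> \<open>Applied to the zero function: a nonzero coefficient would give a punctured
      disc on which 0 differs from 0.\<close>
    show False
    proof (rule powser_0_nonzero[of 1 0 a "\<lambda>_. 0", OF _ _ _ an \<open>n > 0\<close>])
      show "(\<lambda>n. a n * (x - 0) ^ n) sums 0" if "cmod (x - 0) < 1" for x
        using sums[of x] that by simp
      show False if "0 < s" "\<And>z :: complex. z \<in> cball 0 s - {0} \<Longrightarrow> (0::complex) \<noteq> 0" for s
        using that(2)[of "complex_of_real s"] that(1) by simp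
    qed simp_all
  qed
  then show ?thesis
    by (simp add: a_def)
qed

text \<open>Slicing along one coordinate after another preserves vanishing on the ball and finally
  isolates a single Taylor term. One point with nonzero coordinates then shows that its coefficient
  is 0.\<close>

lemma da_eval_inject:
  assumes f: "\<And>z. z \<in> ball 0 1 \<Longrightarrow> da_eval f z = 0"
  shows "f = 0"
proof -
  have "da_coeff f \<gamma> = 0" for \<gamma>
  proof -
    have *: "\<forall>z\<in>ball 0 1. da_eval (da_restrict {\<alpha>. \<forall>k\<in>J. Poly_Mapping.lookup \<alpha> k = Poly_Mapping.lookup \<gamma> k} f) z = 0"
      if "finite J" for J
      using that
    proof (induction J rule: finite_induct)
      case empty
      have "da_restrict UNIV f = f"
        by (simp add: da_eq_iff da_coeff_restrict)
      then show ?case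
        using f by simp
    next
      case (insert k J)
      have "da_restrict {\<alpha>. \<forall>k\<in>insert k J. Poly_Mapping.lookup \<alpha> k = Poly_Mapping.lookup \<gamma> k} f
          = da_restrict {\<alpha>. Poly_Mapping.lookup \<alpha> k = Poly_Mapping.lookup \<gamma> k}
              (da_restrict {\<alpha>. \<forall>k\<in>J. Poly_Mapping.lookup \<alpha> k = Poly_Mapping.lookup \<gamma> k} f)"
        by (auto simp: da_eq_iff da_coeff_restrict)
      then show ?case
        using insert.IH by (simp only:) (intro ballI da_eval_restrict_eq_0, auto)
    qed
    \<comment> \<open>The coordinates of \<open>z\<close> add up to 1/2, which keeps it in the ball,
      and none of them vanishes, so \<open>multi_power z \<gamma>\<close> is nonzero.\<close>
    define c where "c = 1 / (2 * real CARD('a))"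
    define z :: "complex ^ 'a" where "z = (\<chi> k. complex_of_real c)"
    have c: "c > 0"
      by (simp add: c_def)
    have "norm z \<le> (\<Sum>k\<in>(UNIV :: 'a set). c)"
      unfolding norm_vec_def using L2_set_le_sum[of UNIV "\<lambda>i. norm (z $ i)"] c by (simp add: z_def)
    also have "\<dots> < 1"
      by (simp add: c_def)
    finally have z: "z \<in> ball 0 1"
      by simp
    have "da_restrict {\<alpha>. \<forall>k\<in>UNIV. Poly_Mapping.lookup \<alpha> k = Poly_Mapping.lookup \<gamma> k} f
        = da_coeff f \<gamma> *\<^sub>C da_monomial \<gamma>"
      by (auto simp: da_eq_iff da_coeff_restrict da_coeff_simps da_coeff_monomial intro: poly_mapping_eqI)
    then have "da_coeff f \<gamma> * multi_power z \<gamma> = 0"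
      using bspec[OF *[of UNIV, OF finite] z] da_eval_scaleC[OF z, of "da_coeff f \<gamma>" "da_monomial \<gamma>"]
      by (simp add: da_eval_monomial)
    moreover have "multi_power z \<gamma> \<noteq> 0"
      using c by (simp add: multi_power_def z_def)
    ultimately show ?thesis
      by simp
  qed
  then show ?thesis
    by (simp add: da_eq_iff da_coeff_simps)
qed

section \<open>Multipliers\<close>

lemma commuting_da_shift: "commuting_tuple da_shift"
  unfolding commuting_tuple_def
proof (intro allI blinfun_eqI)
  fix j k :: 'a and f
  show "(da_shift j o\<^sub>L da_shift k) f = (da_shift k o\<^sub>L da_shift j) f"
  proof (rule da_linear_ext[where F = "blinfun_apply _" and G = "blinfun_apply _"])
    show "(da_shift j o\<^sub>L da_shift k) (c *\<^sub>C da_monomial \<alpha>) = (da_shift k o\<^sub>L da_shift j) (c *\<^sub>C da_monomial \<alpha>)"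
      for c \<alpha>
      by (simp add: bopsD da_shift_monomial ac_simps)
  qed (rule blinfun.bounded_linear_right)+
qed

lemma da_shift_power_monomial: "op_monomial da_shift \<alpha> (da_monomial \<beta>) = da_monomial (\<alpha> + \<beta>)"
  by (induction \<alpha> rule: multi_index_induct)
     (simp_all add: op_monomial_add_unit_index[OF commuting_da_shift] da_shift_monomial ac_simps)

lemma da_shift_power_bops [simp]: "op_monomial da_shift \<alpha> \<in> bops"
  by (rule op_monomial_bops[OF commuting_da_shift]) simp

lemma da_eval_shift_power:
  "z \<in> ball 0 1 \<Longrightarrow> da_eval (op_monomial da_shift \<alpha> f) z = multi_power z \<alpha> * da_eval f z"
  by (induction \<alpha> rule: multi_index_induct)
     (simp_all add: op_monomial_add_unit_index[OF commuting_da_shift] da_eval_shift multi_power_add)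

definition index_le :: "('d \<Rightarrow>\<^sub>0 nat) \<Rightarrow> ('d \<Rightarrow>\<^sub>0 nat) \<Rightarrow> bool" where
  "index_le \<alpha> \<beta> \<longleftrightarrow> (\<forall>k. Poly_Mapping.lookup \<alpha> k \<le> Poly_Mapping.lookup \<beta> k)"

lemma index_le_iff: "index_le \<alpha> \<beta> \<longleftrightarrow> (\<exists>\<gamma>. \<beta> = \<alpha> + \<gamma>)"
proof
  assume "index_le \<alpha> \<beta>"
  then have "\<beta> = \<alpha> + (\<beta> - \<alpha>)"
    using index_diff_add[of \<alpha> \<beta>] by (simp add: index_le_def add.commute)
  then show "\<exists>\<gamma>. \<beta> = \<alpha> + \<gamma>" ..
qed (auto simp: index_le_def lookup_add)

lemma finite_index_le: "finite {\<beta>. index_le \<beta> (\<gamma> :: 'd::finite \<Rightarrow>\<^sub>0 nat)}"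
proof (rule finite_subset)
  show "{\<beta>. index_le \<beta> \<gamma>} \<subseteq> index_box (index_degree \<gamma> + 1)"
    using order_trans[OF _ lookup_le_degree] by (auto simp: index_box_def index_le_def less_Suc_eq_le)
qed simp

lemma da_coeff_shift_power:
  "da_coeff (op_monomial da_shift \<alpha> f) \<beta> = (if index_le \<alpha> \<beta> then da_coeff f (\<beta> - \<alpha>) else 0)"
proof (rule da_linear_ext[where F = "\<lambda>f. da_coeff (op_monomial da_shift \<alpha> f) \<beta>"])
  show "bounded_linear (\<lambda>f. da_coeff (op_monomial da_shift \<alpha> f) \<beta>)"
    by (rule bounded_linear_compose[OF bounded_linear_da_coeff blinfun.bounded_linear_right])
  show "bounded_linear (\<lambda>f. if index_le \<alpha> \<beta> then da_coeff f (\<beta> - \<alpha>) else 0)"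
    by (cases "index_le \<alpha> \<beta>") (simp_all add: bounded_linear_da_coeff)
  show "da_coeff (op_monomial da_shift \<alpha> (c *\<^sub>C da_monomial \<gamma>)) \<beta>
      = (if index_le \<alpha> \<beta> then da_coeff (c *\<^sub>C da_monomial \<gamma>) (\<beta> - \<alpha>) else 0)" for c \<gamma>
    by (auto simp: bopsD da_shift_power_monomial da_coeff_simps da_coeff_monomial index_le_iff)
qed

lemma multiplies_byD:
  "multiplies_by \<phi> M \<Longrightarrow> z \<in> ball 0 1 \<Longrightarrow> da_eval (blinfun_apply M f) z = \<phi> z * da_eval f z"
  by (simp add: multiplies_by_def)

lemma da_eval_eqI:
  assumes "\<And>z. z \<in> ball 0 1 \<Longrightarrow> da_eval f z = da_eval g z"
  shows "f = g"
proof -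
  have "da_eval (f - g) z = 0" if "z \<in> ball 0 1" for z
    using linear_diff[OF bounded_linear.linear[OF bounded_linear_da_eval[OF that]]] assms[OF that] by simp
  then show ?thesis
    using da_eval_inject[of "f - g"] by simp
qed

lemma mult_op_eqI:
  assumes "M \<in> bops" "multiplies_by \<phi> M"
  shows "mult_op \<phi> = M"
  unfolding mult_op_def
proof (rule the_equality)
  fix N assume "N \<in> bops \<and> multiplies_by \<phi> N"
  then show "N = M"
    using assms by (intro blinfun_eqI da_eval_eqI) (simp add: multiplies_byD)
qed (use assms in simp)

text \<open>Both sides have the values \<open>\<phi> z * z $ k * da_eval f z\<close>. Through this
  commutation a multiplier is determined by its action on the constant function 1.\<close>

lemma multiplier_commutes_shift:
  assumes "M \<in> multiplier_algebra"
  shows "blinfun_apply M (da_shift k f) = da_shift k (M f)"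
proof (rule da_eval_eqI)
  obtain \<phi> where "multiplies_by \<phi> M"
    using assms by (auto simp: multiplier_algebra_def)
  then show "da_eval (M (da_shift k f)) z = da_eval (da_shift k (M f)) z" if "z \<in> ball 0 1" for z
    using that by (simp add: multiplies_byD da_eval_shift)
qed

lemma multiplier_commutes_shift_power:
  assumes "M \<in> multiplier_algebra"
  shows "blinfun_apply M (op_monomial da_shift \<alpha> f) = op_monomial da_shift \<alpha> (M f)"
  by (induction \<alpha> rule: multi_index_induct)
     (simp_all add: op_monomial_add_unit_index[OF commuting_da_shift] multiplier_commutes_shift[OF assms])

lemma multiplier_bops: "M \<in> multiplier_algebra \<Longrightarrow> M \<in> bops"
  by (simp add: multiplier_algebra_def)

text \<open>The Taylor coefficients of the symbol, obtained without choosing one: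
  \<open>da_monomial 0\<close> is the constant function 1.\<close>

definition mult_coeff :: "('d::finite drury_arveson \<Rightarrow>\<^sub>L 'd drury_arveson) \<Rightarrow> ('d \<Rightarrow>\<^sub>0 nat) \<Rightarrow> complex" where
  "mult_coeff M \<alpha> = da_coeff (M (da_monomial 0)) \<alpha>"

lemma multiplier_monomial:
  assumes "M \<in> multiplier_algebra"
  shows "da_coeff (M (da_monomial \<alpha>)) \<beta> = (if index_le \<alpha> \<beta> then mult_coeff M (\<beta> - \<alpha>) else 0)"
  using multiplier_commutes_shift_power[OF assms, of \<alpha> "da_monomial 0"]
  by (simp add: da_shift_power_monomial da_coeff_shift_power mult_coeff_def)

lemma mult_coeff_add: "mult_coeff (A + B) \<alpha> = mult_coeff A \<alpha> + mult_coeff B \<alpha>"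
  by (simp add: mult_coeff_def blinfun.add_left da_coeff_simps)

lemma mult_coeff_scaleC: "mult_coeff (c *\<^sub>C A) \<alpha> = c * mult_coeff A \<alpha>"
  by (simp add: mult_coeff_def scaleC_blinfun.rep_eq da_coeff_simps)

text \<open>The Cauchy product of two power series. The sum is finite, so coefficientwise
  convergence of multipliers passes to each coefficient of their values.\<close>

lemma multiplier_coeff:
  assumes A: "A \<in> multiplier_algebra"
  shows "da_coeff (A f) \<gamma> = (\<Sum>\<beta> | index_le \<beta> \<gamma>. mult_coeff A (\<gamma> - \<beta>) * da_coeff f \<beta>)"
proof (rule da_linear_ext[where F = "\<lambda>f. da_coeff (A f) \<gamma>"])
  show "bounded_linear (\<lambda>f. da_coeff (A f) \<gamma>)"
    by (rule bounded_linear_compose[OF bounded_linear_da_coeff blinfun.bounded_linear_right])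
  show "bounded_linear (\<lambda>f. \<Sum>\<beta> | index_le \<beta> \<gamma>. mult_coeff A (\<gamma> - \<beta>) * da_coeff f \<beta>)"
    by (intro bounded_linear_sum bounded_linear_const_mult bounded_linear_da_coeff)
  show "da_coeff (A (c *\<^sub>C da_monomial \<alpha>)) \<gamma>
      = (\<Sum>\<beta> | index_le \<beta> \<gamma>. mult_coeff A (\<gamma> - \<beta>) * da_coeff (c *\<^sub>C da_monomial \<alpha>) \<beta>)" for c \<alpha>
    by (simp add: bopsD[OF multiplier_bops[OF A]] da_coeff_simps multiplier_monomial[OF A]
        da_coeff_monomial finite_index_le if_distrib[of "\<lambda>x. _ * x"] cong: if_cong)
qed

lemma mult_coeff_compose:
  "A \<in> multiplier_algebra
    \<Longrightarrow> mult_coeff (A o\<^sub>L B) \<gamma> = (\<Sum>\<beta> | index_le \<beta> \<gamma>. mult_coeff A (\<gamma> - \<beta>) * mult_coeff B \<beta>)"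
  using multiplier_coeff[of A "B (da_monomial 0)" \<gamma>]
  by (simp add: mult_coeff_def[of "A o\<^sub>L B"] mult_coeff_def[of B])

lemma id_multiplier: "id_blinfun \<in> multiplier_algebra"
  by (auto simp: multiplier_algebra_def multiplies_by_def intro!: exI[of _ "\<lambda>_. 1"])

lemma add_multiplier:
  assumes "A \<in> multiplier_algebra" "B \<in> multiplier_algebra"
  shows "A + B \<in> multiplier_algebra"
proof -
  obtain \<phi> \<psi> where "multiplies_by \<phi> A" "multiplies_by \<psi> B"
    using assms by (auto simp: multiplier_algebra_def)
  then have "multiplies_by (\<lambda>z. \<phi> z + \<psi> z) (A + B)"
    unfolding multiplies_by_def
    by (simp add: blinfun.add_left da_eval_cinner cinner.add_left distrib_right)
  then show ?thesis
    using assms by (auto simp: multiplier_algebra_def add_bops)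
qed

lemma scaleC_multiplier:
  assumes "A \<in> multiplier_algebra"
  shows "c *\<^sub>C A \<in> multiplier_algebra"
proof -
  obtain \<phi> where "multiplies_by \<phi> A"
    using assms by (auto simp: multiplier_algebra_def)
  then have "multiplies_by (\<lambda>z. c * \<phi> z) (c *\<^sub>C A)"
    unfolding multiplies_by_def
    by (simp add: scaleC_blinfun.rep_eq da_eval_cinner cinner.scaleC_left)
  then show ?thesis
    using assms by (auto simp: multiplier_algebra_def scaleC_bops)
qed

lemma compose_multiplier:
  assumes "A \<in> multiplier_algebra" "B \<in> multiplier_algebra"
  shows "A o\<^sub>L B \<in> multiplier_algebra"
proof -
  obtain \<phi> \<psi> where "multiplies_by \<phi> A" "multiplies_by \<psi> B"
    using assms by (auto simp: multiplier_algebra_def)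
  then have "multiplies_by (\<lambda>z. \<phi> z * \<psi> z) (A o\<^sub>L B)"
    by (simp add: multiplies_by_def)
  then show ?thesis
    using assms by (auto simp: multiplier_algebra_def compose_bops)
qed

lemma shift_multiplies_by: "multiplies_by (\<lambda>z. z $ k) (da_shift k)"
  by (simp add: multiplies_by_def da_eval_shift)

lemma mult_op_coordinate: "mult_op (\<lambda>z. z $ k) = da_shift k"
  by (rule mult_op_eqI) (simp_all add: shift_multiplies_by)

lemma shift_multiplier: "da_shift k \<in> multiplier_algebra"
  using shift_multiplies_by by (auto simp: multiplier_algebra_def)

lemma shift_power_multiplier: "op_monomial da_shift \<alpha> \<in> multiplier_algebra"
  by (induction \<alpha> rule: multi_index_induct)
     (simp_all add: op_monomial_add_unit_index[OF commuting_da_shift] id_multiplier compose_multiplier shift_multiplier)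

lemma zero_multiplier: "0 \<in> multiplier_algebra"
proof -
  have "0 *\<^sub>C id_blinfun = (0 :: 'a drury_arveson \<Rightarrow>\<^sub>L 'a drury_arveson)"
    by (simp add: blinfun_ext_iff scaleC_blinfun.rep_eq)
  then show ?thesis
    using scaleC_multiplier[OF id_multiplier, of 0] by metis
qed

lemma sum_multiplier:
  "(\<And>i. i \<in> I \<Longrightarrow> A i \<in> multiplier_algebra) \<Longrightarrow> (\<Sum>i\<in>I. A i) \<in> multiplier_algebra"
  by (induction I rule: infinite_finite_induct) (simp_all add: zero_multiplier add_multiplier)

section \<open>Polynomials as multipliers\<close>

definition poly_op ::
  "('d::finite, 'h::complex_inner) op_tuple \<Rightarrow> 'd cpoly \<Rightarrow> ('h \<Rightarrow>\<^sub>L 'h)" where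
  "poly_op T p = (\<Sum>\<alpha>\<in>Poly_Mapping.keys p. Poly_Mapping.lookup p \<alpha> *\<^sub>C op_monomial T \<alpha>)"

lemma poly_op_multiplier: "poly_op da_shift p \<in> multiplier_algebra"
  unfolding poly_op_def by (intro sum_multiplier scaleC_multiplier shift_power_multiplier)

lemma mult_op_poly: "mult_op (cpoly_eval p) = poly_op da_shift p"
proof (rule mult_op_eqI)
  show "poly_op da_shift p \<in> bops"
    by (rule multiplier_bops[OF poly_op_multiplier])
  show "multiplies_by (cpoly_eval p) (poly_op da_shift p)"
    unfolding multiplies_by_def
  proof (intro allI ballI)
    fix f and z :: "complex ^ 'a" assume z: "z \<in> ball 0 1"
    have "da_eval (poly_op da_shift p f) z
        = (\<Sum>\<alpha>\<in>Poly_Mapping.keys p. Poly_Mapping.lookup p \<alpha> * da_eval (op_monomial da_shift \<alpha> f) z)"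
      by (simp add: poly_op_def da_eval_cinner[OF z] blinfun_scaleC_sum_apply cinner.sum_left cinner.scaleC_left)
    also have "\<dots> = cpoly_eval p z * da_eval f z"
      by (simp add: da_eval_shift_power[OF z] cpoly_eval_def sum_distrib_right mult.assoc)
    finally show "da_eval (poly_op da_shift p f) z = cpoly_eval p z * da_eval f z" .
  qed
qed

lemma mult_coeff_sum:
  "finite F \<Longrightarrow> mult_coeff (\<Sum>\<alpha>\<in>F. f \<alpha> *\<^sub>C op_monomial da_shift \<alpha>) \<gamma> = (if \<gamma> \<in> F then f \<gamma> else 0)"
  by (simp add: mult_coeff_def blinfun_scaleC_sum_apply da_shift_power_monomial da_coeff_sum
      da_coeff_simps da_coeff_monomial if_distrib[of "\<lambda>x. _ * x"] cong: if_cong)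

section \<open>Fejer means of multipliers\<close>

lemma finite_index_degree_less: "finite {\<alpha> :: 'd::finite \<Rightarrow>\<^sub>0 nat. index_degree \<alpha> < n}"
  by (rule finite_subset[OF _ finite_index_box[of n]])
     (auto simp: index_box_def intro: le_less_trans[OF lookup_le_degree])

text \<open>The weights depend on the total degree only: these are the Cesaro means of the expansion
  of the symbol into homogeneous parts.\<close>

definition fejer_mean ::
  "nat \<Rightarrow> ('d::finite drury_arveson \<Rightarrow>\<^sub>L 'd drury_arveson) \<Rightarrow> ('d drury_arveson \<Rightarrow>\<^sub>L 'd drury_arveson)" where
  "fejer_mean n M = (\<Sum>\<alpha> | index_degree \<alpha> < n.
     (complex_of_real (1 - index_degree \<alpha> / n) * mult_coeff M \<alpha>) *\<^sub>C op_monomial da_shift \<alpha>)"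

lemma fejer_mean_multiplier: "fejer_mean n M \<in> multiplier_algebra"
  unfolding fejer_mean_def by (intro sum_multiplier scaleC_multiplier shift_power_multiplier)

text \<open>With the denominator cleared, truncated subtraction expresses the cut-off at degree n,
  and the coefficient becomes a number of windows, to be counted in
  \<open>fejer_mean_window\<close>.\<close>

lemma mult_coeff_fejer_mean:
  assumes "n > 0"
  shows "of_nat n * mult_coeff (fejer_mean n M) \<alpha> = of_nat (n - index_degree \<alpha>) * mult_coeff M \<alpha>"
  using assms by (auto simp: fejer_mean_def mult_coeff_sum finite_index_degree_less of_nat_diff field_simps)

lemma cinner_multiplier_restrict:
  assumes M: "M \<in> multiplier_algebra" and F: "finite F" "finite G"
  shows "cinner (M (da_restrict F f)) (da_restrict G g)
    = (\<Sum>\<alpha>\<in>F. \<Sum>\<beta>\<in>G. da_coeff f \<alpha> * cnj (da_coeff g \<beta>) * da_weight \<beta>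
        * (if index_le \<alpha> \<beta> then mult_coeff M (\<beta> - \<alpha>) else 0))"
proof -
  have "cinner (M (da_restrict F f)) (da_restrict G g)
      = (\<Sum>\<alpha>\<in>F. \<Sum>\<beta>\<in>G. da_coeff f \<alpha> * (cnj (da_coeff g \<beta>) * cinner (M (da_monomial \<alpha>)) (da_monomial \<beta>)))"
    unfolding da_restrict_finite[OF F(1)] da_restrict_finite[OF F(2)] bops_scaleC_sum[OF multiplier_bops[OF M]]
    by (simp only: cinner.sum_left cinner.scaleC_left)
       (simp add: cinner.sum_right cinner.scaleC_right sum_distrib_left)
  then show ?thesis
    by (simp add: cinner_da_monomial multiplier_monomial[OF M] mult_ac cong: if_cong)
qed

lemma norm_da_restrict_finite:
  assumes "finite F"
  shows "(norm (da_restrict F f))\<^sup>2 = (\<Sum>\<alpha>\<in>F. da_weight \<alpha> * (cmod (da_coeff f \<alpha>))\<^sup>2)"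
proof -
  have "(norm (da_restrict F f))\<^sup>2 = (\<Sum>\<^sub>\<infinity>\<alpha>\<in>F. da_weight \<alpha> * (cmod (da_coeff f \<alpha>))\<^sup>2)"
    unfolding da_norm_sq by (rule infsum_cong_neutral) (auto simp: da_coeff_restrict)
  then show ?thesis
    using assms by simp
qed

text \<open>A band of up to n consecutive degrees ending at m, written additively because the band
  may start below degree 0. Every index belongs to the windows of exactly n values of m.\<close>

definition degree_window :: "nat \<Rightarrow> nat \<Rightarrow> ('d::finite \<Rightarrow>\<^sub>0 nat) set" where
  "degree_window n m = {\<alpha>. index_degree \<alpha> \<le> m \<and> m < index_degree \<alpha> + n}"

lemma sum_norm_window_le:
  assumes F: "finite F"
  shows "(\<Sum>m<N. (norm (da_restrict (F \<inter> degree_window n m) f))\<^sup>2) \<le> n * (norm f)\<^sup>2"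
proof -
  let ?s = "\<lambda>\<alpha>. da_weight \<alpha> * (cmod (da_coeff f \<alpha>))\<^sup>2"
  have "(\<Sum>m<N. (norm (da_restrict (F \<inter> degree_window n m) f))\<^sup>2)
      = (\<Sum>m<N. \<Sum>\<alpha>\<in>F. if \<alpha> \<in> degree_window n m then ?s \<alpha> else 0)"
    using F by (intro sum.cong refl) (simp add: norm_da_restrict_finite sum.inter_restrict)
  also have "\<dots> = (\<Sum>\<alpha>\<in>F. \<Sum>m<N. if \<alpha> \<in> degree_window n m then ?s \<alpha> else 0)"
    by (rule sum.swap)
  also have "\<dots> \<le> (\<Sum>\<alpha>\<in>F. real n * ?s \<alpha>)"
  proof (rule sum_mono)
    fix \<alpha> assume "\<alpha> \<in> F"
    have "(\<Sum>m<N. if \<alpha> \<in> degree_window n m then ?s \<alpha> else 0)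
        = real (card {m. m < N \<and> \<alpha> \<in> degree_window n m}) * ?s \<alpha>"
      by (simp flip: sum.inter_filter)
    also have "\<dots> \<le> real n * ?s \<alpha>"
    proof (rule mult_right_mono)
      have "card {m. m < N \<and> \<alpha> \<in> degree_window n m} \<le> card {index_degree \<alpha>..<index_degree \<alpha> + n}"
        by (rule card_mono) (auto simp: degree_window_def)
      then show "real (card {m. m < N \<and> \<alpha> \<in> degree_window n m}) \<le> real n"
        by simp
    qed (simp add: da_weight_nonneg)
    finally show "(\<Sum>m<N. if \<alpha> \<in> degree_window n m then ?s \<alpha> else 0) \<le> real n * ?s \<alpha>" .
  qed
  also have "\<dots> \<le> real n * (norm f)\<^sup>2"
    unfolding sum_distrib_left[symmetric] by (intro mult_left_mono da_finite_sum_le F) simp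
  finally show ?thesis .
qed

text \<open>The triangular weights \<open>(n - k)\<^sub>+\<close> count the windows of length \<open>n\<close> containing two given
  degrees at distance \<open>k\<close>, so the Fejer mean is an average of compressions of \<open>M\<close>.\<close>

lemma fejer_mean_window:
  assumes M: "M \<in> multiplier_algebra" and F: "finite F" and n: "n > 0"
    and N: "\<And>\<alpha>. \<alpha> \<in> F \<Longrightarrow> index_degree \<alpha> + n \<le> N"
  shows "of_nat n * cinner (fejer_mean n M (da_restrict F f)) (da_restrict F g)
    = (\<Sum>m<N. cinner (M (da_restrict (F \<inter> degree_window n m) f)) (da_restrict (F \<inter> degree_window n m) g))"
proof -
  let ?t = "\<lambda>\<alpha> \<beta>. da_coeff f \<alpha> * cnj (da_coeff g \<beta>) * da_weight \<beta>
        * (if index_le \<alpha> \<beta> then mult_coeff M (\<beta> - \<alpha>) else 0)"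
  let ?w = "\<lambda>m \<alpha> \<beta>. \<alpha> \<in> degree_window n m \<and> \<beta> \<in> degree_window n m"
  have "(\<Sum>m<N. cinner (M (da_restrict (F \<inter> degree_window n m) f)) (da_restrict (F \<inter> degree_window n m) g))
      = (\<Sum>m<N. \<Sum>\<alpha>\<in>F. \<Sum>\<beta>\<in>F. if ?w m \<alpha> \<beta> then ?t \<alpha> \<beta> else 0)"
    using F by (intro sum.cong refl)
      (auto simp: cinner_multiplier_restrict[OF M] sum.inter_restrict intro!: sum.cong)
  also have "\<dots> = (\<Sum>\<alpha>\<in>F. \<Sum>m<N. \<Sum>\<beta>\<in>F. if ?w m \<alpha> \<beta> then ?t \<alpha> \<beta> else 0)"
    by (rule sum.swap)
  also have "\<dots> = (\<Sum>\<alpha>\<in>F. \<Sum>\<beta>\<in>F. \<Sum>m<N. if ?w m \<alpha> \<beta> then ?t \<alpha> \<beta> else 0)"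
    by (intro sum.cong refl sum.swap)
  also have "\<dots> = (\<Sum>\<alpha>\<in>F. \<Sum>\<beta>\<in>F. of_nat (card {m. m < N \<and> ?w m \<alpha> \<beta>}) * ?t \<alpha> \<beta>)"
    by (simp flip: sum.inter_filter)
  also have "\<dots> = (\<Sum>\<alpha>\<in>F. \<Sum>\<beta>\<in>F. of_nat n * (da_coeff f \<alpha> * cnj (da_coeff g \<beta>) * da_weight \<beta>
        * (if index_le \<alpha> \<beta> then mult_coeff (fejer_mean n M) (\<beta> - \<alpha>) else 0)))"
  proof (intro sum.cong refl)
    fix \<alpha> \<beta> assume \<alpha>: "\<alpha> \<in> F" and \<beta>: "\<beta> \<in> F"
    show "of_nat (card {m. m < N \<and> ?w m \<alpha> \<beta>}) * ?t \<alpha> \<beta>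
        = of_nat n * (da_coeff f \<alpha> * cnj (da_coeff g \<beta>) * da_weight \<beta>
          * (if index_le \<alpha> \<beta> then mult_coeff (fejer_mean n M) (\<beta> - \<alpha>) else 0))"
    proof (cases "index_le \<alpha> \<beta>")
      case True
      then obtain \<gamma> where \<gamma>: "\<beta> = \<alpha> + \<gamma>"
        by (auto simp: index_le_iff)
      \<comment> \<open>The index of larger degree, \<beta>, bounds m from below and the one of
        smaller degree, \<alpha>, from above; the choice of N keeps all these m below N.\<close>
      have "{m. m < N \<and> ?w m \<alpha> \<beta>} = {index_degree \<alpha> + index_degree \<gamma>..<index_degree \<alpha> + n}"
        using N[OF \<alpha>] by (auto simp: degree_window_def \<gamma> index_degree_add)
      then have "card {m. m < N \<and> ?w m \<alpha> \<beta>} = n - index_degree \<gamma>"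
        by simp
      then show ?thesis
        using True mult_coeff_fejer_mean[OF n, of M \<gamma>] by (simp add: \<gamma>)
    qed simp
  qed
  also have "\<dots> = of_nat n * cinner (fejer_mean n M (da_restrict F f)) (da_restrict F g)"
    by (simp add: cinner_multiplier_restrict[OF fejer_mean_multiplier F F] sum_distrib_left)
  finally show ?thesis ..
qed

text \<open>Cauchy-Schwarz over the windows: each index lies in at most n of them, so either vector
  contributes a factor \<open>sqrt n\<close>, and together these cancel the n in front. The bound
  does not depend on n. It is shown for finite restrictions and extended by continuity.\<close>

lemma fejer_mean_bound:
  assumes M: "M \<in> multiplier_algebra" and n: "n > 0"
  shows "cmod (cinner (fejer_mean n M f) g) \<le> norm M * norm f * norm g"
proof -
  have fin: "cmod (cinner (fejer_mean n M (da_restrict F f)) (da_restrict F g)) \<le> norm M * norm f * norm g"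
    if F: "finite F" for F
  proof -
    have "\<exists>N. \<forall>\<alpha>\<in>F. index_degree \<alpha> + n \<le> N"
      using F by (intro exI[of _ "\<Sum>\<alpha>\<in>F. index_degree \<alpha> + n"] ballI member_le_sum) auto
    then obtain N where N: "\<And>\<alpha>. \<alpha> \<in> F \<Longrightarrow> index_degree \<alpha> + n \<le> N"
      by blast
    let ?r = "\<lambda>f m. da_restrict (F \<inter> degree_window n m) f"
    have "real n * cmod (cinner (fejer_mean n M (da_restrict F f)) (da_restrict F g))
        = cmod (of_nat n * cinner (fejer_mean n M (da_restrict F f)) (da_restrict F g))"
      by (simp add: norm_mult)
    also have "\<dots> = cmod (\<Sum>m<N. cinner (M (?r f m)) (?r g m))"
      by (simp only: fejer_mean_window[OF M F n N])
    also have "\<dots> \<le> (\<Sum>m<N. norm M * (\<bar>norm (?r f m)\<bar> * \<bar>norm (?r g m)\<bar>))"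
    proof (rule order_trans[OF norm_sum sum_mono])
      fix m
      have "cmod (cinner (M (?r f m)) (?r g m)) \<le> norm (M (?r f m)) * norm (?r g m)"
        by (rule cinner_bound)
      also have "\<dots> \<le> norm M * norm (?r f m) * norm (?r g m)"
        by (intro mult_right_mono norm_blinfun) simp
      finally show "cmod (cinner (M (?r f m)) (?r g m)) \<le> norm M * (\<bar>norm (?r f m)\<bar> * \<bar>norm (?r g m)\<bar>)"
        by (simp add: mult.assoc)
    qed
    also have "\<dots> \<le> norm M * (L2_set (\<lambda>m. norm (?r f m)) {..<N} * L2_set (\<lambda>m. norm (?r g m)) {..<N})"
      unfolding sum_distrib_left[symmetric] by (intro mult_left_mono L2_set_mult_ineq) simp
    also have "\<dots> \<le> norm M * (sqrt (n * (norm f)\<^sup>2) * sqrt (n * (norm g)\<^sup>2))"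
      unfolding L2_set_def
      by (intro mult_left_mono mult_mono real_sqrt_le_mono sum_norm_window_le F) (auto intro: sum_nonneg)
    also have "\<dots> = real n * (norm M * norm f * norm g)"
      by (simp add: real_sqrt_mult)
    finally show ?thesis
      using n by simp
  qed
  have r: "(\<lambda>k. da_restrict (index_box k) h) \<longlonglongrightarrow> h" for h :: "'a drury_arveson"
    by (rule da_restrict_tendsto) (rule eventually_in_index_box)
  have "(\<lambda>k. cmod (cinner (fejer_mean n M (da_restrict (index_box k) f)) (da_restrict (index_box k) g)))
      \<longlonglongrightarrow> cmod (cinner (fejer_mean n M f) g)"
    by (intro tendsto_norm cinner_bilinear.tendsto blinfun.tendsto tendsto_const r)
  then show ?thesis
    by (rule LIMSEQ_le_const2) (use fin in auto)
qed

lemma mult_coeff_fejer_mean_tendsto: "(\<lambda>n. mult_coeff (fejer_mean n M) \<alpha>) \<longlonglongrightarrow> mult_coeff M \<alpha>"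
proof (rule Lim_transform_eventually)
  have "(\<lambda>n. complex_of_real (1 - real (index_degree \<alpha>) / real n) * mult_coeff M \<alpha>)
      \<longlonglongrightarrow> complex_of_real (1 - 0) * mult_coeff M \<alpha>"
    by (intro tendsto_intros lim_const_over_n)
  then show "(\<lambda>n. complex_of_real (1 - real (index_degree \<alpha>) / real n) * mult_coeff M \<alpha>) \<longlonglongrightarrow> mult_coeff M \<alpha>"
    by simp
  show "\<forall>\<^sub>F n in sequentially. complex_of_real (1 - real (index_degree \<alpha>) / real n) * mult_coeff M \<alpha>
      = mult_coeff (fejer_mean n M) \<alpha>"
    using eventually_gt_at_top[of "index_degree \<alpha>"]
    by eventually_elim (simp add: fejer_mean_def mult_coeff_sum finite_index_degree_less)
qed

text \<open>Against a monomial the inner product is a finite expression in the coefficients, which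
  converge. The uniform bound extends this from finite combinations of monomials to all g.\<close>

lemma fejer_mean_tendsto:
  assumes M: "M \<in> multiplier_algebra"
  shows "(\<lambda>n. cinner (fejer_mean n M f) g) \<longlonglongrightarrow> cinner (M f) g"
proof -
  let ?D = "\<lambda>n. cinner (fejer_mean n M f - M f)"
  have mono: "(\<lambda>n. ?D n (da_monomial \<gamma>)) \<longlonglongrightarrow> 0" for \<gamma>
  proof -
    have "(\<lambda>n. cinner (fejer_mean n M f) (da_monomial \<gamma>)) \<longlonglongrightarrow> cinner (M f) (da_monomial \<gamma>)"
      unfolding cinner_da_monomial multiplier_coeff[OF M] multiplier_coeff[OF fejer_mean_multiplier]
      by (intro tendsto_intros mult_coeff_fejer_mean_tendsto)
    then show ?thesis
      unfolding cinner.diff_left by (rule LIM_zero)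
  qed
  have bound: "cmod (?D n h) \<le> 2 * norm M * norm f * norm h" if "n > 0" for n h
  proof -
    have "cmod (cinner (M f) h) \<le> norm (M f) * norm h"
      by (rule cinner_bound)
    also have "\<dots> \<le> norm M * norm f * norm h"
      by (intro mult_right_mono norm_blinfun) simp
    finally show ?thesis
      using norm_triangle_ineq4[of "cinner (fejer_mean n M f) h" "cinner (M f) h"]
        fejer_mean_bound[OF M that, of f h]
      by (simp add: cinner.diff_left)
  qed
  have "(\<lambda>n. ?D n g) \<longlonglongrightarrow> 0"
  proof (rule LIMSEQ_I)
    fix e :: real assume e: "e > 0"
    \<comment> \<open>The summand 1 keeps K positive when \<open>M\<close> or \<open>f\<close> is
      0.\<close>
    define K where "K = 2 * norm M * norm f + 1"
    have K: "K > 0"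
      by (simp add: K_def add_nonneg_pos)
    obtain m where m: "norm ((\<Sum>\<alpha>\<in>index_box m. da_coeff g \<alpha> *\<^sub>C da_monomial \<alpha>) - g) < e / (2 * K)"
      using LIMSEQ_D[OF da_monomials_dense[of g], of "e / (2 * K)"] e K by auto
    define h where "h = (\<Sum>\<alpha>\<in>index_box m. da_coeff g \<alpha> *\<^sub>C da_monomial \<alpha>)"
    have h: "norm (g - h) < e / (2 * K)"
      using m by (simp add: h_def norm_minus_commute)
    have "(\<lambda>n. ?D n h) \<longlonglongrightarrow> (\<Sum>\<alpha>\<in>index_box m. cnj (da_coeff g \<alpha>) * 0)"
      unfolding h_def cinner.sum_right cinner.scaleC_right
      by (intro tendsto_sum tendsto_mult tendsto_const mono)
    then have "(\<lambda>n. ?D n h) \<longlonglongrightarrow> 0"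
      by simp
    from LIMSEQ_D[OF this, of "e / 2"] obtain n0 where n0: "\<And>n. n \<ge> n0 \<Longrightarrow> cmod (?D n h) < e / 2"
      using e by auto
    have "cmod (?D n g) < e" if "n \<ge> max n0 1" for n
    proof -
      have "cmod (?D n (g - h)) \<le> 2 * norm M * norm f * norm (g - h)"
        using that by (intro bound) simp
      also have "\<dots> \<le> K * norm (g - h)"
        by (intro mult_right_mono) (simp_all add: K_def)
      also have "\<dots> \<le> K * (e / (2 * K))"
        using h K by (intro mult_left_mono) auto
      also have "\<dots> = e / 2"
        using K by simp
      finally have "cmod (?D n (g - h)) \<le> e / 2" .
      moreover have "?D n g = ?D n (g - h) + ?D n h"
        by (simp flip: cinner.add_right)
      ultimately show ?thesis
        using norm_triangle_ineq[of "?D n (g - h)" "?D n h"] n0[of n] that by simp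
    qed
    then show "\<exists>no. \<forall>n\<ge>no. cmod (?D n g - 0) < e"
      by (intro exI[of _ "max n0 1"]) simp
  qed
  then show ?thesis
    unfolding cinner.diff_left by (rule LIM_zero_cancel)
qed

section \<open>The weak-* topology\<close>

lemma bound_sq_sum: "2 * (a * b) \<le> a\<^sup>2 + (b :: real)\<^sup>2"
  using sum_squares_bound[of a b] by simp

text \<open>Dominated convergence for series, in the form of Tannery's theorem; the uniform bound on
  Fejer means supplies the dominating series.\<close>

lemma normal_functional_fejer_mean:
  assumes M: "M \<in> multiplier_algebra"
    and x: "summable (\<lambda>i. (norm (x i))\<^sup>2)" and y: "summable (\<lambda>i. (norm (y i))\<^sup>2)"
  shows "(\<lambda>n. normal_functional x y (fejer_mean n M)) \<longlonglongrightarrow> normal_functional x y M"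
proof -
  let ?m = "\<lambda>i. norm M * ((norm (x i))\<^sup>2 + (norm (y i))\<^sup>2)"
  \<comment> \<open>\<open>fejer_mean_bound\<close> is about positive indices, hence the sequence is
    shifted to \<open>Suc n\<close>.\<close>
  have bound: "cmod (cinner (fejer_mean (Suc n) M (x i)) (y i)) \<le> ?m i" for n i
  proof -
    have "cmod (cinner (fejer_mean (Suc n) M (x i)) (y i)) \<le> norm M * (norm (x i) * norm (y i))"
      using fejer_mean_bound[OF M, of "Suc n" "x i" "y i"] by (simp add: mult.assoc)
    also have "\<dots> \<le> ?m i"
    proof (rule mult_left_mono)
      have "0 \<le> norm (x i) * norm (y i)"
        by simp
      then show "norm (x i) * norm (y i) \<le> (norm (x i))\<^sup>2 + (norm (y i))\<^sup>2"
        using bound_sq_sum[of "norm (x i)" "norm (y i)"] by linarith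
    qed simp
    finally show ?thesis .
  qed
  have "(\<lambda>n. normal_functional x y (fejer_mean (Suc n) M)) \<longlonglongrightarrow> normal_functional x y M"
    unfolding normal_functional_def
  proof (rule conjunct2[OF conjunct2[OF tannerys_theorem]])
    show "(\<lambda>n. cinner (fejer_mean (Suc n) M (x i)) (y i)) \<longlonglongrightarrow> cinner (M (x i)) (y i)" for i
      by (rule LIMSEQ_Suc[OF fejer_mean_tendsto[OF M]])
    show "\<forall>\<^sub>F (k, n) in at_top \<times>\<^sub>F sequentially. cmod (cinner (fejer_mean (Suc n) M (x k)) (y k)) \<le> ?m k"
      by (rule always_eventually) (auto intro: bound)
    show "summable ?m"
      by (intro summable_mult summable_add x y)
  qed simp
  then show ?thesis
    by (rule LIMSEQ_imp_Suc)
qed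

lemma topspace_weak_star [simp]: "topspace weak_star = bops"
proof
  have "bops = {A \<in> bops. normal_functional (\<lambda>_. 0) (\<lambda>_. 0) A \<in> UNIV}"
    by simp
  moreover have "{A \<in> bops. normal_functional (\<lambda>_. 0) (\<lambda>_. 0 :: 'a) A \<in> UNIV} \<subseteq> topspace weak_star"
    unfolding weak_star_def topology_generated_by_topspace
    by (rule Union_upper, simp only: mem_Collect_eq, intro exI conjI, rule refl) simp_all
  ultimately show "bops \<subseteq> topspace (weak_star :: ('a \<Rightarrow>\<^sub>L 'a) topology)"
    by metis
qed (auto simp: weak_star_def topology_generated_by_topspace)

lemma continuous_map_normal_functional:
  assumes "summable (\<lambda>i. (norm (x i))\<^sup>2)" "summable (\<lambda>i. (norm (y i))\<^sup>2)"
  shows "continuous_map weak_star euclidean (normal_functional x y)"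
  unfolding continuous_map_def
proof (intro conjI allI impI)
  fix U :: "complex set" assume "openin euclidean U"
  then show "openin weak_star {A \<in> topspace weak_star. normal_functional x y A \<in> U}"
    unfolding topspace_weak_star unfolding weak_star_def
    by (intro topology_generated_by_Basis) (use assms in auto)
qed simp

lemma normal_functional_single:
  fixes A :: "'a::complex_inner \<Rightarrow>\<^sub>L 'a"
  shows "normal_functional (\<lambda>i. if i = 0 then x else 0) (\<lambda>i. if i = 0 then y else 0) A = cinner (A x) y"
proof -
  have "(\<lambda>i::nat. cinner (A (if i = 0 then x else 0)) (if i = 0 then y else 0))
      = (\<lambda>i. if i = 0 then cinner (A x) y else 0)"
    by auto
  then show ?thesis
    using sums_single[of 0 "\<lambda>_. cinner (A x) y"] unfolding normal_functional_def
    by (simp add: sums_iff)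
qed

lemma continuous_map_cinner: "continuous_map weak_star euclidean (\<lambda>A. cinner (blinfun_apply A x) y)"
proof -
  have "summable (\<lambda>i::nat. (norm (if i = 0 then v else 0 :: 'a))\<^sup>2)" for v
    by (rule summable_finite[of "{0}"]) auto
  from continuous_map_normal_functional[OF this this, of x y] show ?thesis
    by (simp only: ext[OF normal_functional_single])
qed

lemma continuous_map_weak_starI:
  fixes f :: "'c \<Rightarrow> ('b::complex_inner \<Rightarrow>\<^sub>L 'b)"
  assumes "f ` topspace X \<subseteq> bops"
    and "\<And>x y. summable (\<lambda>i. (norm (x i))\<^sup>2) \<Longrightarrow> summable (\<lambda>i. (norm (y i))\<^sup>2)
      \<Longrightarrow> continuous_map X euclidean (\<lambda>a. normal_functional x y (f a))"
  shows "continuous_map X weak_star f"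
  unfolding weak_star_def
proof (rule continuous_on_generated_topo)
  fix V assume "V \<in> {{A :: 'b \<Rightarrow>\<^sub>L 'b. A \<in> bops \<and> normal_functional x y A \<in> U} |x y U.
      summable (\<lambda>n. (norm (x n))\<^sup>2) \<and> summable (\<lambda>n. (norm (y n))\<^sup>2) \<and> open U}"
  then obtain x y U where V: "V = {A \<in> bops. normal_functional x y A \<in> U}" and "open U"
      and xy: "summable (\<lambda>n. (norm (x n))\<^sup>2)" "summable (\<lambda>n. (norm (y n))\<^sup>2)"
    by blast
  then have "openin X {a \<in> topspace X. normal_functional x y (f a) \<in> U}"
    using openin_continuous_map_preimage[OF assms(2)[OF xy], of U] by simp
  moreover have "f -` V \<inter> topspace X = {a \<in> topspace X. normal_functional x y (f a) \<in> U}"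
    using assms(1) by (auto simp: V)
  ultimately show "openin X (f -` V \<inter> topspace X)"
    by simp
next
  show "f ` topspace X \<subseteq> \<Union> {{A :: 'b \<Rightarrow>\<^sub>L 'b. A \<in> bops \<and> normal_functional x y A \<in> U} |x y U.
      summable (\<lambda>n. (norm (x n))\<^sup>2) \<and> summable (\<lambda>n. (norm (y n))\<^sup>2) \<and> open U}"
    using assms(1) topspace_weak_star[where 'a = 'b] unfolding weak_star_def topology_generated_by_topspace by metis
qed

text \<open>Induction over the generation of an open set reduces a neighbourhood of the limit to a
  subbasic one, which is described by a single normal functional.\<close>

lemma limitin_weak_starI:
  assumes M: "M \<in> bops" and X: "\<And>n. X n \<in> bops"
    and lim: "\<And>x y. summable (\<lambda>i. (norm (x i))\<^sup>2) \<Longrightarrow> summable (\<lambda>i. (norm (y i))\<^sup>2)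
      \<Longrightarrow> (\<lambda>n. normal_functional x y (X n)) \<longlonglongrightarrow> normal_functional x y M"
  shows "limitin weak_star X M sequentially"
  unfolding limitin_def
proof (intro conjI allI impI)
  fix V assume V: "openin weak_star V \<and> M \<in> V"
  then have "generate_topology_on {{A \<in> bops. normal_functional x y A \<in> U} |x y U.
      summable (\<lambda>n. (norm (x n))\<^sup>2) \<and> summable (\<lambda>n. (norm (y n))\<^sup>2) \<and> open U} V"
    unfolding weak_star_def openin_topology_generated_by_iff by blast
  then have "M \<in> V \<longrightarrow> (\<forall>\<^sub>F n in sequentially. X n \<in> V)"
  proof induction
    case (Int a b)
    then show ?case
      by (auto intro: eventually_conj)
  next
    case (UN K)
    show ?case
    proof
      assume "M \<in> \<Union>K"
      then obtain k where "k \<in> K" "M \<in> k"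
        by blast
      then have "\<forall>\<^sub>F n in sequentially. X n \<in> k"
        using UN.IH by blast
      then show "\<forall>\<^sub>F n in sequentially. X n \<in> \<Union>K"
        by (rule eventually_mono) (use \<open>k \<in> K\<close> in blast)
    qed
  next
    case (Basis s)
    then obtain x y U where s: "s = {A \<in> bops. normal_functional x y A \<in> U}" and U: "open U"
      and xy: "summable (\<lambda>n. (norm (x n))\<^sup>2)" "summable (\<lambda>n. (norm (y n))\<^sup>2)"
      by blast
    show ?case
    proof
      assume "M \<in> s"
      then have "\<forall>\<^sub>F n in sequentially. normal_functional x y (X n) \<in> U"
        by (intro topological_tendstoD[OF lim[OF xy] U]) (simp add: s)
      then show "\<forall>\<^sub>F n in sequentially. X n \<in> s"
        by (simp add: s X)
    qed
  qed simp
  then show "\<forall>\<^sub>F n in sequentially. X n \<in> V"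
    using V by blast
qed (use M in simp)

section \<open>The functional calculus of a nilpotent row contraction\<close>

lemma matrix_norm_bound:
  fixes A :: "nat \<Rightarrow> nat \<Rightarrow> ('a::complex_inner \<Rightarrow>\<^sub>L 'a)"
  shows "L2_set (\<lambda>i. norm (\<Sum>j<n. A i j (\<xi> j))) {..<n} \<le> matrix_norm n A * L2_set (\<lambda>j. norm (\<xi> j)) {..<n}"
proof (cases "L2_set (\<lambda>j. norm (\<xi> j)) {..<n} = 0")
  case True
  then have "\<xi> j = 0" if "j < n" for j
    using member_le_L2_set[of "{..<n}" j "\<lambda>j. norm (\<xi> j)"] that by simp
  then show ?thesis
    by (simp add: blinfun.zero_right L2_set_def)
next
  case False
  define r where "r = L2_set (\<lambda>j. norm (\<xi> j)) {..<n}"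
  have r: "r > 0"
    using False by (simp add: r_def less_le)
  let ?N = "\<lambda>\<xi>. L2_set (\<lambda>i. norm (\<Sum>j<n. A i j (\<xi> j))) {..<n}"
  let ?B = "{\<xi>. L2_set (\<lambda>j. norm (\<xi> j)) {..<n} \<le> 1}"
  \<comment> \<open>A crude bound, needed only so that the supremum in \<open>matrix_norm\<close> is
    over a set bounded above.\<close>
  have "?N \<xi> \<le> (\<Sum>i<n. \<Sum>j<n. norm (A i j))" if \<xi>: "\<xi> \<in> ?B" for \<xi>
  proof -
    have "?N \<xi> \<le> (\<Sum>i<n. norm (\<Sum>j<n. A i j (\<xi> j)))"
      by (rule L2_set_le_sum) simp
    also have "\<dots> \<le> (\<Sum>i<n. \<Sum>j<n. norm (A i j))"
    proof (intro sum_mono order_trans[OF norm_sum])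
      fix i j assume "j \<in> {..<n}"
      then have "norm (\<xi> j) \<le> 1"
        using member_le_L2_set[of "{..<n}" j "\<lambda>j. norm (\<xi> j)"] \<xi> by simp
      then show "norm (A i j (\<xi> j)) \<le> norm (A i j)"
        using order_trans[OF norm_blinfun mult_left_mono[of "norm (\<xi> j)" 1 "norm (A i j)"]] by simp
    qed
    finally show ?thesis .
  qed
  then have bdd: "bdd_above (?N ` ?B)"
    by (intro bdd_aboveI2)
  let ?\<eta> = "\<lambda>j. (1 / r) *\<^sub>R \<xi> j"
  have scale: "L2_set (\<lambda>i. norm ((1 / r) *\<^sub>R f i)) {..<n} = 1 / r * L2_set (\<lambda>i. norm (f i)) {..<n}"
    for f :: "nat \<Rightarrow> 'a"
    using r L2_set_right_distrib[of "1 / r" "\<lambda>i. norm (f i)" "{..<n}"] by simp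
  have "?\<eta> \<in> ?B"
    using r by (simp only: mem_Collect_eq scale r_def[symmetric]) simp
  then have "?N ?\<eta> \<le> matrix_norm n A"
    unfolding matrix_norm_def by (rule cSUP_upper[OF _ bdd])
  moreover have "?N ?\<eta> = 1 / r * ?N \<xi>"
    by (simp only: blinfun.scaleR_right scaleR_sum_right[symmetric] scale)
  ultimately show ?thesis
    using r unfolding r_def[symmetric] by (simp add: field_simps)
qed

lemma matrix_norm_leI:
  fixes A :: "nat \<Rightarrow> nat \<Rightarrow> ('a::complex_inner \<Rightarrow>\<^sub>L 'a)"
  assumes "\<And>\<xi>. L2_set (\<lambda>j. norm (\<xi> j)) {..<n} \<le> 1
    \<Longrightarrow> L2_set (\<lambda>i. norm (\<Sum>j<n. A i j (\<xi> j))) {..<n} \<le> C"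
  shows "matrix_norm n A \<le> C"
  unfolding matrix_norm_def
proof (rule cSUP_least)
  have "(\<lambda>_. 0) \<in> {\<xi> :: nat \<Rightarrow> 'a. L2_set (\<lambda>j. norm (\<xi> j)) {..<n} \<le> 1}"
    by (simp add: L2_set_def)
  then show "{\<xi> :: nat \<Rightarrow> 'a. L2_set (\<lambda>j. norm (\<xi> j)) {..<n} \<le> 1} \<noteq> {}"
    by (rule ex_in_conv[THEN iffD1, OF exI])
qed (use assms in simp)

lemma matrix_norm_nonneg: "0 \<le> matrix_norm n (A :: nat \<Rightarrow> nat \<Rightarrow> ('a::complex_inner \<Rightarrow>\<^sub>L 'a))"
  if "n > 0" "(x :: 'a) \<noteq> 0"
proof -
  have "0 < norm x"
    using that by simp
  also have "norm x \<le> L2_set (\<lambda>j::nat. norm x) {..<n}"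
    using that by (intro member_le_L2_set[of "{..<n}" 0]) auto
  finally have "0 < L2_set (\<lambda>j::nat. norm x) {..<n}" .
  moreover have "0 \<le> matrix_norm n A * L2_set (\<lambda>j::nat. norm x) {..<n}"
    by (rule order_trans[OF L2_set_nonneg matrix_norm_bound])
  ultimately show ?thesis
    by (simp add: zero_le_mult_iff)
qed

text \<open>The index set depends on T alone and not on a choice of nilpotency orders, so T and its
  ampliation sum over the same indices.\<close>

definition da_calculus ::
  "('d::finite, 'h::chilbert_space) op_tuple \<Rightarrow> ('d drury_arveson \<Rightarrow>\<^sub>L 'd drury_arveson) \<Rightarrow> ('h \<Rightarrow>\<^sub>L 'h)" where
  "da_calculus T M = (\<Sum>\<alpha> | op_monomial T \<alpha> \<noteq> 0. mult_coeff M \<alpha> *\<^sub>C op_monomial T \<alpha>)"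

lemma continuous_map_mult_const:
  fixes f :: "'a \<Rightarrow> complex"
  shows "continuous_map X euclidean f \<Longrightarrow> continuous_map X euclidean (\<lambda>x. f x * c)"
  by (simp add: continuous_map_atin tendsto_mult)

lemma continuous_map_mult_coeff: "continuous_map weak_star euclidean (\<lambda>M. mult_coeff M \<alpha>)"
  unfolding mult_coeff_def da_coeff_cinner divide_inverse
  by (rule continuous_map_mult_const[OF continuous_map_cinner])

locale nilpotent_row_contraction =
  fixes T :: "('d::finite, 'h::chilbert_space) op_tuple"
  assumes bops: "T k \<in> bops"
    and commuting: "commuting_tuple T"
    and contraction: "row_contraction T"
    and nilpotent: "nilpotent_tuple T"
begin

text \<open>Positivity puts the index 0 into the box, as Pascal's rule and the value at the identity
  require.\<close>

definition nil_bound :: nat where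
  "nil_bound = (SOME N. 0 < N \<and> (\<forall>\<alpha>. \<alpha> \<notin> index_box N \<longrightarrow> op_monomial T \<alpha> = 0))"

lemma nil_bound: "0 < nil_bound" and monomial_eq_0: "\<alpha> \<notin> index_box nil_bound \<Longrightarrow> op_monomial T \<alpha> = 0"
proof -
  obtain m where m: "\<And>\<alpha>. \<alpha> \<notin> index_box m \<Longrightarrow> op_monomial T \<alpha> = 0"
    using nilpotent_op_monomial_eq_0[OF commuting nilpotent] by metis
  then have "0 < Suc m \<and> (\<forall>\<alpha>. \<alpha> \<notin> index_box (Suc m) \<longrightarrow> op_monomial T \<alpha> = 0)"
    using index_box_mono[of m "Suc m"] by auto
  then have "0 < nil_bound \<and> (\<forall>\<alpha>. \<alpha> \<notin> index_box nil_bound \<longrightarrow> op_monomial T \<alpha> = 0)"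
    unfolding nil_bound_def by (rule someI)
  then show "0 < nil_bound" "\<alpha> \<notin> index_box nil_bound \<Longrightarrow> op_monomial T \<alpha> = 0"
    by auto
qed

abbreviation box where "box \<equiv> index_box nil_bound :: ('d \<Rightarrow>\<^sub>0 nat) set"

lemma calculus_box: "da_calculus T M = (\<Sum>\<alpha>\<in>box. mult_coeff M \<alpha> *\<^sub>C op_monomial T \<alpha>)"
  unfolding da_calculus_def
  by (rule sum.mono_neutral_left)
     (use monomial_eq_0 in \<open>auto simp: blinfun_ext_iff scaleC_blinfun.rep_eq\<close>)

lemma calculus_apply: "da_calculus T M x = (\<Sum>\<alpha>\<in>box. mult_coeff M \<alpha> *\<^sub>C op_monomial T \<alpha> x)"
  by (simp add: calculus_box blinfun_scaleC_sum_apply)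

section \<open>The defect form and the Poisson kernel\<close>

abbreviation adj_monomial :: "('d \<Rightarrow>\<^sub>0 nat) \<Rightarrow> 'h \<Rightarrow> 'h" where
  "adj_monomial \<alpha> \<equiv> blinfun_apply (op_monomial (\<lambda>k. adj (T k)) \<alpha>)"

lemma cinner_monomial: "cinner (op_monomial T \<alpha> x) y = cinner x (adj_monomial \<alpha> y)"
  by (rule op_monomial_adj[OF commuting bops])

lemma adj_monomial_eq_0: "\<alpha> \<notin> box \<Longrightarrow> adj_monomial \<alpha> x = 0"
  by (rule cinner_extR) (simp add: cinner_monomial[symmetric] monomial_eq_0)

lemma adj_monomial_add: "adj_monomial (\<alpha> + \<beta>) x = adj_monomial \<alpha> (adj_monomial \<beta> x)"
  by (simp add: op_monomial_add[OF commuting_adj[OF commuting bops]])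

lemma adj_monomial_add_unit_index: "adj_monomial (\<alpha> + unit_index k) x = adj (T k) (adj_monomial \<alpha> x)"
  by (simp add: op_monomial_add_unit_index[OF commuting_adj[OF commuting bops]])

definition defect :: "'h \<Rightarrow> 'h \<Rightarrow> complex" where
  "defect x y = cinner x y - (\<Sum>k\<in>UNIV. cinner (adj (T k) x) (adj (T k) y))"

lemma psd_form_defect: "psd_form defect"
proof
  fix x y z and c
  show "defect (x + y) z = defect x z + defect y z"
    by (simp add: defect_def blinfun.add_right cinner.add_left sum.distrib)
  show "defect (c *\<^sub>C x) y = c * defect x y"
    by (simp add: defect_def bopsD[OF adj_bops[OF bops]] cinner.scaleC_left right_diff_distrib sum_distrib_left)
  show "defect x y = cnj (defect y x)"
    unfolding defect_def complex_cnj_diff cnj_sum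
    by (intro arg_cong2[where f = "(-)"] sum.cong refl cinner.hermitian)
  have "cinner ((id_blinfun - (\<Sum>k\<in>UNIV. T k o\<^sub>L adj (T k))) x) x = defect x x"
    by (simp add: defect_def blinfun.diff_left blinfun.sum_left cinner.diff_left cinner.sum_left adj_cinner[OF bops])
  then show "0 \<le> Re (defect x x)"
    using contraction unfolding row_contraction_def op_le_def by metis
qed

sublocale defect: psd_form defect
  by (rule psd_form_defect)

text \<open>This is \<open>K\<^sup>* K = 1\<close> for the Poisson kernel \<open>K\<close>; the sum telescopes by Pascal's rule.\<close>

lemma poisson_isometry:
  "(\<Sum>\<alpha>\<in>box. defect (adj_monomial \<alpha> x) (adj_monomial \<alpha> y) / da_weight \<alpha>) = cinner x y"
proof -
  let ?g = "\<lambda>\<alpha>. cinner (adj_monomial \<alpha> x) (adj_monomial \<alpha> y)"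
  have "(\<Sum>\<alpha>\<in>box. (1 / da_weight \<alpha>) *\<^sub>R ?g \<alpha>)
      = ?g 0 + (\<Sum>k\<in>UNIV. \<Sum>\<alpha> | \<alpha> \<in> box \<and> \<alpha> + unit_index k \<in> box. (1 / da_weight \<alpha>) *\<^sub>R ?g (\<alpha> + unit_index k))"
    by (rule sum_index_box_Pascal[OF nil_bound])
  \<comment> \<open>An index pushed out of the box has a vanishing adjoint monomial, so the inner
    sums may run over the whole box.\<close>
  also have "\<dots> = ?g 0 + (\<Sum>k\<in>UNIV. \<Sum>\<alpha>\<in>box. (1 / da_weight \<alpha>) *\<^sub>R ?g (\<alpha> + unit_index k))"
    by (intro arg_cong2[where f = "(+)"] refl sum.cong sum.mono_neutral_left)
       (auto simp: adj_monomial_eq_0)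
  also have "(\<Sum>k\<in>UNIV. \<Sum>\<alpha>\<in>box. (1 / da_weight \<alpha>) *\<^sub>R ?g (\<alpha> + unit_index k))
      = (\<Sum>\<alpha>\<in>box. (1 / da_weight \<alpha>) *\<^sub>R (\<Sum>k\<in>UNIV. ?g (\<alpha> + unit_index k)))"
    by (subst sum.swap) (simp add: scaleR_sum_right)
  finally have "(\<Sum>\<alpha>\<in>box. (1 / da_weight \<alpha>) *\<^sub>R (?g \<alpha> - (\<Sum>k\<in>UNIV. ?g (\<alpha> + unit_index k)))) = ?g 0"
    by (simp add: scaleR_diff_right sum_subtractf)
  then show ?thesis
    by (simp add: defect_def adj_monomial_add_unit_index scaleR_conv_of_real)
qed

text \<open>The substitution \<open>\<beta> = \<alpha> + \<gamma>\<close>. An index below a member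
  of the box is in the box, and the vanishing of \<open>h\<close> accounts for those \<gamma> that
  are carried out of it.\<close>

lemma sum_index_le_shift:
  assumes "\<And>\<beta>. \<beta> \<notin> box \<Longrightarrow> h \<beta> = 0"
  shows "(\<Sum>\<beta>\<in>box. if index_le \<alpha> \<beta> then c (\<beta> - \<alpha>) * h \<beta> else 0) = (\<Sum>\<gamma>\<in>box. c \<gamma> * h (\<alpha> + \<gamma>) :: complex)"
proof -
  have "(\<Sum>\<beta>\<in>box. if index_le \<alpha> \<beta> then c (\<beta> - \<alpha>) * h \<beta> else 0)
      = (\<Sum>\<beta> | \<beta> \<in> box \<and> index_le \<alpha> \<beta>. c (\<beta> - \<alpha>) * h \<beta>)"
    by (simp add: sum.inter_filter)
  also have "\<dots> = (\<Sum>\<gamma> | \<gamma> \<in> box \<and> \<alpha> + \<gamma> \<in> box. c \<gamma> * h (\<alpha> + \<gamma>))"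
  proof (rule sum.reindex_bij_witness[of _ "\<lambda>\<gamma>. \<alpha> + \<gamma>" "\<lambda>\<beta>. \<beta> - \<alpha>"])
    fix \<beta> assume "\<beta> \<in> {\<beta>. \<beta> \<in> box \<and> index_le \<alpha> \<beta>}"
    then obtain \<gamma> where "\<beta> = \<alpha> + \<gamma>" "\<alpha> + \<gamma> \<in> box"
      by (auto simp: index_le_iff)
    moreover from this have "\<gamma> \<in> box"
      unfolding index_box_def by (auto simp: lookup_add dest: spec intro: le_less_trans[OF le_add2])
    ultimately show "\<alpha> + (\<beta> - \<alpha>) = \<beta>" "\<beta> - \<alpha> \<in> {\<gamma>. \<gamma> \<in> box \<and> \<alpha> + \<gamma> \<in> box}"
      "c (\<beta> - \<alpha>) * h (\<alpha> + (\<beta> - \<alpha>)) = c (\<beta> - \<alpha>) * h \<beta>"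
      by auto
  qed (auto simp: index_le_iff)
  also have "\<dots> = (\<Sum>\<gamma>\<in>box. c \<gamma> * h (\<alpha> + \<gamma>))"
    by (rule sum.mono_neutral_left) (auto simp: assms)
  finally show ?thesis .
qed

text \<open>The components of the Poisson kernel, where \<open>l p\<close> are the coordinates of a factorisation of
  the defect form.\<close>

definition poisson :: "('h \<Rightarrow> complex) \<Rightarrow> 'h \<Rightarrow> 'd drury_arveson" where
  "poisson l x = (\<Sum>\<alpha>\<in>box. (l (adj_monomial \<alpha> x) / da_weight \<alpha>) *\<^sub>C da_monomial \<alpha>)"

lemma cinner_multiplier_poisson:
  assumes M: "M \<in> multiplier_algebra"
  shows "cinner (M (poisson l x)) (poisson l y)
    = (\<Sum>\<alpha>\<in>box. \<Sum>\<beta>\<in>box. l (adj_monomial \<alpha> x) * cnj (l (adj_monomial \<beta> y)) / da_weight \<alpha>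
        * (if index_le \<alpha> \<beta> then mult_coeff M (\<beta> - \<alpha>) else 0))"
proof -
  have "cinner (M (poisson l x)) (poisson l y)
      = (\<Sum>\<alpha>\<in>box. \<Sum>\<beta>\<in>box. (l (adj_monomial \<alpha> x) / da_weight \<alpha>)
          * (cnj (l (adj_monomial \<beta> y)) / da_weight \<beta> * cinner (M (da_monomial \<alpha>)) (da_monomial \<beta>)))"
    unfolding poisson_def bops_scaleC_sum[OF multiplier_bops[OF M]]
    by (simp only: cinner.sum_left cinner.scaleC_left)
       (simp add: cinner.sum_right cinner.scaleC_right sum_distrib_left)
  also have "\<dots> = (\<Sum>\<alpha>\<in>box. \<Sum>\<beta>\<in>box. l (adj_monomial \<alpha> x) * cnj (l (adj_monomial \<beta> y)) / da_weight \<alpha>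
        * (if index_le \<alpha> \<beta> then mult_coeff M (\<beta> - \<alpha>) else 0))"
  proof (intro sum.cong refl)
    fix \<alpha> \<beta> :: "'d \<Rightarrow>\<^sub>0 nat"
    have "da_weight \<beta> \<noteq> 0"
      using da_weight_pos[of \<beta>] by simp
    then show "(l (adj_monomial \<alpha> x) / da_weight \<alpha>)
          * (cnj (l (adj_monomial \<beta> y)) / da_weight \<beta> * cinner (M (da_monomial \<alpha>)) (da_monomial \<beta>))
        = l (adj_monomial \<alpha> x) * cnj (l (adj_monomial \<beta> y)) / da_weight \<alpha>
        * (if index_le \<alpha> \<beta> then mult_coeff M (\<beta> - \<alpha>) else 0)"
      by (simp add: cinner_da_monomial multiplier_monomial[OF M])
  qed
  finally show ?thesis .
qed

text \<open>Summed over p, the coordinates recombine to the defect form. After substituting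
  \<open>\<beta> = \<alpha> + \<gamma>\<close>, the adjoint monomial splits, and
  \<open>poisson_isometry\<close> for x and \<open>adj_monomial \<gamma> y\<close> leaves
  \<open>cinner x (adj_monomial \<gamma> y)\<close>. The factorisation enters only at adjoint
  monomials of x and y, so one on a finite set suffices.\<close>

lemma poisson_dilation:
  assumes M: "M \<in> multiplier_algebra"
    and l: "\<And>\<alpha> \<beta>. \<alpha> \<in> box \<Longrightarrow> \<beta> \<in> box \<Longrightarrow> defect (adj_monomial \<alpha> x) (adj_monomial \<beta> y)
      = (\<Sum>p\<in>P. l p (adj_monomial \<alpha> x) * cnj (l p (adj_monomial \<beta> y)))"
  shows "(\<Sum>p\<in>P. cinner (M (poisson (l p) x)) (poisson (l p) y)) = cinner (da_calculus T M x) y"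
proof -
  let ?d = "\<lambda>\<alpha> \<beta>. defect (adj_monomial \<alpha> x) (adj_monomial \<beta> y)"
  let ?c = "\<lambda>\<alpha> \<beta>. if index_le \<alpha> \<beta> then mult_coeff M (\<beta> - \<alpha>) else 0"
  have "(\<Sum>p\<in>P. cinner (M (poisson (l p) x)) (poisson (l p) y))
      = (\<Sum>\<alpha>\<in>box. \<Sum>\<beta>\<in>box. \<Sum>p\<in>P. l p (adj_monomial \<alpha> x) * cnj (l p (adj_monomial \<beta> y)) / da_weight \<alpha> * ?c \<alpha> \<beta>)"
    unfolding cinner_multiplier_poisson[OF M]
    by (subst sum.swap) (intro sum.cong refl sum.swap)
  also have "\<dots> = (\<Sum>\<alpha>\<in>box. (\<Sum>\<beta>\<in>box. if index_le \<alpha> \<beta> then mult_coeff M (\<beta> - \<alpha>) * ?d \<alpha> \<beta> else 0) / da_weight \<alpha>)"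
    by (simp add: l sum_distrib_right sum_divide_distrib mult.commute[of "mult_coeff _ _"] if_distrib[of "\<lambda>x. x / _"]
        cong: if_cong)
       (auto intro!: sum.cong)
  also have "\<dots> = (\<Sum>\<alpha>\<in>box. (\<Sum>\<gamma>\<in>box. mult_coeff M \<gamma> * ?d \<alpha> (\<alpha> + \<gamma>)) / da_weight \<alpha>)"
    by (subst sum_index_le_shift) (simp_all add: adj_monomial_eq_0)
  also have "\<dots> = (\<Sum>\<gamma>\<in>box. mult_coeff M \<gamma>
      * (\<Sum>\<alpha>\<in>box. defect (adj_monomial \<alpha> x) (adj_monomial \<alpha> (adj_monomial \<gamma> y)) / da_weight \<alpha>))"
    unfolding sum_divide_distrib sum_distrib_left adj_monomial_add
    by (subst sum.swap) simp
  also have "\<dots> = cinner (da_calculus T M x) y"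
    by (simp add: poisson_isometry calculus_apply cinner.sum_left cinner.scaleC_left cinner_monomial)
  finally show ?thesis .
qed

section \<open>Existence of the calculus\<close>

lemma calculus_id: "da_calculus T id_blinfun = id_blinfun"
proof (rule blinfun_eqI)
  fix x
  have "(0 :: 'd \<Rightarrow>\<^sub>0 nat) \<in> box"
    using nil_bound by (simp add: index_box_def)
  then show "da_calculus T id_blinfun x = id_blinfun x"
    by (simp add: calculus_apply mult_coeff_def da_coeff_monomial if_distrib[of "\<lambda>c. c *\<^sub>C _"] cong: if_cong)
qed

text \<open>Pairing the output \<open>u\<close> with itself gives a sum of terms to which
  \<open>poisson_dilation\<close> applies. Cauchy-Schwarz over i, the norm of A in every copy p, and
  Cauchy-Schwarz over p yield \<open>U\<^sup>2 \<le> C * U\<close>, because the Poisson kernel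
  preserves norms.\<close>

lemma calculus_completely_contractive:
  assumes A: "\<And>i j. i < n \<Longrightarrow> j < n \<Longrightarrow> A i j \<in> multiplier_algebra"
  shows "matrix_norm n (\<lambda>i j. da_calculus T (A i j)) \<le> matrix_norm n A"
proof (rule matrix_norm_leI)
  fix v :: "nat \<Rightarrow> 'h"
  assume v: "L2_set (\<lambda>j. norm (v j)) {..<n} \<le> 1"
  define u where "u i = (\<Sum>j<n. da_calculus T (A i j) (v j))" for i
  \<comment> \<open>The outputs \<open>u i\<close> are included because the dilation formula is used
    for pairs of \<open>v j\<close> and \<open>u i\<close>.\<close>
  define X where "X = v ` {..<n} \<union> u ` {..<n}"
  define V where "V = (\<lambda>(\<alpha>, x). adj_monomial \<alpha> x) ` (box \<times> X)"
  have "finite V"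
    by (simp add: V_def X_def)
  from psd_form_gram[OF this psd_form_defect] obtain l
    where l: "\<And>x y. x \<in> V \<Longrightarrow> y \<in> V \<Longrightarrow> defect x y = (\<Sum>p\<in>V. l p x * cnj (l p y))"
    by blast
  have dil: "(\<Sum>p\<in>V. cinner (M (poisson (l p) x)) (poisson (l p) y)) = cinner (da_calculus T M x) y"
    if "M \<in> multiplier_algebra" "x \<in> X" "y \<in> X" for M x y
    using that by (intro poisson_dilation l) (auto simp: V_def)
  have norm_X: "(\<Sum>p\<in>V. (norm (poisson (l p) x))\<^sup>2) = (norm x)\<^sup>2" if "x \<in> X" for x
  proof -
    have "complex_of_real (\<Sum>p\<in>V. (norm (poisson (l p) x))\<^sup>2) = complex_of_real ((norm x)\<^sup>2)"
      using dil[OF id_multiplier that that] by (simp add: calculus_id cinner_self)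
    then show ?thesis
      by (simp only: of_real_eq_iff)
  qed
  have L2_X: "L2_set (\<lambda>p. L2_set (\<lambda>i. norm (poisson (l p) (x i))) {..<n}) V = L2_set (\<lambda>i. norm (x i)) {..<n}"
    if "\<And>i. i < n \<Longrightarrow> x i \<in> X" for x
  proof -
    have "(\<Sum>p\<in>V. \<Sum>i<n. (norm (poisson (l p) (x i)))\<^sup>2) = (\<Sum>i<n. (norm (x i))\<^sup>2)"
      by (subst sum.swap) (intro sum.cong norm_X that, auto)
    then show ?thesis
      by (simp add: L2_set_def sum_nonneg)
  qed
  define U where "U = L2_set (\<lambda>i. norm (u i)) {..<n}"
  define C where "C = matrix_norm n A"
  have "complex_of_real (U\<^sup>2) = (\<Sum>i<n. cinner (u i) (u i))"
    by (simp add: U_def L2_set_def sum_nonneg cinner_self)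
  also have "\<dots> = (\<Sum>i<n. \<Sum>j<n. cinner (da_calculus T (A i j) (v j)) (u i))"
    by (intro sum.cong refl) (subst u_def, rule cinner.sum_left)
  also have "\<dots> = (\<Sum>i<n. \<Sum>j<n. \<Sum>p\<in>V. cinner (A i j (poisson (l p) (v j))) (poisson (l p) (u i)))"
    by (intro sum.cong refl dil[symmetric] A) (auto simp: X_def)
  also have "\<dots> = (\<Sum>p\<in>V. \<Sum>i<n. \<Sum>j<n. cinner (A i j (poisson (l p) (v j))) (poisson (l p) (u i)))"
    by (subst (2) sum.swap, subst sum.swap) simp
  also have "\<dots> = (\<Sum>p\<in>V. \<Sum>i<n. cinner (\<Sum>j<n. A i j (poisson (l p) (v j))) (poisson (l p) (u i)))"
    by (simp add: cinner.sum_left)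
  finally have "U\<^sup>2 = cmod (\<Sum>p\<in>V. \<Sum>i<n. cinner (\<Sum>j<n. A i j (poisson (l p) (v j))) (poisson (l p) (u i)))"
    by (metis norm_of_real abs_of_nonneg zero_le_power2)
  also have "\<dots> \<le> (\<Sum>p\<in>V. \<Sum>i<n. \<bar>norm (\<Sum>j<n. A i j (poisson (l p) (v j)))\<bar> * \<bar>norm (poisson (l p) (u i))\<bar>)"
    by (intro order_trans[OF norm_sum] sum_mono) (simp add: cinner_bound)
  also have "\<dots> \<le> (\<Sum>p\<in>V. L2_set (\<lambda>i. norm (\<Sum>j<n. A i j (poisson (l p) (v j)))) {..<n}
      * L2_set (\<lambda>i. norm (poisson (l p) (u i))) {..<n})"
    by (intro sum_mono L2_set_mult_ineq)
  also have "\<dots> \<le> (\<Sum>p\<in>V. C * (\<bar>L2_set (\<lambda>i. norm (poisson (l p) (v i))) {..<n}\<bar>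
      * \<bar>L2_set (\<lambda>i. norm (poisson (l p) (u i))) {..<n}\<bar>))"
    unfolding C_def mult.assoc[symmetric] abs_of_nonneg[OF L2_set_nonneg]
    by (intro sum_mono mult_right_mono matrix_norm_bound) simp
  finally have U2: "U\<^sup>2 \<le> C * (\<Sum>p\<in>V. \<bar>L2_set (\<lambda>i. norm (poisson (l p) (v i))) {..<n}\<bar>
      * \<bar>L2_set (\<lambda>i. norm (poisson (l p) (u i))) {..<n}\<bar>)"
    by (simp add: sum_distrib_left)
  have "U \<le> C"
  \<comment> \<open>\<open>matrix_norm_nonneg\<close> takes a positive n and a nonzero vector; the
    vector is the constant function \<open>da_monomial 0\<close>.\<close>
  proof (cases "n = 0")
    case True
    then show ?thesis
      by (simp add: U_def C_def matrix_norm_def)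
  next
    case False
    have "da_coeff (da_monomial 0 :: 'd drury_arveson) 0 \<noteq> da_coeff 0 0"
      by (simp add: da_coeff_monomial da_coeff_simps)
    then have "(da_monomial 0 :: 'd drury_arveson) \<noteq> 0"
      by metis
    then have C: "C \<ge> 0"
      unfolding C_def using False by (intro matrix_norm_nonneg) auto
    have "U\<^sup>2 \<le> C * (L2_set (\<lambda>p. L2_set (\<lambda>i. norm (poisson (l p) (v i))) {..<n}) V
        * L2_set (\<lambda>p. L2_set (\<lambda>i. norm (poisson (l p) (u i))) {..<n}) V)"
      by (rule order_trans[OF U2]) (intro mult_left_mono L2_set_mult_ineq C)
    also have "\<dots> = C * (L2_set (\<lambda>j. norm (v j)) {..<n} * U)"
      by (subst (1 2) L2_X) (auto simp: X_def U_def)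
    also have "\<dots> \<le> C * (1 * U)"
      using v by (intro mult_left_mono mult_right_mono C) (auto simp: U_def)
    finally show ?thesis
      using C by (cases "U = 0") (auto simp: power2_eq_square U_def less_le)
  qed
  then show "L2_set (\<lambda>i. norm (\<Sum>j<n. da_calculus T (A i j) (v j))) {..<n} \<le> matrix_norm n A"
    by (simp add: U_def u_def C_def)
qed

text \<open>Truncating the Cauchy product to the box is multiplicative: the divisors of an index in
  the box stay in the box, and products leaving it correspond to vanishing monomials of T.\<close>

lemma calculus_compose:
  assumes A: "A \<in> multiplier_algebra"
  shows "da_calculus T (A o\<^sub>L B) = da_calculus T A o\<^sub>L da_calculus T B"
proof (rule blinfun_eqI, rule cinner_extL)
  fix x y
  let ?h = "\<lambda>\<gamma>. cinner (op_monomial T \<gamma> x) y"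
  have h0: "?h \<gamma> = 0" if "\<gamma> \<notin> box" for \<gamma>
    using monomial_eq_0[OF that] by simp
  have sub: "{\<beta>. index_le \<beta> \<gamma>} \<subseteq> box" if "\<gamma> \<in> box" for \<gamma>
    using that by (auto simp: index_box_def index_le_def intro: le_less_trans)
  have "cinner (da_calculus T (A o\<^sub>L B) x) y
      = (\<Sum>\<gamma>\<in>box. (\<Sum>\<beta> | index_le \<beta> \<gamma>. mult_coeff A (\<gamma> - \<beta>) * mult_coeff B \<beta>) * ?h \<gamma>)"
    by (simp add: calculus_apply mult_coeff_compose[OF A] cinner.sum_left cinner.scaleC_left)
  also have "\<dots> = (\<Sum>\<gamma>\<in>box. \<Sum>\<beta>\<in>box. if index_le \<beta> \<gamma> then mult_coeff A (\<gamma> - \<beta>) * mult_coeff B \<beta> * ?h \<gamma> else 0)"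
  proof (intro sum.cong refl)
    fix \<gamma> assume "\<gamma> \<in> box"
    then have "{\<beta>. index_le \<beta> \<gamma>} = {\<beta> \<in> box. index_le \<beta> \<gamma>}"
      using sub by blast
    then show "(\<Sum>\<beta> | index_le \<beta> \<gamma>. mult_coeff A (\<gamma> - \<beta>) * mult_coeff B \<beta>) * ?h \<gamma>
        = (\<Sum>\<beta>\<in>box. if index_le \<beta> \<gamma> then mult_coeff A (\<gamma> - \<beta>) * mult_coeff B \<beta> * ?h \<gamma> else 0)"
      by (simp add: sum_distrib_right sum.inter_filter if_distrib[of "\<lambda>x. x * _"] cong: if_cong)
  qed
  also have "\<dots> = (\<Sum>\<beta>\<in>box. mult_coeff B \<beta> * (\<Sum>\<gamma>\<in>box. if index_le \<beta> \<gamma> then mult_coeff A (\<gamma> - \<beta>) * ?h \<gamma> else 0))"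
    by (subst sum.swap) (auto simp: sum_distrib_left intro!: sum.cong)
  also have "\<dots> = (\<Sum>\<beta>\<in>box. mult_coeff B \<beta> * (\<Sum>\<gamma>\<in>box. mult_coeff A \<gamma> * ?h (\<beta> + \<gamma>)))"
    by (subst sum_index_le_shift) (simp_all add: h0)
  also have "\<dots> = cinner ((da_calculus T A o\<^sub>L da_calculus T B) x) y"
  proof -
    have "da_calculus T A \<in> bops"
      unfolding da_calculus_def by (intro sum_bops scaleC_bops op_monomial_bops commuting bops)
    then have "(da_calculus T A o\<^sub>L da_calculus T B) x
        = (\<Sum>\<beta>\<in>box. mult_coeff B \<beta> *\<^sub>C (\<Sum>\<gamma>\<in>box. mult_coeff A \<gamma> *\<^sub>C op_monomial T (\<gamma> + \<beta>) x))"
      by (simp add: calculus_apply[of B] bops_scaleC_sum)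
         (simp add: calculus_apply op_monomial_add[OF commuting])
    then show ?thesis
      by (simp add: cinner.sum_left cinner.scaleC_left add.commute)
  qed
  finally show "cinner (da_calculus T (A o\<^sub>L B) x) y = cinner ((da_calculus T A o\<^sub>L da_calculus T B) x) y" .
qed

lemma calculus_bops: "da_calculus T M \<in> bops"
  unfolding da_calculus_def by (intro sum_bops scaleC_bops op_monomial_bops commuting bops)


text \<open>Composed with the calculus, a normal functional is a finite combination of Taylor
  coefficients of M, each of them a weak-* continuous matrix entry. The summability estimate serves
  to exchange the series with the finite sum.\<close>

lemma calculus_weak_star_continuous:
  "continuous_map (subtopology weak_star multiplier_algebra) weak_star (da_calculus T)"
proof (rule continuous_map_weak_starI)
  show "da_calculus T ` topspace (subtopology weak_star multiplier_algebra) \<subseteq> bops"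
    using calculus_bops by auto
  fix x y :: "nat \<Rightarrow> 'h"
  assume x: "summable (\<lambda>i. (norm (x i))\<^sup>2)" and y: "summable (\<lambda>i. (norm (y i))\<^sup>2)"
  have "summable (\<lambda>i. cinner (op_monomial T \<alpha> (x i)) (y i))" for \<alpha>
  proof (rule summable_comparison_test)
    let ?m = "\<lambda>i. norm (op_monomial T \<alpha>) * ((norm (x i))\<^sup>2 + (norm (y i))\<^sup>2)"
    show "summable ?m"
      by (intro summable_mult summable_add x y)
    have "cmod (cinner (op_monomial T \<alpha> (x i)) (y i)) \<le> ?m i" for i
    proof -
      have "cmod (cinner (op_monomial T \<alpha> (x i)) (y i)) \<le> norm (op_monomial T \<alpha>) * norm (x i) * norm (y i)"
        by (intro order_trans[OF cinner_bound] mult_right_mono norm_blinfun) simp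
      also have "\<dots> \<le> ?m i"
        unfolding mult.assoc
      proof (rule mult_left_mono)
        have "0 \<le> norm (x i) * norm (y i)"
          by simp
        then show "norm (x i) * norm (y i) \<le> (norm (x i))\<^sup>2 + (norm (y i))\<^sup>2"
          using bound_sq_sum[of "norm (x i)" "norm (y i)"] by linarith
      qed simp
      finally show ?thesis .
    qed
    then show "\<exists>N. \<forall>n\<ge>N. cmod (cinner (op_monomial T \<alpha> (x n)) (y n)) \<le> ?m n"
      by blast
  qed
  then have "normal_functional x y (da_calculus T M)
      = (\<Sum>\<alpha>\<in>box. mult_coeff M \<alpha> * normal_functional x y (op_monomial T \<alpha>))" for M
    unfolding normal_functional_def calculus_apply cinner.sum_left cinner.scaleC_left
    by (subst suminf_sum) (simp_all add: summable_mult suminf_mult)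
  then show "continuous_map (subtopology weak_star multiplier_algebra) euclidean
      (\<lambda>M. normal_functional x y (da_calculus T M))"
    by (simp only:) (intro continuous_map_from_subtopology continuous_map_sum finite_index_box
        continuous_map_mult_const continuous_map_mult_coeff)
qed

lemma calculus_shift: "da_calculus T (da_shift k) = T k"
proof (rule blinfun_eqI)
  fix x
  have "da_calculus T (da_shift k) x = (\<Sum>\<alpha>\<in>box. if \<alpha> = unit_index k then T k x else 0)"
    unfolding calculus_apply
    by (intro sum.cong refl)
       (simp add: mult_coeff_def da_shift_monomial da_coeff_monomial op_monomial_unit_index[OF commuting])
  also have "\<dots> = T k x"
    using monomial_eq_0[of "unit_index k"] op_monomial_unit_index[OF commuting, of k] by auto
  finally show "da_calculus T (da_shift k) x = T k x" .
qed

lemma is_functional_calculus_da_calculus: "is_functional_calculus T (da_calculus T)"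
  unfolding is_functional_calculus_def mult_op_coordinate
proof (intro conjI ballI allI impI)
  show "da_calculus T (A + B) = da_calculus T A + da_calculus T B" for A B
    by (simp add: da_calculus_def mult_coeff_add blinfun_ext_iff blinfun_scaleC_sum_apply blinfun.add_left
        scaleC_add_left sum.distrib)
  show "da_calculus T (c *\<^sub>C A) = c *\<^sub>C da_calculus T A" for c A
    by (simp add: da_calculus_def mult_coeff_scaleC blinfun_ext_iff blinfun_scaleC_sum_apply
        scaleC_blinfun.rep_eq scaleC_sum_right scaleC_scaleC)
qed (simp_all add: calculus_bops calculus_id calculus_compose calculus_completely_contractive
    calculus_weak_star_continuous calculus_shift)

section \<open>Uniqueness of the calculus\<close>

lemma functional_calculus_monomial:
  assumes "is_functional_calculus T \<Phi>"
  shows "\<Phi> (op_monomial da_shift \<alpha>) = op_monomial T \<alpha>"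
proof (induction \<alpha> rule: multi_index_induct)
  case zero
  then show ?case
    using assms by (simp add: is_functional_calculus_def)
next
  case (add \<alpha> k)
  have "\<Phi> (da_shift k o\<^sub>L op_monomial da_shift \<alpha>) = \<Phi> (da_shift k) o\<^sub>L \<Phi> (op_monomial da_shift \<alpha>)"
    using assms shift_multiplier shift_power_multiplier unfolding is_functional_calculus_def by blast
  moreover have "\<Phi> (da_shift k) = T k"
    using assms unfolding is_functional_calculus_def mult_op_coordinate by blast
  ultimately show ?case
    using add by (simp add: op_monomial_add_unit_index[OF commuting] op_monomial_add_unit_index[OF commuting_da_shift])
qed

lemma functional_calculus_sum:
  assumes \<Phi>: "is_functional_calculus T \<Phi>" and "finite F"
  shows "\<Phi> (\<Sum>\<alpha>\<in>F. f \<alpha> *\<^sub>C op_monomial da_shift \<alpha>) = (\<Sum>\<alpha>\<in>F. f \<alpha> *\<^sub>C op_monomial T \<alpha>)"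
  using \<open>finite F\<close>
proof (induction F rule: finite_induct)
  case empty
  have "(0 :: 'd drury_arveson \<Rightarrow>\<^sub>L 'd drury_arveson) = 0 *\<^sub>C id_blinfun" "(0 :: 'h \<Rightarrow>\<^sub>L 'h) = 0 *\<^sub>C id_blinfun"
    by (simp_all add: blinfun_ext_iff scaleC_blinfun.rep_eq)
  moreover have "\<Phi> (0 *\<^sub>C id_blinfun) = 0 *\<^sub>C \<Phi> id_blinfun" "\<Phi> id_blinfun = id_blinfun"
    using \<Phi> id_multiplier unfolding is_functional_calculus_def by blast+
  ultimately show ?case
    by simp
next
  case (insert \<alpha> F)
  have "\<Phi> (A + B) = \<Phi> A + \<Phi> B" if "A \<in> multiplier_algebra" "B \<in> multiplier_algebra" for A B
    using \<Phi> that unfolding is_functional_calculus_def by blast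
  moreover have "\<Phi> (c *\<^sub>C A) = c *\<^sub>C \<Phi> A" if "A \<in> multiplier_algebra" for A c
    using \<Phi> that unfolding is_functional_calculus_def by blast
  ultimately show ?case
    using insert
    by (simp add: sum_multiplier scaleC_multiplier shift_power_multiplier functional_calculus_monomial[OF \<Phi>])
qed

lemma functional_calculus_unique:
  assumes \<Phi>: "is_functional_calculus T \<Phi>" and \<Psi>: "is_functional_calculus T \<Psi>" and M: "M \<in> multiplier_algebra"
  shows "\<Phi> M = \<Psi> M"
proof (rule blinfun_eqI, rule cinner_extL)
  fix x y
  have lim: "limitin weak_star (\<lambda>n. fejer_mean n M) M sequentially"
    by (intro limitin_weak_starI multiplier_bops M fejer_mean_multiplier normal_functional_fejer_mean)
  \<comment> \<open>Continuity of a calculus is relative to the multiplier algebra, so the limit is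
    taken in the subspace; matrix entries reduce the comparison to unique limits of complex
    sequences.\<close>
  have *: "(\<lambda>n. cinner (\<Theta> (fejer_mean n M) x) y) \<longlonglongrightarrow> cinner (\<Theta> M x) y" if "is_functional_calculus T \<Theta>" for \<Theta>
  proof -
    have "continuous_map (subtopology weak_star multiplier_algebra) weak_star \<Theta>"
      using that unfolding is_functional_calculus_def by blast
    from continuous_map_compose[OF this continuous_map_cinner[of x y]]
    have "continuous_map (subtopology weak_star multiplier_algebra) euclidean (\<lambda>A. cinner (\<Theta> A x) y)"
      by (simp add: o_def)
    moreover have "limitin (subtopology weak_star multiplier_algebra) (\<lambda>n. fejer_mean n M) M sequentially"
      using lim M by (simp add: limitin_subtopology fejer_mean_multiplier)
    ultimately have "limitin euclidean ((\<lambda>A. cinner (\<Theta> A x) y) \<circ> (\<lambda>n. fejer_mean n M)) (cinner (\<Theta> M x) y) sequentially"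
      by (rule continuous_map_limit)
    then show ?thesis
      by (simp add: o_def)
  qed
  have "\<Phi> (fejer_mean n M) = \<Psi> (fejer_mean n M)" for n
    unfolding fejer_mean_def
    by (simp only: functional_calculus_sum[OF \<Phi> finite_index_degree_less]
        functional_calculus_sum[OF \<Psi> finite_index_degree_less])
  then show "cinner (\<Phi> M x) y = cinner (\<Psi> M x) y"
    using LIMSEQ_unique[OF *[OF \<Phi>] ] *[OF \<Psi>] by simp
qed

text \<open>\<open>func_calc\<close> describes the value at M and not the map, so uniqueness on the
  multiplier algebra is what the definite description asks for.\<close>

lemma func_calc_eq: "M \<in> multiplier_algebra \<Longrightarrow> func_calc M T = da_calculus T M"
  unfolding func_calc_def
  by (rule the_equality) (use is_functional_calculus_da_calculus functional_calculus_unique in blast)+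

end

section \<open>Polynomials in a tuple and the quotient algebra\<close>

lemma poly_op_superset:
  assumes "finite F" "Poly_Mapping.keys p \<subseteq> F"
  shows "poly_op T p = (\<Sum>\<alpha>\<in>F. Poly_Mapping.lookup p \<alpha> *\<^sub>C op_monomial T \<alpha>)"
  unfolding poly_op_def
  by (rule sum.mono_neutral_left) (use assms in \<open>auto simp: blinfun_ext_iff scaleC_blinfun.rep_eq in_keys_iff\<close>)

lemma poly_op_add: "poly_op T (p + q) = poly_op T p + poly_op T q"
proof -
  let ?F = "Poly_Mapping.keys p \<union> Poly_Mapping.keys q"
  have "poly_op T r = (\<Sum>\<alpha>\<in>?F. Poly_Mapping.lookup r \<alpha> *\<^sub>C op_monomial T \<alpha>)" if "r \<in> {p, q, p + q}" for r
    using that keys_add[of p q] by (intro poly_op_superset) auto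
  then show ?thesis
    by (simp add: blinfun_ext_iff blinfun_scaleC_sum_apply blinfun.add_left lookup_add scaleC_add_left sum.distrib)
qed

lemma poly_op_zero [simp]: "poly_op T 0 = 0"
  by (simp add: poly_op_def)

lemma poly_op_sum: "poly_op T (\<Sum>i\<in>I. p i) = (\<Sum>i\<in>I. poly_op T (p i))"
  by (induction I rule: infinite_finite_induct) (simp_all add: poly_op_add)

lemma poly_op_uminus: "poly_op T (- p) = - poly_op T p"
  using poly_op_add[of T p "- p"] by (simp add: eq_neg_iff_add_eq_0 add.commute)

lemma poly_op_diff: "poly_op T (p - q) = poly_op T p - poly_op T q"
  using poly_op_add[of T p "- q"] by (simp add: poly_op_uminus)

lemma poly_op_single: "poly_op T (Poly_Mapping.single \<alpha> c) = c *\<^sub>C op_monomial T \<alpha>"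
  by (subst poly_op_superset[of "{\<alpha>}"]) simp_all

lemma cpoly_expand: "p = (\<Sum>\<alpha>\<in>Poly_Mapping.keys p. Poly_Mapping.single \<alpha> (Poly_Mapping.lookup p \<alpha>))"
  for p :: "'d cpoly"
  by (rule poly_mapping_eqI) (auto simp: lookup_sum lookup_single when_def in_keys_iff)

lemma poly_op_mult:
  assumes T: "commuting_tuple T" "\<And>k. T k \<in> bops"
  shows "poly_op T (p * q) = poly_op T p o\<^sub>L poly_op T q"
proof (rule blinfun_eqI)
  fix x
  have "p * q = (\<Sum>\<alpha>\<in>Poly_Mapping.keys p. Poly_Mapping.single \<alpha> (Poly_Mapping.lookup p \<alpha>))
      * (\<Sum>\<beta>\<in>Poly_Mapping.keys q. Poly_Mapping.single \<beta> (Poly_Mapping.lookup q \<beta>))"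
    using cpoly_expand[of p] cpoly_expand[of q] by simp
  also have "\<dots> = (\<Sum>\<alpha>\<in>Poly_Mapping.keys p. \<Sum>\<beta>\<in>Poly_Mapping.keys q.
      Poly_Mapping.single (\<alpha> + \<beta>) (Poly_Mapping.lookup p \<alpha> * Poly_Mapping.lookup q \<beta>))"
    by (simp add: sum_product mult_single)
  finally have "poly_op T (p * q) x = (\<Sum>\<alpha>\<in>Poly_Mapping.keys p. \<Sum>\<beta>\<in>Poly_Mapping.keys q.
      (Poly_Mapping.lookup p \<alpha> * Poly_Mapping.lookup q \<beta>) *\<^sub>C op_monomial T \<alpha> (op_monomial T \<beta> x))"
    by (simp add: poly_op_sum poly_op_single blinfun.sum_left scaleC_blinfun.rep_eq op_monomial_add[OF T(1)])
  also have "\<dots> = (poly_op T p o\<^sub>L poly_op T q) x"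
    by (simp add: poly_op_def blinfun_scaleC_sum_apply bops_scaleC_sum[OF op_monomial_bops[OF T]]
        scaleC_sum_right scaleC_scaleC)
  finally show "poly_op T (p * q) x = (poly_op T p o\<^sub>L poly_op T q) x" .
qed

section \<open>The polynomial ring and its constants\<close>

lemma cpoly_ring_simps [simp]:
  "carrier cpoly_ring = UNIV" "\<one>\<^bsub>cpoly_ring\<^esub> = 1" "\<zero>\<^bsub>cpoly_ring\<^esub> = 0"
  "p \<otimes>\<^bsub>cpoly_ring\<^esub> q = p * q" "p \<oplus>\<^bsub>cpoly_ring\<^esub> q = p + q"
  by (simp_all add: cpoly_ring_def)

lemma cring_cpoly_ring: "cring (cpoly_ring :: 'd::finite cpoly ring)"
proof (rule cringI)
  show "abelian_group (cpoly_ring :: 'd cpoly ring)"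
  proof (rule abelian_groupI)
    show "\<exists>y\<in>carrier cpoly_ring. y \<oplus>\<^bsub>cpoly_ring\<^esub> x = \<zero>\<^bsub>cpoly_ring\<^esub>" for x :: "'d cpoly"
      by (rule bexI[of _ "- x"]) simp_all
  qed (simp_all add: ac_simps)
  show "Group.comm_monoid (cpoly_ring :: 'd cpoly ring)"
    by (rule comm_monoidI) (simp_all add: ac_simps)
qed (simp add: distrib_right)

lemma cpoly_ring_a_inv [simp]: "\<ominus>\<^bsub>cpoly_ring\<^esub> p = - (p :: 'd::finite cpoly)"
proof -
  interpret cring "cpoly_ring :: 'd cpoly ring"
    by (rule cring_cpoly_ring)
  show ?thesis
    by (rule minus_equality) simp_all
qed

text \<open>\<open>ring.dimension\<close> takes its scalars from a subfield of the ring. The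
  quotient inherits this one as a homomorphic image.\<close>

lemma subfield_cpoly_constants:
  "subfield (range (Poly_Mapping.single 0)) (cpoly_ring :: 'd::finite cpoly ring)"
proof -
  interpret R: cring "cpoly_ring :: 'd cpoly ring"
    by (rule cring_cpoly_ring)
  let ?K = "range (Poly_Mapping.single 0) :: 'd cpoly set"
  have ring: "subring ?K cpoly_ring"
  proof (rule R.subringI)
    show "\<one>\<^bsub>cpoly_ring\<^esub> \<in> ?K"
      by (metis cpoly_ring_simps(2) rangeI single_one)
  qed (auto simp: mult_single single_uminus[symmetric] single_add[symmetric])
  show ?thesis
  proof (rule R.subfieldI[OF R.subcringI'[OF ring]])
    have inv: "Poly_Mapping.single 0 (1 / c) * Poly_Mapping.single 0 c = (1 :: 'd cpoly)" if "c \<noteq> 0" for c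
      using that by (simp add: mult_single)
    show "Units (cpoly_ring\<lparr>carrier := ?K\<rparr>) = ?K - {\<zero>\<^bsub>cpoly_ring\<^esub>}"
    proof
      show "Units (cpoly_ring\<lparr>carrier := ?K\<rparr>) \<subseteq> ?K - {\<zero>\<^bsub>cpoly_ring\<^esub>}"
        by (auto simp: Units_def)
      show "?K - {\<zero>\<^bsub>cpoly_ring\<^esub>} \<subseteq> Units (cpoly_ring\<lparr>carrier := ?K\<rparr>)"
      proof
        fix x assume "x \<in> ?K - {\<zero>\<^bsub>cpoly_ring\<^esub>}"
        then obtain c where c: "x = Poly_Mapping.single 0 c" and "Poly_Mapping.single 0 c \<noteq> (0 :: 'd cpoly)"
          by auto
        then have "c \<noteq> 0"
          by auto
        with c inv[of c] show "x \<in> Units (cpoly_ring\<lparr>carrier := ?K\<rparr>)"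
          unfolding Units_def by (auto simp: mult.commute)
      qed
    qed
  qed
qed

section \<open>The quotient as an algebra of operators\<close>

context nilpotent_row_contraction
begin

lemma calculus_poly_op: "da_calculus T (poly_op da_shift p) = poly_op T p"
  unfolding poly_op_def
  by (rule functional_calculus_sum[OF is_functional_calculus_da_calculus]) simp

text \<open>Combines the identification of \<open>func_calc\<close> with that of
  \<open>mult_op\<close> on polynomials; from here on the ideal is handled without
  multipliers.\<close>

lemma poly_Ann_iff: "p \<in> poly_Ann T \<longleftrightarrow> poly_op T p = 0"
  by (simp add: poly_Ann_def Ann_def mult_op_poly poly_op_multiplier func_calc_eq calculus_poly_op)

lemma poly_op_times: "poly_op T (p * q) = poly_op T p o\<^sub>L poly_op T q"
  by (rule poly_op_mult[OF commuting bops])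

lemma poly_op_const_times: "poly_op T (Poly_Mapping.single 0 c * p) = c *\<^sub>C poly_op T p"
  by (simp add: poly_op_times poly_op_single blinfun_ext_iff scaleC_blinfun.rep_eq)

text \<open>The symbol may be truncated to the monomials that survive in T. Hence separating the
  polynomials in T is the same as separating all multipliers.\<close>

lemma calculus_eq_poly_op: "\<exists>p. da_calculus T M = poly_op T p"
proof -
  have "poly_op T (\<Sum>\<alpha> | op_monomial T \<alpha> \<noteq> 0. Poly_Mapping.single \<alpha> (mult_coeff M \<alpha>)) = da_calculus T M"
    by (simp add: poly_op_sum poly_op_single da_calculus_def)
  then show ?thesis
    by metis
qed

lemma ideal_poly_Ann: "ideal (poly_Ann T) cpoly_ring"
proof -
  interpret R: cring "cpoly_ring :: 'd cpoly ring"
    by (rule cring_cpoly_ring)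
  show ?thesis
  proof (rule idealI[OF R.ring_axioms R.add.subgroupI])
    have "0 \<in> poly_Ann T"
      by (simp add: poly_Ann_iff)
    then show "poly_Ann T \<noteq> {}"
      by blast
  qed (simp_all add: poly_Ann_iff poly_op_add poly_op_uminus poly_op_times flip: a_inv_def)
qed

abbreviation cls :: "'d cpoly \<Rightarrow> 'd cpoly set" where
  "cls p \<equiv> poly_Ann T +>\<^bsub>cpoly_ring\<^esub> p"

lemma cls_hom: "ring_hom_ring cpoly_ring (quotient_algebra T) cls"
  unfolding quotient_algebra_def by (rule ideal.rcos_ring_hom_ring[OF ideal_poly_Ann])

lemma cls_add: "cls p \<oplus>\<^bsub>quotient_algebra T\<^esub> cls q = cls (p + q)"
  and cls_mult: "cls p \<otimes>\<^bsub>quotient_algebra T\<^esub> cls q = cls (p * q)"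
  using ring_hom_add[OF ring_hom_ring.homh[OF cls_hom], of p q]
    ring_hom_mult[OF ring_hom_ring.homh[OF cls_hom], of p q] by simp_all

text \<open>Identifies the quotient with the algebra of polynomials in T, so that statements about
  cosets turn into equations between operators.\<close>

lemma cls_eq_iff: "cls p = cls q \<longleftrightarrow> poly_op T p = poly_op T q"
proof -
  interpret I: ideal "poly_Ann T" cpoly_ring
    by (rule ideal_poly_Ann)
  have "p \<in> cls q \<longleftrightarrow> p - q \<in> poly_Ann T"
    using I.a_rcos_module[of q p] by simp
  then have "p \<in> cls q \<longleftrightarrow> poly_op T p = poly_op T q"
    by (simp add: poly_Ann_iff poly_op_diff)
  moreover have "cls p = cls q \<longleftrightarrow> p \<in> cls q"
    using I.a_rcos_self[of p] I.a_repr_independence'[of p q] by auto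
  ultimately show ?thesis
    by simp
qed

lemma zero_quotient: "\<zero>\<^bsub>quotient_algebra T\<^esub> = cls 0"
  using ring_hom_zero[OF ring_hom_ring.homh[OF cls_hom] ring_hom_ring.axioms(1,2)[OF cls_hom]] by simp

lemma cls_eq_zero_iff: "cls p = \<zero>\<^bsub>quotient_algebra T\<^esub> \<longleftrightarrow> poly_op T p = 0"
  by (simp add: zero_quotient cls_eq_iff)

lemma carrier_quotient: "carrier (quotient_algebra T) = range cls"
  by (auto simp: quotient_algebra_def FactRing_def A_RCOSETS_def' image_def)

lemma quotient_scalars_eq: "quotient_scalars T = cls ` range (Poly_Mapping.single 0)"
  by (auto simp: quotient_scalars_def)

text \<open>On the zero space 0 and 1 have the same coset and the scalars are not a field; the
  nonzero vector excludes this.\<close>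

lemma subfield_quotient_scalars:
  assumes "(x :: 'h) \<noteq> 0"
  shows "subfield (quotient_scalars T) (quotient_algebra T)"
  unfolding quotient_scalars_eq
proof (rule ring_hom_ring.img_is_subfield(2)[OF cls_hom subfield_cpoly_constants])
  have "poly_op T 1 = id_blinfun"
    using poly_op_single[of T 0 1] by (simp add: blinfun_ext_iff scaleC_blinfun.rep_eq)
  then have "poly_op T 1 \<noteq> 0"
    using assms by (auto simp: blinfun_ext_iff)
  then show "\<one>\<^bsub>quotient_algebra T\<^esub> \<noteq> \<zero>\<^bsub>quotient_algebra T\<^esub>"
    using ring_hom_one[OF ring_hom_ring.homh[OF cls_hom]] cls_eq_zero_iff[of 1] by simp
qed

text \<open>\<open>ring.dimension\<close> is built from such extensions. This is its induction step
  in terms of operators, with \<open>E\<close> described by representatives.\<close>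

lemma line_extension_quotient:
  assumes "E \<subseteq> range cls"
  shows "cls p \<in> ring.line_extension (quotient_algebra T) (quotient_scalars T) (cls r) E
    \<longleftrightarrow> (\<exists>c s. cls s \<in> E \<and> poly_op T p = c *\<^sub>C poly_op T r + poly_op T s)"
proof -
  interpret ring "quotient_algebra T"
    using cls_hom by (rule ring_hom_ring.axioms(2))
  have ex_E: "(\<exists>v\<in>E. P v) \<longleftrightarrow> (\<exists>s. cls s \<in> E \<and> P (cls s))" for P
    using assms by blast
  have "cls p \<in> line_extension (quotient_scalars T) (cls r) E
      \<longleftrightarrow> (\<exists>c s. cls s \<in> E \<and> cls p = cls (Poly_Mapping.single 0 c * r + s))"
    unfolding line_extension_mem_iff quotient_scalars_eq ex_E bex_simps(7) cls_add cls_mult by blast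
  then show ?thesis
    unfolding cls_eq_iff poly_op_add poly_op_const_times .
qed

lemma finite_dimension_quotient:
  assumes "(x :: 'h) \<noteq> 0"
  shows "ring.finite_dimension (quotient_algebra T) (quotient_scalars T) (carrier (quotient_algebra T))"
proof -
  interpret ring "quotient_algebra T"
    using cls_hom by (rule ring_hom_ring.axioms(2))
  let ?m = "\<lambda>\<alpha>. cls (Poly_Mapping.single \<alpha> 1)"
  have scal: "quotient_scalars T \<subseteq> carrier (quotient_algebra T)"
    by (auto simp: quotient_scalars_eq carrier_quotient)
  have sub: "Span (quotient_scalars T) (map ?m as) \<subseteq> range cls" for as
    using Span_in_carrier[OF scal, of "map ?m as"] by (auto simp: carrier_quotient simp del: Span.simps)
  \<comment> \<open>\<open>Span\<close> recurses over its list, so one monomial is removed from p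
    per list element.\<close>
  have span: "cls p \<in> Span (quotient_scalars T) (map ?m as)" if "Poly_Mapping.keys p \<subseteq> set as" for as p
    using that
  proof (induction as arbitrary: p)
    case Nil
    then show ?case
      by (simp add: zero_quotient)
  next
    case (Cons \<alpha> as)
    define s where "s = p - Poly_Mapping.single \<alpha> (Poly_Mapping.lookup p \<alpha>)"
    have "Poly_Mapping.keys s \<subseteq> set as"
      using Cons.prems by (auto simp: s_def in_keys_iff lookup_minus lookup_single when_def split: if_splits)
    then have "cls s \<in> Span (quotient_scalars T) (map ?m as)"
      by (rule Cons.IH)
    moreover have "poly_op T p = Poly_Mapping.lookup p \<alpha> *\<^sub>C poly_op T (Poly_Mapping.single \<alpha> 1) + poly_op T s"
      by (simp add: s_def poly_op_diff poly_op_single blinfun_ext_iff scaleC_blinfun.rep_eq blinfun.add_left blinfun.diff_left)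
    ultimately have "cls p \<in> line_extension (quotient_scalars T) (?m \<alpha>) (Span (quotient_scalars T) (map ?m as))"
      using line_extension_quotient[OF sub] by blast
    then show ?case
      by simp
  qed
  obtain as where as: "set as = box"
    using finite_list[OF finite_index_box] by blast
  have "cls p \<in> Span (quotient_scalars T) (map ?m as)" for p
  proof -
    \<comment> \<open>Dropping the monomials outside the box changes p but not its coset.\<close>
    let ?q = "\<Sum>\<alpha>\<in>box. Poly_Mapping.single \<alpha> (Poly_Mapping.lookup p \<alpha>)"
    have "Poly_Mapping.keys ?q \<subseteq> set as"
      by (auto simp: as in_keys_iff lookup_sum lookup_single when_def split: if_splits)
    moreover have "poly_op T ?q = poly_op T p"
    proof -
      have "poly_op T p = (\<Sum>\<alpha>\<in>box \<union> Poly_Mapping.keys p. Poly_Mapping.lookup p \<alpha> *\<^sub>C op_monomial T \<alpha>)"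
        by (rule poly_op_superset) auto
      also have "\<dots> = (\<Sum>\<alpha>\<in>box. Poly_Mapping.lookup p \<alpha> *\<^sub>C op_monomial T \<alpha>)"
        by (rule sum.mono_neutral_right)
           (auto simp: monomial_eq_0 blinfun_ext_iff scaleC_blinfun.rep_eq)
      finally show ?thesis
        by (simp add: poly_op_sum poly_op_single)
    qed
    ultimately show ?thesis
      using span[of ?q as] cls_eq_iff[of ?q p] by simp
  qed
  then have "carrier (quotient_algebra T) = Span (quotient_scalars T) (map ?m as)"
    using sub[of as] by (auto simp: carrier_quotient simp del: Span.simps)
  moreover have "finite_dimension (quotient_scalars T) (Span (quotient_scalars T) (map ?m as))"
    by (rule Span_finite_dimension[OF subfield_quotient_scalars[OF assms]]) (auto simp: carrier_quotient)
  ultimately show ?thesis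
    by simp
qed

text \<open>Each step of the dimension count needs one new vector: on the annihilator of the vectors chosen
  so far the extended space is at most a line.\<close>

lemma dimension_separating:
  assumes "ring.dimension (quotient_algebra T) n (quotient_scalars T) E"
  shows "E \<subseteq> range cls
    \<and> (\<forall>c p q. cls p \<in> E \<longrightarrow> cls q \<in> E \<longrightarrow> cls (p + Poly_Mapping.single 0 c * q) \<in> E)
    \<and> (\<exists>\<eta>. \<forall>p. cls p \<in> E \<longrightarrow> (\<forall>i<n. poly_op T p (\<eta> i) = 0) \<longrightarrow> poly_op T p = 0)"
proof -
  interpret ring "quotient_algebra T"
    using cls_hom by (rule ring_hom_ring.axioms(2))
  have scal: "quotient_scalars T \<subseteq> carrier (quotient_algebra T)"
    by (auto simp: quotient_scalars_eq carrier_quotient)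
  from assms show ?thesis
  proof (induction n "quotient_scalars T" E rule: dimension.induct)
    case zero_dim
    show ?case
      by (auto simp: zero_quotient cls_eq_iff poly_op_add poly_op_const_times blinfun_ext_iff
          scaleC_blinfun.rep_eq blinfun.add_left)
  next
    case (Suc_dim v E n)
    from Suc_dim.hyps(1) obtain r where v: "v = cls r"
      by (auto simp: carrier_quotient)
    let ?E = "line_extension (quotient_scalars T) v E"
    \<comment> \<open>Closure under linear combinations is carried through the induction because the
      elimination below must end inside \<open>E\<close>.\<close>
    from Suc_dim.hyps(4) obtain \<eta> where sub: "E \<subseteq> range cls"
      and closed: "\<And>c p q. cls p \<in> E \<Longrightarrow> cls q \<in> E \<Longrightarrow> cls (p + Poly_Mapping.single 0 c * q) \<in> E"
      and \<eta>: "\<And>p. cls p \<in> E \<Longrightarrow> (\<And>i. i < n \<Longrightarrow> poly_op T p (\<eta> i) = 0) \<Longrightarrow> poly_op T p = 0"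
      by blast
    have mem: "cls p \<in> ?E \<longleftrightarrow> (\<exists>c s. cls s \<in> E \<and> poly_op T p = c *\<^sub>C poly_op T r + poly_op T s)" for p
      unfolding v by (rule line_extension_quotient[OF sub])
    have 1: "?E \<subseteq> range cls"
      using line_extension_in_carrier[OF scal, of v E] Suc_dim.hyps(1) sub by (simp add: carrier_quotient)
    have 2: "cls (p + Poly_Mapping.single 0 c * q) \<in> ?E" if "cls p \<in> ?E" "cls q \<in> ?E" for c p q
    proof -
      from that obtain a s b t where "cls s \<in> E" "poly_op T p = a *\<^sub>C poly_op T r + poly_op T s"
        "cls t \<in> E" "poly_op T q = b *\<^sub>C poly_op T r + poly_op T t"
        unfolding mem by blast
      then have "cls (s + Poly_Mapping.single 0 c * t) \<in> E"
        and "poly_op T (p + Poly_Mapping.single 0 c * q)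
          = (a + c * b) *\<^sub>C poly_op T r + poly_op T (s + Poly_Mapping.single 0 c * t)"
        by (simp_all add: closed poly_op_add poly_op_const_times blinfun_ext_iff scaleC_blinfun.rep_eq
            blinfun.add_left scaleC_add_left scaleC_add_right scaleC_scaleC)
      then show ?thesis
        unfolding mem by blast
    qed
    have 3: "\<exists>\<eta>. \<forall>p. cls p \<in> ?E \<longrightarrow> (\<forall>i<Suc n. poly_op T p (\<eta> i) = 0) \<longrightarrow> poly_op T p = 0"
    proof (cases "\<exists>p. cls p \<in> ?E \<and> (\<forall>i<n. poly_op T p (\<eta> i) = 0) \<and> poly_op T p \<noteq> 0")
      \<comment> \<open>The old vectors already separate the larger space, and whatever stands at
        position n may stay.\<close>
      case False
      then show ?thesis
        by (intro exI[of _ \<eta>]) auto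
    next
      case True
      then obtain p0 \<zeta> where p0: "cls p0 \<in> ?E" "\<And>i. i < n \<Longrightarrow> poly_op T p0 (\<eta> i) = 0"
        and \<zeta>: "poly_op T p0 \<zeta> \<noteq> 0"
        by (auto simp: blinfun_ext_iff)
      from p0(1) obtain a s where s: "cls s \<in> E" "poly_op T p0 = a *\<^sub>C poly_op T r + poly_op T s"
        unfolding mem by blast
      \<comment> \<open>Otherwise \<open>p0\<close> would act as an element of \<open>E\<close>
        killing the old vectors, hence as 0.\<close>
      have a: "a \<noteq> 0"
      proof
        assume "a = 0"
        then have p0s: "poly_op T p0 = poly_op T s"
          using s(2) by (simp add: blinfun_ext_iff scaleC_blinfun.rep_eq blinfun.add_left)
        have "poly_op T s = 0"
          by (rule \<eta>[OF s(1)]) (use p0(2) p0s in simp)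
        then show False
          using \<zeta> p0s by simp
      qed
      have "poly_op T p = 0" if p: "cls p \<in> ?E"
        and ann: "\<And>i. i < Suc n \<Longrightarrow> poly_op T p ((\<eta>(n := \<zeta>)) i) = 0" for p
      proof -
        from p obtain b t where t: "cls t \<in> E" "poly_op T p = b *\<^sub>C poly_op T r + poly_op T t"
          unfolding mem by blast
        \<comment> \<open>Subtracting \<open>b / a\<close> times \<open>p0\<close> from p eliminates
          the new direction \<open>r\<close>. The rest lies in \<open>E\<close> and kills the old
          vectors, so it is 0, and then \<zeta> forces \<open>b / a = 0\<close>.\<close>
        define q where "q = t + Poly_Mapping.single 0 (- (b / a)) * s"
        have pq: "poly_op T p x = (b / a) *\<^sub>C poly_op T p0 x + poly_op T q x" for x
        proof -
          have "(b / a) *\<^sub>C poly_op T p0 x = b *\<^sub>C poly_op T r x + (b / a) *\<^sub>C poly_op T s x"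
            using a by (simp add: s(2) blinfun.add_left scaleC_blinfun.rep_eq scaleC_add_right scaleC_scaleC)
          moreover have "poly_op T q x = poly_op T t x + (- (b / a)) *\<^sub>C poly_op T s x"
            by (simp add: q_def poly_op_add poly_op_const_times blinfun.add_left scaleC_blinfun.rep_eq)
          moreover have "(b / a) *\<^sub>C poly_op T s x + (- (b / a)) *\<^sub>C poly_op T s x = 0"
            by (simp flip: scaleC_add_left)
          ultimately show ?thesis
            by (simp add: t(2) blinfun.add_left scaleC_blinfun.rep_eq add.assoc add.left_commute)
        qed
        have "poly_op T q = 0"
        proof (rule \<eta>)
          show "cls q \<in> E"
            unfolding q_def by (rule closed[OF t(1) s(1)])
          show "poly_op T q (\<eta> i) = 0" if "i < n" for i
            using pq[of "\<eta> i"] ann[of i] p0(2)[OF that] that by simp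
        qed
        moreover have "(b / a) *\<^sub>C poly_op T p0 \<zeta> = 0"
          using pq[of \<zeta>] ann[of n] calculation by simp
        then have "b / a = 0"
          using \<zeta> norm_scaleC[of "b / a" "poly_op T p0 \<zeta>"] by simp
        ultimately show ?thesis
          using pq by (auto simp: blinfun_ext_iff simp del: divide_eq_0_iff)
      qed
      then show ?thesis
        by (intro exI[of _ "\<eta>(n := \<zeta>)"]) blast
    qed
    show ?case
      using 1 2 3 by blast
  qed
qed

section \<open>Separating vectors\<close>

lemma separating_vectors_exist:
  assumes "(x :: 'h) \<noteq> 0" "dim_quotient T \<le> CARD('s::finite)"
  shows "\<exists>\<eta> :: 'h ^ 's. \<forall>p. (\<forall>i. poly_op T p (\<eta> $ i) = 0) \<longrightarrow> poly_op T p = 0"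
proof -
  interpret ring "quotient_algebra T"
    using cls_hom by (rule ring_hom_ring.axioms(2))
  let ?n = "dim_quotient T"
  \<comment> \<open>Finite dimensionality turns the number \<open>dim_quotient T\<close> into a
    derivation of \<open>dimension\<close>, over which the induction runs.\<close>
  have "dimension ?n (quotient_scalars T) (carrier (quotient_algebra T))"
    using finite_dimensionE[OF subfield_quotient_scalars finite_dimension_quotient] assms(1)
    by (simp add: dim_quotient_def over_def)
  from dimension_separating[OF this] obtain \<eta>
    where \<eta>: "\<And>p. (\<And>i. i < ?n \<Longrightarrow> poly_op T p (\<eta> i) = 0) \<Longrightarrow> poly_op T p = 0"
    by (auto simp: carrier_quotient)
  obtain f :: "'s \<Rightarrow> nat" where f: "bij_betw f UNIV {0..<CARD('s)}"
    using ex_bij_betw_finite_nat[OF finite] by blast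
  \<comment> \<open>The coordinates are numbered from 0 up to \<open>CARD('s) - 1\<close>, which
    covers all positions below \<open>?n\<close>; any surplus coordinate only adds conditions on
    p.\<close>
  have "poly_op T p = 0" if p: "\<And>j. poly_op T p ((\<chi> j. \<eta> (f j)) $ j) = 0" for p
  proof (rule \<eta>)
    fix i assume "i < ?n"
    then have "i \<in> f ` UNIV"
      using assms(2) f by (auto simp: bij_betw_def)
    then obtain j where "i = f j"
      by blast
    then show "poly_op T p (\<eta> i) = 0"
      using p[of j] by simp
  qed
  then show ?thesis
    by (intro exI[of _ "\<chi> j. \<eta> (f j)"]) blast
qed

lemma adj_ampliation: "adj (ampliation T k :: ('h ^ 's::finite) \<Rightarrow>\<^sub>L ('h ^ 's)) = blinfun_ampl (adj (T k))"
  by (rule adj_unique)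
     (simp add: cinner_vec_def blinfun_ampl.rep_eq adj_cinner[OF bops])

text \<open>Separation for the ampliation refers to the calculus of the ampliation itself, which is
  thereby given by \<open>da_calculus\<close> as well.\<close>

lemma nilpotent_row_contraction_ampliation:
  "nilpotent_row_contraction (ampliation T :: ('d, 'h ^ 's::finite) op_tuple)"
proof
  show "ampliation T k \<in> (bops :: (('h ^ 's) \<Rightarrow>\<^sub>L ('h ^ 's)) set)" for k
    by (simp add: bops_def vec_eq_iff scaleC_vec_def bopsD[OF bops])
  have "T j (T k x) = T k (T j x)" for j k x
    using commuting unfolding commuting_tuple_def by (metis blinfun_apply_blinfun_compose)
  then show "commuting_tuple (ampliation T :: ('d, 'h ^ 's) op_tuple)"
    by (auto simp: commuting_tuple_def blinfun_ext_iff vec_eq_iff)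
  have *: "cinner ((id_blinfun - (\<Sum>k\<in>UNIV. ampliation T k o\<^sub>L adj (ampliation T k))) v) v
      = (\<Sum>i\<in>UNIV. cinner ((id_blinfun - (\<Sum>k\<in>UNIV. T k o\<^sub>L adj (T k))) (v $ i)) (v $ i))" for v :: "'h ^ 's"
    by (simp add: cinner_vec_def adj_ampliation blinfun.diff_left blinfun.sum_left blinfun_ampl.rep_eq)
  show "row_contraction (ampliation T :: ('d, 'h ^ 's) op_tuple)"
    unfolding row_contraction_def op_le_def *
    using contraction unfolding row_contraction_def op_le_def
    by (auto intro: sum_in_Reals sum_nonneg)
  have pow: "(blinfun_apply (ampliation T k) ^^ m) v $ i = (blinfun_apply (T k) ^^ m) (v $ i)"
    for k m i and v :: "'h ^ 's"
    by (induction m) simp_all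
  show "nilpotent_tuple (ampliation T :: ('d, 'h ^ 's) op_tuple)"
    using nilpotent unfolding nilpotent_tuple_def by (simp add: vec_eq_iff pow) metis
qed

lemma calculus_ampliation:
  "da_calculus (ampliation T :: ('d, 'h ^ 's::finite) op_tuple) M v $ i = da_calculus T M (v $ i)"
proof -
  interpret A: nilpotent_row_contraction "ampliation T :: ('d, 'h ^ 's) op_tuple"
    by (rule nilpotent_row_contraction_ampliation)
  note mono = op_monomial_ampliation[OF commuting A.commuting]
  have "op_monomial (ampliation T :: ('d, 'h ^ 's) op_tuple) \<alpha> = 0 \<longleftrightarrow> op_monomial T \<alpha> = 0" for \<alpha>
  proof
    assume 0: "op_monomial (ampliation T :: ('d, 'h ^ 's) op_tuple) \<alpha> = 0"
    have "op_monomial T \<alpha> x = 0" for x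
    proof -
      have "op_monomial (ampliation T :: ('d, 'h ^ 's) op_tuple) \<alpha> (\<chi> i. x) $ i = 0"
        by (simp add: 0)
      then show ?thesis
        by (simp add: mono blinfun_ampl.rep_eq)
    qed
    then show "op_monomial T \<alpha> = 0"
      by (simp add: blinfun_ext_iff)
  qed (simp add: mono blinfun_ext_iff blinfun_ampl.rep_eq vec_eq_iff)
  then show ?thesis
    by (simp add: da_calculus_def blinfun_scaleC_sum_apply mono blinfun_ampl.rep_eq scaleC_vec_def)
qed

text \<open>By \<open>calculus_eq_poly_op\<close> every multiplier acts as a polynomial in T, in
  each coordinate the same one.\<close>

lemma separating_ampliationI:
  fixes \<xi> :: "'h ^ 's::finite"
  assumes "\<And>p. (\<And>i. poly_op T p (\<xi> $ i) = 0) \<Longrightarrow> poly_op T p = 0"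
  shows "separating (ampliation T) \<xi>"
proof -
  interpret A: nilpotent_row_contraction "ampliation T :: ('d, 'h ^ 's) op_tuple"
    by (rule nilpotent_row_contraction_ampliation)
  show ?thesis
    unfolding separating_def
  proof (intro ballI impI)
    fix M :: "'d drury_arveson \<Rightarrow>\<^sub>L 'd drury_arveson"
    assume M: "M \<in> multiplier_algebra" and 0: "func_calc M (ampliation T) \<xi> = 0"
    obtain p where p: "da_calculus T M = poly_op T p"
      using calculus_eq_poly_op by blast
    have "poly_op T p (\<xi> $ i) = 0" for i
      using 0 calculus_ampliation[of M \<xi> i] by (simp add: A.func_calc_eq[OF M] p)
    then have "da_calculus T M = 0"
      unfolding p by (rule assms)
    then show "func_calc M (ampliation T :: ('d, 'h ^ 's) op_tuple) = 0"
      by (simp add: A.func_calc_eq[OF M] blinfun_ext_iff vec_eq_iff calculus_ampliation)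
  qed
qed

text \<open>Annihilators \<open>A t\<close> of \<open>\<zeta> + t \<eta>\<close> behave like eigenvectors of a linear pencil: for distinct \<open>t\<close>
  they are linearly independent.\<close>

lemma pencil_independent:
  fixes \<eta> \<zeta> :: "'h ^ 's::finite"
  assumes \<eta>: "\<And>p. (\<And>i. poly_op T p (\<eta> $ i) = 0) \<Longrightarrow> poly_op T p = 0"
    and S: "finite S"
    and A: "\<And>t i. t \<in> S \<Longrightarrow> poly_op T (q t) (\<zeta> $ i) = - t *\<^sub>R poly_op T (q t) (\<eta> $ i)"
    and ne: "\<And>t. t \<in> S \<Longrightarrow> poly_op T (q t) \<noteq> 0"
    and sum: "(\<Sum>t\<in>S. c t *\<^sub>R poly_op T (q t)) = 0"
  shows "\<forall>t\<in>S. c t = 0"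
  using S A ne sum
proof (induction S arbitrary: c rule: finite_induct)
  case (insert t0 S)
  let ?P = "\<lambda>t. poly_op T (q t)"
  have scaleR: "r *\<^sub>R ?P t = poly_op T (Poly_Mapping.single 0 (complex_of_real r) * q t)" for r t
    by (simp add: poly_op_const_times blinfun_ext_iff scaleC_blinfun.rep_eq blinfun.scaleR_left scaleR_scaleC)
  \<comment> \<open>Weighting the relation by t makes the pencil identity applicable: at
    \<open>\<eta> $ i\<close> this polynomial equals minus the given relation at
    \<open>\<zeta> $ i\<close>, that is 0.\<close>
  let ?p = "\<Sum>t\<in>insert t0 S. Poly_Mapping.single 0 (complex_of_real (c t * t)) * q t"
  have p: "poly_op T ?p = (\<Sum>t\<in>insert t0 S. (c t * t) *\<^sub>R ?P t)"
    unfolding poly_op_sum scaleR ..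
  have "poly_op T ?p = 0"
  proof (rule \<eta>)
    fix i
    have "poly_op T ?p (\<eta> $ i) = - (\<Sum>t\<in>insert t0 S. c t *\<^sub>R ?P t) (\<zeta> $ i)"
      unfolding p blinfun.sum_left sum_negf[symmetric]
    proof (rule sum.cong[OF refl])
      fix t assume "t \<in> insert t0 S"
      then show "((c t * t) *\<^sub>R ?P t) (\<eta> $ i) = - (c t *\<^sub>R ?P t) (\<zeta> $ i)"
        using insert.prems(1)[of t i] by (simp add: blinfun.scaleR_left)
    qed
    then show "poly_op T ?p (\<eta> $ i) = 0"
      using insert.prems(3) by simp
  qed
  \<comment> \<open>As for eigenvectors, \<open>t0\<close> times the relation is subtracted from its
    weighted version, which removes the term of \<open>t0\<close>.\<close>
  then have "(\<Sum>t\<in>insert t0 S. (c t * t) *\<^sub>R ?P t) - t0 *\<^sub>R (\<Sum>t\<in>insert t0 S. c t *\<^sub>R ?P t) = 0"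
    unfolding p by (simp only: insert.prems(3) scaleR_zero_right diff_zero)
  then have "(\<Sum>t\<in>insert t0 S. (c t * (t - t0)) *\<^sub>R ?P t) = 0"
    by (simp only: scaleR_sum_right sum_subtractf[symmetric])
       (simp add: algebra_simps)
  then have "(\<Sum>t\<in>S. (c t * (t - t0)) *\<^sub>R ?P t) = 0"
    using insert.hyps by simp
  then have "\<forall>t\<in>S. c t * (t - t0) = 0"
    by (intro insert.IH insert.prems) auto
  then have c: "\<forall>t\<in>S. c t = 0"
    using insert.hyps by auto
  then have "c t0 *\<^sub>R ?P t0 = 0"
    using insert.prems(3) insert.hyps by simp
  then show ?case
    using c insert.prems(2)[of t0] by simp
qed simp

text \<open>The polynomials in T lie in a real space spanned by finitely many operators, while by
  \<open>pencil_independent\<close> every bad t contributes one member of an independent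
  family.\<close>

lemma finite_nonseparating_parameters:
  fixes \<eta> \<zeta> :: "'h ^ 's::finite"
  assumes \<eta>: "\<And>p. (\<And>i. poly_op T p (\<eta> $ i) = 0) \<Longrightarrow> poly_op T p = 0"
  shows "finite {t :: real. \<exists>p. poly_op T p \<noteq> 0 \<and> (\<forall>i. poly_op T p ((\<zeta> + t *\<^sub>R \<eta>) $ i) = 0)}"
    (is "finite ?N")
proof (rule ccontr)
  \<comment> \<open>Independence is over the reals, as t is real, so the multiples by
    \<open>\<i>\<close> are needed as further generators.\<close>
  define G where "G = op_monomial T ` box \<union> (\<lambda>\<alpha>. \<i> *\<^sub>C op_monomial T \<alpha>) ` box"
  have G: "finite G"
    by (simp add: G_def)
  have span: "poly_op T p \<in> span G" for p
  proof -
    have "poly_op T p = (\<Sum>\<alpha>\<in>Poly_Mapping.keys p \<inter> box. Poly_Mapping.lookup p \<alpha> *\<^sub>C op_monomial T \<alpha>)"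
      unfolding poly_op_def
      by (rule sum.mono_neutral_right) (auto simp: monomial_eq_0 blinfun_ext_iff scaleC_blinfun.rep_eq)
    also have "\<dots> \<in> span G"
    proof (rule span_sum)
      fix \<alpha> assume "\<alpha> \<in> Poly_Mapping.keys p \<inter> box"
      then have "Re c *\<^sub>R op_monomial T \<alpha> + Im c *\<^sub>R (\<i> *\<^sub>C op_monomial T \<alpha>) \<in> span G" for c
        by (intro span_add span_scale span_base) (auto simp: G_def)
      moreover have "Re c *\<^sub>R op_monomial T \<alpha> + Im c *\<^sub>R (\<i> *\<^sub>C op_monomial T \<alpha>) = c *\<^sub>C op_monomial T \<alpha>" for c
      proof (rule blinfun_eqI)
        fix x
        have "complex_of_real (Re c) + complex_of_real (Im c) * \<i> = c"
          by (simp add: complex_eq_iff)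
        then show "(Re c *\<^sub>R op_monomial T \<alpha> + Im c *\<^sub>R (\<i> *\<^sub>C op_monomial T \<alpha>)) x = (c *\<^sub>C op_monomial T \<alpha>) x"
          by (simp add: blinfun.add_left blinfun.scaleR_left scaleC_blinfun.rep_eq scaleR_scaleC scaleC_scaleC
              scaleC_add_left[symmetric])
      qed
      ultimately show "Poly_Mapping.lookup p \<alpha> *\<^sub>C op_monomial T \<alpha> \<in> span G"
        by simp
    qed
    finally show ?thesis .
  qed
  assume "infinite ?N"
  then obtain S where S: "S \<subseteq> ?N" "finite S" "card S = Suc (card G)"
    using infinite_arbitrarily_large by blast
  then have "\<forall>t\<in>S. \<exists>p. poly_op T p \<noteq> 0 \<and> (\<forall>i. poly_op T p ((\<zeta> + t *\<^sub>R \<eta>) $ i) = 0)"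
    by blast
  then obtain q where q: "\<And>t. t \<in> S \<Longrightarrow> poly_op T (q t) \<noteq> 0"
    and q0: "\<And>t i. t \<in> S \<Longrightarrow> poly_op T (q t) ((\<zeta> + t *\<^sub>R \<eta>) $ i) = 0"
    by metis
  have pen: "poly_op T (q t) (\<zeta> $ i) = - t *\<^sub>R poly_op T (q t) (\<eta> $ i)" if "t \<in> S" for t i
    using q0[OF that, of i] by (simp add: blinfun.add_right blinfun.scaleR_right eq_neg_iff_add_eq_0)
  have indep: "\<forall>t\<in>S. c t = 0" if "(\<Sum>t\<in>S. c t *\<^sub>R poly_op T (q t)) = 0" for c
    by (rule pencil_independent[where \<eta> = \<eta> and \<zeta> = \<zeta> and q = q, OF \<eta> S(2)]) (use pen q that in auto)
  \<comment> \<open>Two equal operators for distinct parameters would give the relation with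
    coefficients 1 and -1. Injectivity makes the family as large a set as \<open>S\<close>.\<close>
  have inj: "inj_on (\<lambda>t. poly_op T (q t)) S"
  proof (rule inj_onI, rule ccontr)
    fix t u assume tu: "t \<in> S" "u \<in> S" "poly_op T (q t) = poly_op T (q u)" "t \<noteq> u"
    have "(\<Sum>v\<in>S. (if v = t then 1 else if v = u then - 1 else 0) *\<^sub>R poly_op T (q v))
        = (\<Sum>v\<in>{t, u}. (if v = t then 1 else if v = u then - 1 else 0) *\<^sub>R poly_op T (q v))"
      using S(2) tu by (intro sum.mono_neutral_right) auto
    also have "\<dots> = 0"
      using tu by simp
    finally show False
      using indep[of "\<lambda>v. if v = t then 1 else if v = u then - 1 else 0"] tu(1) by auto
  qed
  have "independent ((\<lambda>t. poly_op T (q t)) ` S)"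
  proof (rule real_vector.independent_if_scalars_zero)
    fix f x assume f: "(\<Sum>x\<in>(\<lambda>t. poly_op T (q t)) ` S. f x *\<^sub>R x) = 0" and x: "x \<in> (\<lambda>t. poly_op T (q t)) ` S"
    from f have "(\<Sum>t\<in>S. f (poly_op T (q t)) *\<^sub>R poly_op T (q t)) = 0"
      by (simp add: sum.reindex[OF inj])
    then have "\<forall>t\<in>S. f (poly_op T (q t)) = 0"
      by (rule indep)
    then show "f x = 0"
      using x by blast
  qed (use S in simp)
  then have "card ((\<lambda>t. poly_op T (q t)) ` S) \<le> card G"
    using independent_span_bound[OF G] span by blast
  then show False
    using card_image[OF inj] S(3) by simp
qed

lemma dense_separating:
  assumes "dim_quotient T \<le> CARD('s::finite)"
  shows "closure {\<xi> :: 'h ^ 's. separating (ampliation T) \<xi>} = UNIV"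
proof (cases "\<exists>x :: 'h. x \<noteq> 0")
  \<comment> \<open>On the zero space the quotient has no scalar field and its dimension says
    nothing, but every vector separates.\<close>
  case False
  then have "poly_op T p = 0" for p
    by (simp add: blinfun_ext_iff)
  then have "separating (ampliation T) \<xi>" for \<xi> :: "'h ^ 's"
    by (rule separating_ampliationI)
  then show ?thesis
    by simp
next
  case True
  then obtain \<eta> :: "'h ^ 's" where \<eta>: "\<And>p. (\<And>i. poly_op T p (\<eta> $ i) = 0) \<Longrightarrow> poly_op T p = 0"
    using separating_vectors_exist[OF _ assms] by blast
  have "\<exists>\<xi>. separating (ampliation T) \<xi> \<and> dist \<xi> \<zeta> < e" if e: "e > 0" for \<zeta> :: "'h ^ 's" and e
  proof -
    \<comment> \<open>The summand 1 avoids division by 0 if \<eta> is 0; for \<open>t < d\<close>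
      the displacement \<open>t * norm \<eta>\<close> is below e.\<close>
    define d where "d = e / (norm \<eta> + 1)"
    have d: "d > 0"
      using e by (simp add: d_def add_nonneg_pos)
    have "\<not> {0<..<d} \<subseteq> {t :: real. \<exists>p. poly_op T p \<noteq> 0 \<and> (\<forall>i. poly_op T p ((\<zeta> + t *\<^sub>R \<eta>) $ i) = 0)}"
      using finite_subset[OF _ finite_nonseparating_parameters[OF \<eta>]] infinite_Ioo[OF d] by blast
    then obtain t where t: "0 < t" "t < d"
      and "t \<notin> {t :: real. \<exists>p. poly_op T p \<noteq> 0 \<and> (\<forall>i. poly_op T p ((\<zeta> + t *\<^sub>R \<eta>) $ i) = 0)}"
      by (auto simp only: subset_iff greaterThanLessThan_iff)
    then have good: "\<And>p. (\<And>i. poly_op T p ((\<zeta> + t *\<^sub>R \<eta>) $ i) = 0) \<Longrightarrow> poly_op T p = 0"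
      by blast
    have "dist (\<zeta> + t *\<^sub>R \<eta>) \<zeta> = t * norm \<eta>"
      using t by (simp add: dist_norm)
    also have "\<dots> \<le> t * (norm \<eta> + 1)"
      using t by simp
    also have "\<dots> < d * (norm \<eta> + 1)"
      using t by (intro mult_strict_right_mono) (simp_all add: add_nonneg_pos)
    also have "\<dots> = e"
      using add_nonneg_pos[OF norm_ge_zero[of \<eta>] zero_less_one] by (simp add: d_def)
    finally show ?thesis
      using separating_ampliationI[OF good] by blast
  qed
  then show ?thesis
    by (auto simp: closure_approachable)
qed

end

theorem theorem1p4:
  fixes T :: "'d::finite \<Rightarrow> ('h::chilbert_space \<Rightarrow>\<^sub>L 'h)"
  assumes "\<And>k. T k \<in> bops"
    and "commuting_tuple T"
    and "row_contraction T"
    and "nilpotent_tuple T"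
    and "dim_quotient T \<le> CARD('s::finite)"
  shows "closure {\<xi> :: 'h ^ 's. separating (ampliation T) \<xi>} = UNIV"
proof -
  interpret nilpotent_row_contraction T
    by unfold_locales (fact assms)+
  show ?thesis
    by (rule dense_separating) fact
qed

end
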